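(* Let $E\subset\mathbb{R}^2$ be a nonpolar compact set, and let $X$, $U$, $\Phi_h$, $E_h$, $I(h)$, $\mu_h$ be as defined in the context. Then the map $h\mapsto I(h)$ is $C^1$ (continuously Fréchet differentiable) on the open set $U\subset X$, and for every $h\in U$ and $q\in X$, $$DI(h)[q]=-\int\int_{E\times E}\frac{(\Phi_h(x)-\Phi_h(y))\cdot(q(x)-q(y))}{|\Phi_h(x)-\Phi_h(y)|^2}\,d\mu_h(x)\,d\mu_h(y).$$
   Context: For a compact set $K\subset\mathbb{R}^2$, with $\mathcal{P}(K)$ the Borel probability measures on $K$, the logarithmic potential energy is $I(K)=\inf_{\mu\in\mathcal{P}(K)}\int_{K\times K}\log(|x-y|^{-1})\,d\mu(x)\,d\mu(y)$; $K$ is nonpolar if $I(K)<\infty$, in which case the minimizer exists, is unique and is atomless, and is called the equilibrium measure of $K$. Fix a nonpolar compact $E\subset\mathbb{R}^2$. Let $X=W^{1,\infty}(E;\mathbb{R}^2)$, understood as the space of Lipschitz maps $h:E\to\mathbb{R}^2$ with norm $\|h\|_X=\|h\|_{L^\infty}+\mathrm{Lip}(h;E)$, where $\mathrm{Lip}(h;E)$ is the best Lipschitz constant of $h$ on $E$ and $\|h\|_{L^\infty}$ is the supremum of $|h|$ over $E$. Let $U=\{h\in X:\mathrm{Lip}(h;E)<1\}$. For $h\in U$ let $\Phi_h(x)=x+h(x)$ for $x\in E$ (a bi-Lipschitz map onto its image), $E_h=\Phi_h(E)$, and $I(h):=I(E_h)$. Then $I(h)=\min_{\mu\in\mathcal{P}(E)}\int\int_{E\times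 E}-\log|\Phi_h(x)-\Phi_h(y)|\,d\mu(x)\,d\mu(y)$, and $\mu_h\in\mathcal{P}(E)$ denotes the minimizer; equivalently, $(\Phi_h)_*\mu_h$ is the equilibrium measure of $E_h$. The integrand in the formula is defined for $x\ne y$; the diagonal has zero $\mu_h\otimes\mu_h$-measure. *)

theory Defs
  imports "HOL-Probability.Probability"
begin

type_synonym plane = "real^2"

section \<open>Logarithmic energy\<close>

text \<open>The value on the diagonal is \<open>\<infinity>\<close>; it has to be given explicitly because \<open>ln 0 = 0\<close> in HOL.\<close>

definition log_kernel :: "plane \<Rightarrow> plane \<Rightarrow> ereal" where
  "log_kernel x y = (if x = y then \<infinity> else ereal (ln (inverse (dist x y))))"

text \<open>Lebesgue integral of an extended-real function as the integral of the positive part minus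
  that of the negative part (\<open>e2ennreal\<close> sends negative numbers to \<open>0\<close>). It is only meaningful if
  one of the two is finite; the logarithmic kernel is bounded below on bounded sets.\<close>

definition ereal_integral :: "'a measure \<Rightarrow> ('a \<Rightarrow> ereal) \<Rightarrow> ereal" where
  "ereal_integral M f =
     enn2ereal (\<integral>\<^sup>+ x. e2ennreal (f x) \<partial>M) - enn2ereal (\<integral>\<^sup>+ x. e2ennreal (- f x) \<partial>M)"

definition borel_probs :: "plane set \<Rightarrow> plane measure set" where
  "borel_probs K = {\<mu>. prob_space \<mu> \<and> sets \<mu> = sets (restrict_space borel K)}"

definition log_energy :: "(plane \<Rightarrow> plane) \<Rightarrow> plane measure \<Rightarrow> ereal" where
  "log_energy \<Phi> \<mu> = ereal_integral (\<mu> \<Otimes>\<^sub>M \<mu>) (\<lambda>(x, y). log_kernel (\<Phi> x) (\<Phi> y))"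

definition min_energy :: "plane set \<Rightarrow> ereal" where
  "min_energy K = (INF \<mu>\<in>borel_probs K. log_energy (\<lambda>x. x) \<mu>)"

definition nonpolar :: "plane set \<Rightarrow> bool" where
  "nonpolar K \<longleftrightarrow> min_energy K < \<infinity>"

section \<open>Lipschitz perturbations\<close>

text \<open>A map defined on \<open>E\<close> is represented by its extension by zero, so that \<open>W1inf_norm E\<close> is a
  norm, and not merely a seminorm, on \<open>W1inf E\<close>.\<close>

definition W1inf :: "plane set \<Rightarrow> (plane \<Rightarrow> plane) set" where
  "W1inf E = {h. (\<exists>L. L-lipschitz_on E h) \<and> (\<forall>x. x \<notin> E \<longrightarrow> h x = 0)}"

definition Lip :: "plane set \<Rightarrow> (plane \<Rightarrow> plane) \<Rightarrow> real" where
  "Lip E h = Inf {L. L-lipschitz_on E h}"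

definition W1inf_norm :: "plane set \<Rightarrow> (plane \<Rightarrow> plane) \<Rightarrow> real" where
  "W1inf_norm E h = (SUP x\<in>E. norm (h x)) + Lip E h"

definition contractions :: "plane set \<Rightarrow> (plane \<Rightarrow> plane) set" where
  "contractions E = {h \<in> W1inf E. Lip E h < 1}"

definition perturb :: "(plane \<Rightarrow> plane) \<Rightarrow> plane \<Rightarrow> plane" where
  "perturb h x = x + h x"

definition energy_of :: "plane set \<Rightarrow> (plane \<Rightarrow> plane) \<Rightarrow> real" where
  "energy_of E h = real_of_ereal (min_energy (perturb h ` E))"

text \<open>The measure lives on \<open>E\<close>; its image under \<open>perturb h\<close> is the equilibrium measure of
  \<open>perturb h ` E\<close>. The minimizer exists and is unique for nonpolar compact \<open>E\<close> and \<open>h\<close> with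
  \<open>Lip E h < 1\<close>.\<close>

definition equilibrium :: "plane set \<Rightarrow> (plane \<Rightarrow> plane) \<Rightarrow> plane measure" where
  "equilibrium E h = (THE \<mu>. \<mu> \<in> borel_probs E \<and>
     (\<forall>\<nu>\<in>borel_probs E. log_energy (perturb h) \<mu> \<le> log_energy (perturb h) \<nu>))"

section \<open>Differential calculus on a normed space of functions\<close>

text \<open>The space \<open>W1inf E\<close> depends on the set \<open>E\<close>, so it is not a type and the library's
  \<open>has_derivative\<close> does not apply to it. Below, \<open>V\<close> is a space of functions that is closed under
  the pointwise operations and \<open>N\<close> is a norm on it.\<close>

definition norm_open ::
  "('a \<Rightarrow> 'b::real_normed_vector) set \<Rightarrow> (('a \<Rightarrow> 'b) \<Rightarrow> real) \<Rightarrow> ('a \<Rightarrow> 'b) set \<Rightarrow> bool" where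
  "norm_open V N U \<longleftrightarrow> U \<subseteq> V \<and>
     (\<forall>h\<in>U. \<exists>\<delta>>0. \<forall>g\<in>V. N (\<lambda>x. g x - h x) < \<delta> \<longrightarrow> g \<in> U)"

definition bounded_functional ::
  "('a \<Rightarrow> 'b::real_normed_vector) set \<Rightarrow> (('a \<Rightarrow> 'b) \<Rightarrow> real) \<Rightarrow> (('a \<Rightarrow> 'b) \<Rightarrow> real) \<Rightarrow> bool" where
  "bounded_functional V N L \<longleftrightarrow>
     (\<forall>q\<in>V. \<forall>r\<in>V. L (\<lambda>x. q x + r x) = L q + L r) \<and>
     (\<forall>c. \<forall>q\<in>V. L (\<lambda>x. c *\<^sub>R q x) = c * L q) \<and>
     (\<exists>B. \<forall>q\<in>V. \<bar>L q\<bar> \<le> B * N q)"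

definition dual_norm ::
  "('a \<Rightarrow> 'b::real_normed_vector) set \<Rightarrow> (('a \<Rightarrow> 'b) \<Rightarrow> real) \<Rightarrow> (('a \<Rightarrow> 'b) \<Rightarrow> real) \<Rightarrow> real" where
  "dual_norm V N L = (SUP q\<in>{q \<in> V. N q \<le> 1}. \<bar>L q\<bar>)"

definition has_frechet_derivative_on ::
  "('a \<Rightarrow> 'b::real_normed_vector) set \<Rightarrow> (('a \<Rightarrow> 'b) \<Rightarrow> real) \<Rightarrow> ('a \<Rightarrow> 'b) set \<Rightarrow>
   (('a \<Rightarrow> 'b) \<Rightarrow> real) \<Rightarrow> (('a \<Rightarrow> 'b) \<Rightarrow> real) \<Rightarrow> ('a \<Rightarrow> 'b) \<Rightarrow> bool" where
  "has_frechet_derivative_on V N U F L h \<longleftrightarrow> bounded_functional V N L \<and>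
     (\<forall>\<epsilon>>0. \<exists>\<delta>>0. \<forall>q\<in>V. (\<lambda>x. h x + q x) \<in> U \<and> N q < \<delta> \<longrightarrow>
        \<bar>F (\<lambda>x. h x + q x) - F h - L q\<bar> \<le> \<epsilon> * N q)"

text \<open>\<open>F\<close> is continuously Frechet differentiable on the open set \<open>U\<close>, with derivative \<open>DF\<close>.\<close>

definition C1_on ::
  "('a \<Rightarrow> 'b::real_normed_vector) set \<Rightarrow> (('a \<Rightarrow> 'b) \<Rightarrow> real) \<Rightarrow> ('a \<Rightarrow> 'b) set \<Rightarrow>
   (('a \<Rightarrow> 'b) \<Rightarrow> real) \<Rightarrow> (('a \<Rightarrow> 'b) \<Rightarrow> ('a \<Rightarrow> 'b) \<Rightarrow> real) \<Rightarrow> bool" where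
  "C1_on V N U F DF \<longleftrightarrow> norm_open V N U \<and>
     (\<forall>h\<in>U. has_frechet_derivative_on V N U F (DF h) h) \<and>
     (\<forall>h\<in>U. \<forall>\<epsilon>>0. \<exists>\<delta>>0. \<forall>g\<in>U. N (\<lambda>x. g x - h x) < \<delta> \<longrightarrow>
        dual_norm V N (\<lambda>q. DF g q - DF h q) < \<epsilon>)"

end

theory Submission
  imports Defs
begin

text \<open>
  For fixed \<open>\<mu>\<close> the energy of \<open>\<mu>\<close> under \<open>perturb h\<close> is smooth in \<open>h\<close>, uniformly in \<open>\<mu>\<close>: the kernel
  changes by the logarithm of a quotient of distances, which is bounded with all its derivatives
  off the diagonal because \<open>perturb h\<close> is bi-Lipschitz. Comparing the minimizers at \<open>h\<close> and
  \<open>h + q\<close> with each other (Danskin's argument) therefore reduces both differentiability and the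
  continuity of the derivative to the continuity of the derivative formula along equilibrium
  measures. By compactness, lower semicontinuity of the energy and uniqueness, these measures
  converge weakly. The integrand of the formula is discontinuous only at the diagonal, near which
  measures of bounded energy carry little mass, so weak convergence suffices, uniformly in \<open>q\<close>.

  Weak compactness is transferred from the real line (Helly) along a space-filling curve.
  Uniqueness comes from writing the logarithm as a positive superposition of Gaussians
  (Frullani) and expanding the Gaussian kernel into products of moments.
\<close>

section \<open>A space-filling curve\<close>

text \<open>Every estimate sees a perturbation \<open>q\<close> only through its increments
  \<open>q x - q y\<close>, so \<open>Lip E q\<close> alone controls everything and the supremum
  part of the norm enters only at the end. The size of a perturbation is measured by
  \<open>Lip E q / (1 - Lip E h)\<close>, the relative change of distances between image points.

  The obstacle is the dual norm. A difference quotient of a Lipschitz map need not have a limit at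
  the diagonal, so the integrands for different \<open>q\<close> have no common modulus of
  continuity until they are cut off there; after the cut-off they have one. The cut-off error comes
  from a Markov inequality for the logarithmic kernel, which asks for one energy bound, with respect
  to the same \<open>h\<close>, for all nearby equilibrium measures. The chain of inequalities
  giving this bound also shows that those measures nearly minimize the energy at \<open>h\<close>.

  Energies are shifted by \<open>ln D\<close> into \<open>ennreal\<close>, with one \<open>D\<close>
  for all contractions. Sums and Tonelli then hold without integrability conditions; the price is
  that identities are written without subtraction.\<close>

definition hat :: "real \<Rightarrow> real" where
  "hat u = max 0 (min 1 (1/2 - cos (pi * u)))"

lemma hat_nonneg: "0 \<le> hat u" and hat_le_1: "hat u \<le> 1"
  by (auto simp: hat_def)

lemma hat_periodic: "hat (2 * real m + u) = hat u"
proof -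
  have "cos (pi * (2 * real m + u)) = cos (pi * u)"
    using cos_2npi[of m] sin_2npi[of m] by (simp add: distrib_left cos_add mult.commute mult.left_commute)
  then show ?thesis by (simp add: hat_def)
qed

text \<open>The clamp is flat on the outer thirds of [0, 1] because \<open>cos (pi * u)\<close>
  passes 1/2 at u = 1/3 and -1/2 at u = 2/3. A clamped cosine is continuous and periodic without any
  gluing.\<close>

lemma hat_eq_0:
  assumes "0 \<le> u" "u \<le> 1/3" shows "hat u = 0"
proof -
  have "cos (pi / 3) \<le> cos (pi * u)"
    using assms pi_gt_zero by (intro cos_monotone_0_pi_le) (auto simp: field_simps)
  then show ?thesis by (simp add: hat_def cos_60)
qed

lemma hat_eq_1:
  assumes "2/3 \<le> u" "u \<le> 1" shows "hat u = 1"
proof -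
  have "cos (pi * u) \<le> cos (2 * (pi / 3))"
    using assms pi_gt_zero by (intro cos_monotone_0_pi_le) (auto simp: field_simps)
  then show ?thesis by (simp add: hat_def cos_120)
qed

text \<open>Schoenberg's curve: if the ternary digits of \<open>t\<close> are \<open>2 a\<^sub>n\<close>, then \<open>hat (3 ^ k * t) = a\<^sub>k\<close>, so the two
  coordinates \<open>schoenberg 0 t\<close> and \<open>schoenberg 1 t\<close> have the binary digits \<open>a\<^sub>2\<^sub>n\<close> and \<open>a\<^sub>2\<^sub>n\<^sub>+\<^sub>1\<close>.\<close>

definition schoenberg :: "nat \<Rightarrow> real \<Rightarrow> real" where
  "schoenberg i t = (\<Sum>n. hat (3 ^ (2 * n + i) * t) / 2 ^ Suc n)"

lemma continuous_on_schoenberg: "continuous_on A (schoenberg i)"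
proof -
  have sm: "summable (\<lambda>n. 1 / 2 ^ Suc n :: real)"
    using summable_mult[OF summable_geometric[of "1/2::real"], of "1/2"] by (simp add: power_one_over)
  have "uniform_limit UNIV (\<lambda>n t. \<Sum>k<n. hat (3 ^ (2 * k + i) * t) / 2 ^ Suc k) (schoenberg i) sequentially"
    unfolding schoenberg_def
    by (rule Weierstrass_m_test[OF _ sm]) (auto simp: hat_nonneg hat_le_1 divide_right_mono)
  then have "continuous_on UNIV (schoenberg i)"
    by (rule uniform_limit_theorem[rotated])
       (auto intro!: always_eventually continuous_intros simp: hat_def)
  then show ?thesis
    using continuous_on_subset by blast
qed

text \<open>For a 0-1 sequence \<open>a\<close> this is a point of the Cantor set. Avoiding the
  digit 1 keeps every shifted point in an outer third, where \<open>hat\<close> is constant.\<close>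

definition ternary :: "(nat \<Rightarrow> nat) \<Rightarrow> real" where
  "ternary a = (\<Sum>n. 2 * real (a n) / 3 ^ Suc n)"

lemma ternary_summable:
  assumes "\<And>n. a n \<le> 1" shows "summable (\<lambda>n. 2 * real (a n) / 3 ^ Suc n)"
proof (rule summable_comparison_test)
  show "summable (\<lambda>n. 2 / 3 * (1/3) ^ n :: real)"
    by (intro summable_mult summable_geometric) auto
  show "\<exists>N. \<forall>n\<ge>N. norm (2 * real (a n) / 3 ^ Suc n) \<le> 2 / 3 * (1/3) ^ n"
    using assms by (auto simp: power_one_over divide_simps)
qed

lemma ternary_shift:
  assumes "\<And>n. a n \<le> 1" shows "3 * ternary a = 2 * real (a 0) + ternary (\<lambda>n. a (Suc n))"
proof -
  have "(\<Sum>n. 2 * real (a (Suc n)) / 3 ^ Suc (Suc n)) = ternary a - 2 * real (a 0) / 3"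
    using suminf_split_head[OF ternary_summable[of a, OF assms]] by (simp add: ternary_def)
  moreover have "(\<Sum>n. 2 * real (a (Suc n)) / 3 ^ Suc (Suc n)) = ternary (\<lambda>n. a (Suc n)) / 3"
    using suminf_divide[OF ternary_summable[of "\<lambda>n. a (Suc n)", OF assms], of 3]
    by (simp add: ternary_def field_simps)
  ultimately show ?thesis by simp
qed

lemma ternary_bounds:
  assumes "\<And>n. a n \<le> 1" shows "0 \<le> ternary a" "ternary a \<le> 1"
proof -
  show "0 \<le> ternary a"
    unfolding ternary_def by (rule suminf_nonneg[OF ternary_summable[OF assms]]) simp
  have "summable (\<lambda>n. 2 / 3 * (1/3) ^ n :: real)"
    by (intro summable_mult summable_geometric) auto
  moreover have "2 * real (a n) / 3 ^ Suc n \<le> 2 / 3 * (1/3) ^ n" for n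
    using assms[of n] by (simp add: power_one_over divide_simps)
  ultimately have "ternary a \<le> (\<Sum>n. 2 / 3 * (1/3) ^ n)"
    unfolding ternary_def by (intro suminf_le ternary_summable[OF assms])
  also have "\<dots> = 1"
    by (subst suminf_mult) (auto simp: suminf_geometric)
  finally show "ternary a \<le> 1" .
qed

text \<open>By \<open>ternary_shift\<close> the point is one third of \<open>2 * a 0\<close> plus a
  tail in [0, 1], so it lies in the outer third selected by \<open>a 0\<close>.\<close>

lemma hat_ternary:
  assumes "\<And>n. a n \<le> 1" shows "hat (ternary a) = real (a 0)"
proof -
  have t: "ternary a = (2 * real (a 0) + ternary (\<lambda>n. a (Suc n))) / 3"
    using ternary_shift[of a, OF assms] by simp
  have b: "0 \<le> ternary (\<lambda>n. a (Suc n))" "ternary (\<lambda>n. a (Suc n)) \<le> 1"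
    using ternary_bounds[of "\<lambda>n. a (Suc n)"] assms by auto
  consider "a 0 = 0" | "a 0 = 1"
    using assms[of 0] by linarith
  then show ?thesis
    by cases (use t b in \<open>auto intro: hat_eq_0 hat_eq_1\<close>)
qed

text \<open>Multiplying by 3 shifts the digits. The integer parts that accumulate are even, since
  the digits are 0 or 2, and vanish by the period 2 of \<open>hat\<close>.\<close>

lemma hat_power_ternary:
  assumes "\<And>n. a n \<le> 1" shows "hat (3 ^ k * ternary a) = real (a k)"
proof -
  have "\<exists>m. 3 ^ k * ternary a = 2 * real m + ternary (\<lambda>n. a (n + k))"
  proof (induction k)
    case 0
    show ?case by (intro exI[of _ 0]) simp
  next
    case (Suc k)
    then obtain m where "3 ^ k * ternary a = 2 * real m + ternary (\<lambda>n. a (n + k))" by blast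
    then have "3 ^ Suc k * ternary a = 6 * real m + 3 * ternary (\<lambda>n. a (n + k))" by simp
    also have "\<dots> = 2 * real (3 * m + a k) + ternary (\<lambda>n. a (n + Suc k))"
      using ternary_shift[of "\<lambda>n. a (n + k)"] assms by simp
    finally show ?case by blast
  qed
  then obtain m where "3 ^ k * ternary a = 2 * real m + ternary (\<lambda>n. a (n + k))" by blast
  then show ?thesis
    using hat_ternary[of "\<lambda>n. a (n + k)"] assms by (simp add: hat_periodic)
qed

lemma binary_expansion:
  fixes x :: real
  assumes "0 \<le> x" "x \<le> 1"
  obtains a :: "nat \<Rightarrow> nat" where "\<And>n. a n \<le> 1" "(\<lambda>n. real (a n) / 2 ^ Suc n) sums x"
proof -
  \<comment> \<open>Digit 1 from 1/2 on, so the orbit \<open>X\<close> of the doubling map stays in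
    the closed interval [0, 1], and x = 1 expands into all ones. \<open>X n / 2 ^ n\<close> is the
    remainder after n digits.\<close>
  define d :: "real \<Rightarrow> nat" where "d y = (if y < 1/2 then 0 else 1)" for y
  define X where "X n = ((\<lambda>y. 2 * y - real (d y)) ^^ n) x" for n
  have X: "0 \<le> X n \<and> X n \<le> 1" for n
    by (induction n) (use assms in \<open>auto simp: X_def d_def\<close>)
  have S: "(\<Sum>k<n. real (d (X k)) / 2 ^ Suc k) = x - X n / 2 ^ n" for n
    by (induction n) (auto simp: X_def field_simps)
  have "(\<lambda>n. X n / 2 ^ n) \<longlonglongrightarrow> 0"
  proof (rule tendsto_sandwich[of "\<lambda>_. 0" _ _ "\<lambda>n. (1/2) ^ n"])
    show "\<forall>\<^sub>F n in sequentially. X n / 2 ^ n \<le> (1/2) ^ n"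
      using X by (auto simp: power_one_over divide_simps)
    show "(\<lambda>n. (1/2::real) ^ n) \<longlonglongrightarrow> 0"
      by (rule LIMSEQ_power_zero) simp
  qed (use X in auto)
  then have "(\<lambda>n. x - X n / 2 ^ n) \<longlonglongrightarrow> x"
    using tendsto_diff[OF tendsto_const, of "\<lambda>n. X n / 2 ^ n" 0] by simp
  then have "(\<lambda>n. real (d (X n)) / 2 ^ Suc n) sums x"
    by (simp only: sums_def S)
  then show ?thesis
    by (rule that[rotated]) (auto simp: d_def)
qed

lemma schoenberg_surj:
  assumes "0 \<le> x" "x \<le> 1" "0 \<le> y" "y \<le> 1"
  shows "\<exists>t\<in>{0..1}. schoenberg 0 t = x \<and> schoenberg 1 t = y"
proof -
  obtain a where a: "\<And>n. a n \<le> (1::nat)" "(\<lambda>n. real (a n) / 2 ^ Suc n) sums x"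
    by (rule binary_expansion[OF assms(1,2)]) blast
  obtain b where b: "\<And>n. b n \<le> (1::nat)" "(\<lambda>n. real (b n) / 2 ^ Suc n) sums y"
    by (rule binary_expansion[OF assms(3,4)]) blast
  \<comment> \<open>Interleaved expansions: \<open>schoenberg 0\<close> reads the even places,
    \<open>schoenberg 1\<close> the odd ones.\<close>
  define c where "c n = (if even n then a (n div 2) else b (n div 2))" for n
  have c: "c n \<le> 1" for n using a b by (simp add: c_def)
  have "schoenberg 0 (ternary c) = x" "schoenberg 1 (ternary c) = y"
    unfolding schoenberg_def hat_power_ternary[of c, OF c]
    using sums_unique[OF a(2)] sums_unique[OF b(2)] by (simp_all add: c_def)
  then show ?thesis
    using ternary_bounds[of c, OF c] by auto
qed

lemma compact_subset_curve:
  fixes E :: "plane set"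
  assumes "compact E"
  obtains \<gamma> :: "real \<Rightarrow> plane" where "continuous_on UNIV \<gamma>" "E \<subseteq> \<gamma> ` {0..1}"
proof -
  obtain R where R: "R > 0" "\<And>x. x \<in> E \<Longrightarrow> norm x \<le> R"
    using compact_imp_bounded[OF assms] by (auto simp: bounded_pos)
  define \<gamma> :: "real \<Rightarrow> plane" where
    "\<gamma> t = (\<chi> i. 2 * R * schoenberg (if i = 1 then 0 else 1) t - R)" for t
  have "x \<in> \<gamma> ` {0..1}" if "x \<in> E" for x
  proof -
    have "\<bar>x $ i\<bar> \<le> R" for i
      using R(2)[OF that] component_le_norm_cart[of x i] by linarith
    then have "- R \<le> x $ i" "x $ i \<le> R" for i
      by (metis abs_le_D2 minus_le_iff, metis abs_le_D1)
    then have "0 \<le> (x $ i + R) / (2 * R)" "(x $ i + R) / (2 * R) \<le> 1" for i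
      using R(1) by (simp_all add: field_simps add_nonneg_nonneg minus_le_iff) (smt (verit))?
    then obtain t where t: "t \<in> {0..1}" "schoenberg 0 t = (x $ 1 + R) / (2 * R)"
      "schoenberg 1 t = (x $ 2 + R) / (2 * R)"
      using schoenberg_surj by meson
    have "\<gamma> t = x"
      using t R(1) by (auto simp: \<gamma>_def vec_eq_iff forall_2)
    then show ?thesis using t(1) by blast
  qed
  moreover have "continuous_on UNIV \<gamma>"
    unfolding \<gamma>_def by (intro continuous_intros continuous_on_schoenberg)
  ultimately show ?thesis using that by blast
qed

section \<open>Weak convergence of probability measures on a compact set\<close>

lemma borel_probsD:
  assumes "\<mu> \<in> borel_probs K"
  shows "prob_space \<mu>" "sets \<mu> = sets (restrict_space borel K)" "space \<mu> = K"
  using assms sets_eq_imp_space_eq[of \<mu> "restrict_space borel K"]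
  by (auto simp: borel_probs_def space_restrict_space)

lemma borel_probs_integrable:
  fixes f :: "plane \<Rightarrow> real"
  assumes K: "compact K" and \<mu>: "\<mu> \<in> borel_probs K" and f: "continuous_on K f"
  shows "integrable \<mu> f"
proof -
  interpret prob_space \<mu> using borel_probsD[OF \<mu>] by simp
  obtain B where "\<And>x. x \<in> K \<Longrightarrow> \<bar>f x\<bar> \<le> B"
    using compact_imp_bounded[OF compact_continuous_image[OF f K]] by (auto simp: bounded_real)
  then show ?thesis
    using borel_measurable_continuous_on_restrict[OF f]
      measurable_cong_sets[OF borel_probsD(2)[OF \<mu>] refl, of borel]
    by (intro integrable_const_bound[of _ B]) (auto simp: borel_probsD[OF \<mu>])
qed

definition weakly_to :: "plane set \<Rightarrow> (nat \<Rightarrow> plane measure) \<Rightarrow> plane measure \<Rightarrow> bool" where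
  "weakly_to K \<mu> \<nu> \<longleftrightarrow>
     (\<forall>f :: plane \<Rightarrow> real. continuous_on K f \<longrightarrow> (\<lambda>n. \<integral>x. f x \<partial>\<mu> n) \<longlonglongrightarrow> (\<integral>x. f x \<partial>\<nu>))"

text \<open>A Borel section \<open>s\<close> of the curve carries the measures to [0, 1], and
  \<open>\<gamma> (s x) = x\<close> on \<open>E\<close> turns integrals of \<open>F\<close> into
  integrals of \<open>F \<circ> \<gamma>\<close>. The range of \<open>s\<close> need not be closed,
  so the limit on the line may charge points outside it; it is pushed back by the continuous
  \<open>\<gamma>\<close>, and only afterwards shown to live on \<open>E\<close>.\<close>

theorem borel_probs_weakly_compact:
  fixes \<mu> :: "nat \<Rightarrow> plane measure"
  assumes E: "compact E" and \<mu>: "\<And>n. \<mu> n \<in> borel_probs E"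
  obtains r \<nu> where "strict_mono r" "\<nu> \<in> borel_probs E" "weakly_to E (\<mu> \<circ> r) \<nu>"
proof -
  obtain \<gamma> :: "real \<Rightarrow> plane" where \<gamma>: "continuous_on UNIV \<gamma>" "E \<subseteq> \<gamma> ` {0..1}"
    using compact_subset_curve[OF E] by blast
  have \<gamma>_borel [measurable]: "\<gamma> \<in> borel_measurable borel"
    using \<gamma>(1) by (rule borel_measurable_continuous_onI)
  define S where "S x = {0..1} \<inter> \<gamma> -` {x}" for x
  define s where "s x = Inf (S x)" for x
  have S_closed: "closed (S x)" and S_bdd: "bdd_below (S x)" for x
    using \<gamma>(1) by (auto simp: S_def bdd_below_def intro!: closed_Int continuous_closed_vimage
        continuous_on_interior[of UNIV])
  have s_S: "s x \<in> S x" if "x \<in> E" for x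
    unfolding s_def using that \<gamma>(2) S_closed S_bdd by (intro closed_contains_Inf) (auto simp: S_def)
  then have \<gamma>s: "\<gamma> (s x) = x" and s01: "0 \<le> s x" "s x \<le> 1" if "x \<in> E" for x
    using that by (auto simp: S_def)
  \<comment> \<open>The first hitting time \<open>s\<close> is a Borel section of \<open>\<gamma>\<close>: its sublevel sets are images of compact intervals.\<close>
  have s_meas: "s \<in> borel_measurable (restrict_space borel E)"
  proof (rule borel_measurableI_le)
    fix a :: real
    have "{x \<in> E. s x \<le> a} = \<gamma> ` ({0..1} \<inter> {..a}) \<inter> E"
    proof (intro equalityI subsetI)
      fix x assume "x \<in> {x \<in> E. s x \<le> a}"
      then show "x \<in> \<gamma> ` ({0..1} \<inter> {..a}) \<inter> E"
        using s01 \<gamma>s by (auto intro!: image_eqI[of _ _ "s x"])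
    next
      fix x assume "x \<in> \<gamma> ` ({0..1} \<inter> {..a}) \<inter> E"
      then obtain t where "t \<in> S x" "t \<le> a" "x \<in> E" by (auto simp: S_def)
      then show "x \<in> {x \<in> E. s x \<le> a}"
        using cInf_lower[OF _ S_bdd, of t x] by (auto simp: s_def)
    qed
    moreover have "compact (\<gamma> ` ({0..1} \<inter> {..a}))"
      using \<gamma>(1) by (intro compact_continuous_image compact_Int_closed) (auto intro: continuous_on_subset)
    ultimately show "{x \<in> space (restrict_space borel E). s x \<le> a} \<in> sets (restrict_space borel E)"
      using E by (auto simp: space_restrict_space sets_restrict_space intro!: borel_closed compact_imp_closed)
  qed
  have s_meas' [measurable]: "s \<in> borel_measurable (\<mu> n)" for n
    using s_meas measurable_cong_sets[OF borel_probsD(2)[OF \<mu>[of n]] refl] by blast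
  define M where "M n = distr (\<mu> n) borel s" for n
  have M: "real_distribution (M n)" for n
    unfolding M_def real_distribution_def real_distribution_axioms_def
    using borel_probsD(1)[OF \<mu>] by (auto intro!: prob_space.prob_space_distr)
  have "tight M"
    unfolding tight_def
  proof (intro conjI allI impI M)
    fix \<epsilon> :: real assume \<epsilon>: "\<epsilon> > 0"
    \<comment> \<open>The intervals in the definition of tightness are open on the left; starting at
      -1 keeps the value \<open>s x = 0\<close> inside.\<close>
    have "measure (M n) {-1<..1} = 1" for n
    proof -
      interpret prob_space "\<mu> n" using borel_probsD(1)[OF \<mu>] .
      have "s -` {-1<..1} \<inter> space (\<mu> n) = space (\<mu> n)"
        using s01 borel_probsD(3)[OF \<mu>, of n] by force
      then show ?thesis by (simp add: M_def measure_distr prob_space)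
    qed
    then show "\<exists>a b. a < b \<and> (\<forall>n. 1 - \<epsilon> < measure (M n) {a<..b})"
      using \<epsilon> by (intro exI[of _ "-1"] exI[of _ 1]) auto
  qed
  then obtain r L where r: "strict_mono (r :: nat \<Rightarrow> nat)" and L: "real_distribution L"
    and conv: "weak_conv_m (M \<circ> id \<circ> r) L"
    using tight_imp_convergent_subsubsequence[of M id] by (auto simp: strict_mono_id)
  define N where "N = distr L borel \<gamma>"
  interpret L: real_distribution L by fact
  interpret N: prob_space N
    unfolding N_def by (rule L.prob_space_distr) simp
  have N_sets [measurable_cong, simp]: "sets N = sets borel"
    by (simp add: N_def)
  have N_meas: "F \<in> borel_measurable N" if "continuous_on UNIV F" for F :: "plane \<Rightarrow> real"
    using borel_measurable_continuous_onI[OF that] by (simp cong: measurable_cong_sets)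
  have lim: "(\<lambda>n. \<integral>x. F x \<partial>\<mu> (r n)) \<longlonglongrightarrow> (\<integral>x. F x \<partial>N)"
    if F: "continuous_on UNIV F" "\<And>x. \<bar>F x\<bar> \<le> B" for F :: "plane \<Rightarrow> real" and B
  proof -
    have [measurable]: "F \<in> borel_measurable borel"
      using F(1) by (rule borel_measurable_continuous_onI)
    have "continuous_on UNIV (\<lambda>t. F (\<gamma> t))"
      using continuous_on_compose2[OF F(1) \<gamma>(1)] by simp
    then have "(\<lambda>n. \<integral>t. F (\<gamma> t) \<partial>(M \<circ> id \<circ> r) n) \<longlonglongrightarrow> (\<integral>t. F (\<gamma> t) \<partial>L)"
      using F(2) M L conv
      by (intro weak_conv_imp_integral_bdd_continuous_conv[where B = B])
         (auto simp: continuous_on_eq_continuous_at comp_def)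
    moreover have "(\<integral>t. F (\<gamma> t) \<partial>M n) = (\<integral>x. F x \<partial>\<mu> n)" for n
      unfolding M_def
      by (subst integral_distr) (auto intro!: Bochner_Integration.integral_cong simp: \<gamma>s borel_probsD(3)[OF \<mu>])
    ultimately show ?thesis
      by (simp add: N_def integral_distr)
  qed
  have E_ne: "E \<noteq> {}"
    using prob_space.not_empty[OF borel_probsD(1)[OF \<mu>]] borel_probsD(3)[OF \<mu>] by simp
  \<comment> \<open>A bounded continuous function vanishing exactly on the closed set
    \<open>E\<close>: its integrals against all \<open>\<mu> n\<close> are 0, hence so is the one
    against \<open>N\<close>, and \<open>N\<close> is concentrated on \<open>E\<close>.\<close>
  have inf_cont: "continuous_on UNIV (\<lambda>x. min 1 (infdist x E))"
    by (intro continuous_on_min continuous_on_const continuous_on_infdist continuous_on_id)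
  have "(\<integral>x. min 1 (infdist x E) \<partial>\<mu> n) = 0" for n
    using borel_probsD(3)[OF \<mu>, of n]
    by (subst Bochner_Integration.integral_cong[where g = "\<lambda>_. 0"]) auto
  then have "(\<integral>x. min 1 (infdist x E) \<partial>N) = 0"
    using lim[OF inf_cont, of 1] by (auto simp: infdist_nonneg LIMSEQ_const_iff)
  moreover have "integrable N (\<lambda>x. min 1 (infdist x E))"
    by (rule N.integrable_const_bound[of _ 1])
       (auto simp: infdist_nonneg intro!: N_meas inf_cont)
  ultimately have "AE x in N. min 1 (infdist x E) = 0"
    by (subst (asm) integral_nonneg_eq_0_iff_AE) (auto simp: infdist_nonneg)
  then have "AE x in N. infdist x E = 0"
    by eventually_elim (auto simp: min_def split: if_splits)
  then have AE_E: "AE x in N. x \<in> E"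
    using in_closed_iff_infdist_zero[OF compact_imp_closed[OF E] E_ne] by simp
  have [measurable]: "E \<in> sets borel"
    using E by (simp add: compact_imp_closed)
  have "emeasure N E = 1"
    using N.prob_eq_1[of E] AE_E by (simp add: N.emeasure_eq_measure)
  define \<nu> where "\<nu> = restrict_space N E"
  have \<nu>: "\<nu> \<in> borel_probs E"
    unfolding borel_probs_def \<nu>_def
    using prob_space_restrict_space[OF _ \<open>emeasure N E = 1\<close>]
    by (auto simp: sets_restrict_space)
  show ?thesis
  proof (rule that[OF r \<nu>], unfold weakly_to_def comp_def, intro allI impI)
    fix f :: "plane \<Rightarrow> real" assume f: "continuous_on E f"
    obtain B where B: "B \<ge> 0" "\<And>x. x \<in> E \<Longrightarrow> \<bar>f x\<bar> \<le> B"
      using compact_imp_bounded[OF compact_continuous_image[OF f E]]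
      by (auto simp: bounded_pos) (metis less_imp_le)
    \<comment> \<open>The limit relation is available for bounded functions on the whole plane;
      Tietze extends the test function from \<open>E\<close> with the same bound.\<close>
    obtain F where F: "continuous_on UNIV F" "\<And>x. x \<in> E \<Longrightarrow> F x = f x" "\<And>x. \<bar>F x\<bar> \<le> B"
      using Tietze[of E f UNIV B] f E B by (auto simp: compact_imp_closed)
    have "(\<integral>x. f x \<partial>\<nu>) = (\<integral>x. indicator E x *\<^sub>R f x \<partial>N)"
      unfolding \<nu>_def by (rule integral_restrict_space) simp
    also have "\<dots> = (\<integral>x. indicator E x *\<^sub>R F x \<partial>N)"
      using F(2) by (intro Bochner_Integration.integral_cong) (auto split: split_indicator)
    also have "\<dots> = (\<integral>x. F x \<partial>N)"
      using AE_E F(1) by (intro integral_cong_AE)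
        (auto intro!: N_meas[OF F(1)] borel_measurable_times borel_measurable_indicator)
    finally have "(\<integral>x. f x \<partial>\<nu>) = (\<integral>x. F x \<partial>N)" .
    moreover have "(\<integral>x. f x \<partial>\<mu> n) = (\<integral>x. F x \<partial>\<mu> n)" for n
      using F(2) borel_probsD(3)[OF \<mu>, of n] by (intro Bochner_Integration.integral_cong) auto
    ultimately show "(\<lambda>n. \<integral>x. f x \<partial>\<mu> (r n)) \<longlonglongrightarrow> (\<integral>x. f x \<partial>\<nu>)"
      using lim[OF F(1,3)] by simp
  qed
qed

text \<open>The indicator of a closed set is the pointwise limit of the tents
  \<open>max 0 (1 - n * infdist x C)\<close>, and closed sets form an intersection-stable generator
  of the Borel sets.\<close>

lemma borel_measure_eqI_continuous:
  fixes M N :: "'a::metric_space measure"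
  assumes "prob_space M" "prob_space N" and sets: "sets M = sets borel" "sets N = sets borel"
    and eq: "\<And>f :: 'a \<Rightarrow> real. continuous_on UNIV f \<Longrightarrow> (\<And>x. \<bar>f x\<bar> \<le> 1) \<Longrightarrow> (\<integral>x. f x \<partial>M) = (\<integral>x. f x \<partial>N)"
  shows "M = N"
proof (rule measure_eqI_generator_eq[where E = "Collect closed" and \<Omega> = UNIV and A = "\<lambda>_. UNIV"])
  interpret M: prob_space M by fact
  interpret N: prob_space N by fact
  show "emeasure M C = emeasure N C" if "C \<in> Collect closed" for C
  proof (cases "C = {}")
    case False
    define f where "f n x = max 0 (1 - real n * infdist x C)" for n x
    have f_cont: "continuous_on UNIV (f n)" for n
      unfolding f_def
      by (intro continuous_on_max continuous_on_const continuous_on_diff continuous_on_mult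
          continuous_on_infdist continuous_on_id)
    have f_bound: "\<bar>f n x\<bar> \<le> 1" for n x
      by (auto simp: f_def infdist_nonneg)
    have f_lim: "(\<lambda>n. f n x) \<longlonglongrightarrow> indicator C x" for x
    proof (cases "x \<in> C")
      case True
      then show ?thesis by (simp add: f_def)
    next
      case x: False
      then have "infdist x C > 0"
        using that False infdist_nonneg[of x C] in_closed_iff_infdist_zero[of C x] by (auto simp: less_le)
      then obtain m where m: "1 < real m * infdist x C"
        using reals_Archimedean3 by blast
      have "f n x = 0" if "n \<ge> m" for n
      proof -
        have "real m * infdist x C \<le> real n * infdist x C"
          using that infdist_nonneg by (intro mult_right_mono) auto
        then show ?thesis using m by (simp add: f_def)
      qed
      then have "eventually (\<lambda>n. f n x = 0) sequentially"
        by (auto simp: eventually_sequentially)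
      then show ?thesis
        using x tendsto_eventually by force
    qed
    have lim: "(\<lambda>n. \<integral>x. f n x \<partial>P) \<longlonglongrightarrow> measure P C" if P: "prob_space P" "sets P = sets borel" for P
    proof -
      interpret P: prob_space P by fact
      have C: "C \<in> sets P" using \<open>C \<in> Collect closed\<close> P(2) by simp
      have "(\<lambda>n. \<integral>x. f n x \<partial>P) \<longlonglongrightarrow> (\<integral>x. indicator C x \<partial>P)"
        using f_lim f_bound borel_measurable_continuous_onI[OF f_cont] P(2) C
        by (intro integral_dominated_convergence[where w = "\<lambda>_. 1"])
           (auto cong: measurable_cong_sets)
      then show ?thesis using C by simp
    qed
    have "measure M C = measure N C"
      using lim[OF assms(1) sets(1)] lim[OF assms(2) sets(2)] eq[OF f_cont f_bound]
      by (simp add: LIMSEQ_unique)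
    then show ?thesis by (simp add: M.emeasure_eq_measure N.emeasure_eq_measure)
  qed simp
  show "sets M = sigma_sets UNIV (Collect closed)" "sets N = sigma_sets UNIV (Collect closed)"
    using sets by (simp_all add: borel_eq_closed)
qed (use assms(1) in \<open>auto simp: Int_stable_def prob_space_def finite_measure.emeasure_finite\<close>)

text \<open>The inclusion carries both measures to the plane, where the criterion for Borel measures
  applies. Nothing is lost: \<open>K\<close> is compact, so its measurable subsets are Borel in the
  plane.\<close>

lemma borel_probs_eqI:
  assumes K: "compact K" and \<mu>: "\<mu> \<in> borel_probs K" and \<nu>: "\<nu> \<in> borel_probs K"
    and eq: "\<And>f :: plane \<Rightarrow> real. continuous_on K f \<Longrightarrow> (\<integral>x. f x \<partial>\<mu>) = (\<integral>x. f x \<partial>\<nu>)"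
  shows "\<mu> = \<nu>"
proof -
  have id_meas: "id \<in> \<rho> \<rightarrow>\<^sub>M borel" if "\<rho> \<in> borel_probs K" for \<rho>
    unfolding measurable_cong_sets[OF borel_probsD(2)[OF that] refl]
    by (rule measurable_restrict_space1) (rule measurable_ident)
  have same: "distr \<mu> borel id = distr \<nu> borel id"
  proof (rule borel_measure_eqI_continuous)
    fix f :: "plane \<Rightarrow> real" assume "continuous_on UNIV f"
    then show "(\<integral>x. f x \<partial>distr \<mu> borel id) = (\<integral>x. f x \<partial>distr \<nu> borel id)"
      using eq[of f] continuous_on_subset[of UNIV f K]
      by (simp add: integral_distr id_meas \<mu> \<nu> borel_measurable_continuous_onI)
  qed (use borel_probsD(1)[OF \<mu>] borel_probsD(1)[OF \<nu>] id_meas \<mu> \<nu> in \<open>auto intro!: prob_space.prob_space_distr\<close>)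
  have dist_id: "emeasure (distr \<rho> borel id) A = emeasure \<rho> A"
    if "\<rho> \<in> borel_probs K" "A \<in> sets \<rho>" for \<rho> A
  proof -
    have "A \<in> sets borel"
      using that borel_probsD(2)[OF that(1)] borel_compact[OF K] by (auto simp: sets_restrict_space)
    moreover have "A \<subseteq> space \<rho>" using that(2) by (rule sets.sets_into_space)
    ultimately show ?thesis
      using emeasure_distr[OF id_meas[OF that(1)]] by (simp add: Int_absorb2)
  qed
  show ?thesis
  proof (rule measure_eqI)
    show "sets \<mu> = sets \<nu>" using borel_probsD(2)[OF \<mu>] borel_probsD(2)[OF \<nu>] by simp
    then show "emeasure \<mu> A = emeasure \<nu> A" if "A \<in> sets \<mu>" for A
      using dist_id[OF \<mu> that] dist_id[OF \<nu>] that same by simp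
  qed
qed

section \<open>Products of measures and uniform weak convergence\<close>

lemma sets_pair_borel_probs:
  assumes "\<mu> \<in> borel_probs K" "\<nu> \<in> borel_probs K"
  shows "sets (\<mu> \<Otimes>\<^sub>M \<nu>) = sets (restrict_space borel K \<Otimes>\<^sub>M restrict_space borel K)"
  using assms by (intro sets_pair_measure_cong borel_probsD(2))

lemma borel_probs_product:
  fixes f g :: "plane \<Rightarrow> real"
  assumes K: "compact K" and \<mu>: "\<mu> \<in> borel_probs K" and \<nu>: "\<nu> \<in> borel_probs K"
    and f: "continuous_on K f" and g: "continuous_on K g"
  shows "integrable (\<mu> \<Otimes>\<^sub>M \<nu>) (\<lambda>z. f (fst z) * g (snd z))"
    and "(\<integral>z. f (fst z) * g (snd z) \<partial>(\<mu> \<Otimes>\<^sub>M \<nu>)) = (\<integral>x. f x \<partial>\<mu>) * (\<integral>x. g x \<partial>\<nu>)"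
proof -
  interpret \<mu>: prob_space \<mu> using borel_probsD(1)[OF \<mu>] .
  interpret \<nu>: prob_space \<nu> using borel_probsD(1)[OF \<nu>] .
  interpret P: pair_prob_space \<mu> \<nu> ..
  have [measurable]: "f \<in> borel_measurable \<mu>" "g \<in> borel_measurable \<nu>"
    using borel_probs_integrable[OF K \<mu> f] borel_probs_integrable[OF K \<nu> g] by auto
  obtain A where A: "\<And>x. x \<in> K \<Longrightarrow> \<bar>f x\<bar> \<le> A"
    using compact_imp_bounded[OF compact_continuous_image[OF f K]] by (auto simp: bounded_real)
  obtain B where B: "\<And>x. x \<in> K \<Longrightarrow> \<bar>g x\<bar> \<le> B"
    using compact_imp_bounded[OF compact_continuous_image[OF g K]] by (auto simp: bounded_real)
  have "\<bar>f x * g y\<bar> \<le> \<bar>A\<bar> * \<bar>B\<bar>" if "x \<in> K" "y \<in> K" for x y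
    unfolding abs_mult using A[OF that(1)] B[OF that(2)] by (intro mult_mono) auto
  then show int: "integrable (\<mu> \<Otimes>\<^sub>M \<nu>) (\<lambda>z. f (fst z) * g (snd z))"
    by (intro P.integrable_const_bound[of _ "\<bar>A\<bar> * \<bar>B\<bar>"])
       (auto simp: space_pair_measure borel_probsD(3)[OF \<mu>] borel_probsD(3)[OF \<nu>])
  show "(\<integral>z. f (fst z) * g (snd z) \<partial>(\<mu> \<Otimes>\<^sub>M \<nu>)) = (\<integral>x. f x \<partial>\<mu>) * (\<integral>x. g x \<partial>\<nu>)"
    using P.integral_fst'[OF int] by simp
qed

text \<open>The convergence is uniform over all \<open>f\<close> with a common bound and modulus of continuity, since one
  finite partition of unity serves all of them.\<close>

theorem weak_convergence_pair_uniform: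
  assumes E: "compact E" and \<mu>: "\<And>n. \<mu> n \<in> borel_probs E" and \<nu>: "\<nu> \<in> borel_probs E"
    and conv: "weakly_to E \<mu> \<nu>"
    and e: "e > 0" and d: "d > 0"
  shows "\<forall>\<^sub>F n in sequentially. \<forall>f :: plane \<times> plane \<Rightarrow> real.
    f \<in> borel_measurable (restrict_space borel E \<Otimes>\<^sub>M restrict_space borel E) \<longrightarrow>
    (\<forall>x\<in>E. \<forall>y\<in>E. \<bar>f (x, y)\<bar> \<le> B) \<longrightarrow>
    (\<forall>x\<in>E. \<forall>y\<in>E. \<forall>x'\<in>E. \<forall>y'\<in>E. dist x x' < d \<longrightarrow> dist y y' < d \<longrightarrow> \<bar>f (x, y) - f (x', y')\<bar> \<le> e) \<longrightarrow>
    \<bar>(\<integral>z. f z \<partial>(\<mu> n \<Otimes>\<^sub>M \<mu> n)) - (\<integral>z. f z \<partial>(\<nu> \<Otimes>\<^sub>M \<nu>))\<bar> \<le> 3 * e"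
proof -
  obtain A where A: "finite A" "A \<subseteq> E" "E \<subseteq> (\<Union>a\<in>A. ball a d)"
  proof (rule compactE_image[OF E, of E "\<lambda>a. ball a d"])
    show "E \<subseteq> (\<Union>a\<in>E. ball a d)" using d by (auto intro: rev_bexI)
  qed auto
  \<comment> \<open>Tents of radius \<open>d\<close>, normalized below to a partition of unity: only
    nodes within the modulus of continuity of the point have nonzero weight. The nodes lie in
    \<open>E\<close>, where \<open>f\<close> is controlled.\<close>
  define \<phi> where "\<phi> a x = max 0 (d - dist x a)" for a x :: plane
  define S where "S x = (\<Sum>a\<in>A. \<phi> a x)" for x
  define \<psi> where "\<psi> a x = \<phi> a x / S x" for a x
  have \<phi>_nonneg: "\<phi> a x \<ge> 0" for a x by (simp add: \<phi>_def)
  have S_pos: "S x > 0" if x: "x \<in> E" for x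
  proof -
    obtain a where "a \<in> A" "dist a x < d" using A(3) x by auto
    then show ?thesis
      unfolding S_def using \<phi>_nonneg
      by (intro sum_pos2[OF A(1)]) (auto simp: \<phi>_def dist_commute)
  qed
  have \<psi>_nonneg: "\<psi> a x \<ge> 0" for a x
    by (simp add: \<psi>_def S_def \<phi>_nonneg sum_nonneg)
  have \<psi>_sum: "(\<Sum>a\<in>A. \<psi> a x) = 1" if "x \<in> E" for x
    using S_pos[OF that] by (simp add: \<psi>_def S_def flip: sum_divide_distrib)
  have \<psi>_zero: "\<psi> a x = 0" if "dist x a \<ge> d" for a x
    using that by (simp add: \<psi>_def \<phi>_def)
  have \<psi>_cont: "continuous_on E (\<psi> a)" for a
    unfolding \<psi>_def S_def \<phi>_def
    using S_pos by (intro continuous_intros) (auto simp: S_def \<phi>_def less_imp_neq[symmetric])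
  have \<psi>_meas: "\<psi> a \<in> borel_measurable \<rho>" if "\<rho> \<in> borel_probs E" for \<rho> a
    using borel_probs_integrable[OF E that \<psi>_cont] by (rule borel_measurable_integrable)
  define m where "m a \<rho> = (\<integral>x. \<psi> a x \<partial>\<rho>)" for a and \<rho> :: "plane measure"
  \<comment> \<open>Discretization: with \<open>f\<close> replaced by its values at the nodes, the
    double integral becomes a finite combination of the numbers \<open>m a \<rho>\<close>, at a cost
    of at most \<open>e\<close>.\<close>
  have approx: "\<bar>(\<integral>z. f z \<partial>(\<rho> \<Otimes>\<^sub>M \<rho>)) - (\<Sum>a\<in>A. \<Sum>b\<in>A. f (a, b) * (m a \<rho> * m b \<rho>))\<bar> \<le> e"
    if \<rho>: "\<rho> \<in> borel_probs E"
      and f_meas: "f \<in> borel_measurable (restrict_space borel E \<Otimes>\<^sub>M restrict_space borel E)"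
      and f_bd: "\<forall>x\<in>E. \<forall>y\<in>E. \<bar>f (x, y)\<bar> \<le> B"
      and f_mod: "\<forall>x\<in>E. \<forall>y\<in>E. \<forall>x'\<in>E. \<forall>y'\<in>E. dist x x' < d \<longrightarrow> dist y y' < d \<longrightarrow> \<bar>f (x, y) - f (x', y')\<bar> \<le> e"
    for \<rho> and f :: "plane \<times> plane \<Rightarrow> real"
  proof -
    interpret \<rho>: prob_space \<rho> using borel_probsD(1)[OF \<rho>] .
    interpret P: pair_prob_space \<rho> \<rho> ..
    note [measurable] = \<psi>_meas[OF \<rho>]
    have [measurable]: "f \<in> borel_measurable (\<rho> \<Otimes>\<^sub>M \<rho>)"
      using f_meas measurable_cong_sets[OF sets_pair_borel_probs[OF \<rho> \<rho>] refl] by blast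
    have sp: "space (\<rho> \<Otimes>\<^sub>M \<rho>) = E \<times> E"
      using borel_probsD(3)[OF \<rho>] by (simp add: space_pair_measure)
    have int_f: "integrable (\<rho> \<Otimes>\<^sub>M \<rho>) f"
      using f_bd sp by (intro P.integrable_const_bound[of _ B]) auto
    note prod = borel_probs_product[OF E \<rho> \<rho> \<psi>_cont \<psi>_cont]
    define g where "g = (\<lambda>z. \<Sum>a\<in>A. \<Sum>b\<in>A. f (a, b) * (\<psi> a (fst z) * \<psi> b (snd z)))"
    have int_g: "integrable (\<rho> \<Otimes>\<^sub>M \<rho>) g"
      unfolding g_def using prod(1) by (intro Bochner_Integration.integrable_sum integrable_mult_right) auto
    have g: "(\<integral>z. g z \<partial>(\<rho> \<Otimes>\<^sub>M \<rho>)) = (\<Sum>a\<in>A. \<Sum>b\<in>A. f (a, b) * (m a \<rho> * m b \<rho>))"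
      unfolding g_def m_def using prod
      by (simp add: Bochner_Integration.integral_sum Bochner_Integration.integrable_sum)
    have close: "\<bar>f (x, y) - g (x, y)\<bar> \<le> e" if "x \<in> E" "y \<in> E" for x y
    proof -
      have one: "(\<Sum>a\<in>A. \<Sum>b\<in>A. \<psi> a x * \<psi> b y) = 1"
        using \<psi>_sum[OF that(1)] \<psi>_sum[OF that(2)] by (simp flip: sum_product)
      have "f (x, y) - g (x, y) = (\<Sum>a\<in>A. \<Sum>b\<in>A. (f (x, y) - f (a, b)) * (\<psi> a x * \<psi> b y))"
        using one by (simp add: g_def left_diff_distrib sum_subtractf flip: sum_distrib_left)
      also have "\<bar>\<dots>\<bar> \<le> (\<Sum>a\<in>A. \<Sum>b\<in>A. \<bar>(f (x, y) - f (a, b)) * (\<psi> a x * \<psi> b y)\<bar>)"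
        by (intro order.trans[OF sum_abs] sum_mono sum_abs)
      also have "\<dots> \<le> (\<Sum>a\<in>A. \<Sum>b\<in>A. e * (\<psi> a x * \<psi> b y))"
      proof (intro sum_mono)
        fix a b assume ab: "a \<in> A" "b \<in> A"
        show "\<bar>(f (x, y) - f (a, b)) * (\<psi> a x * \<psi> b y)\<bar> \<le> e * (\<psi> a x * \<psi> b y)"
        proof (cases "dist x a < d \<and> dist y b < d")
          case True
          then have "\<bar>f (x, y) - f (a, b)\<bar> \<le> e" using f_mod that ab A(2) by blast
          then show ?thesis using \<psi>_nonneg by (simp add: abs_mult mult_right_mono)
        next
          case False
          then have "\<psi> a x * \<psi> b y = 0" using \<psi>_zero by (auto simp: not_less)
          then show ?thesis by (simp only: mult_zero_right abs_zero order_refl)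
        qed
      qed
      also have "\<dots> = e" using one by (simp flip: sum_distrib_left)
      finally show ?thesis .
    qed
    have "\<bar>(\<integral>z. f z \<partial>(\<rho> \<Otimes>\<^sub>M \<rho>)) - (\<integral>z. g z \<partial>(\<rho> \<Otimes>\<^sub>M \<rho>))\<bar> = \<bar>\<integral>z. f z - g z \<partial>(\<rho> \<Otimes>\<^sub>M \<rho>)\<bar>"
      using int_f int_g by simp
    also have "\<dots> \<le> (\<integral>z. \<bar>f z - g z\<bar> \<partial>(\<rho> \<Otimes>\<^sub>M \<rho>))"
      by (rule integral_abs_bound)
    also have "\<dots> \<le> (\<integral>z. e \<partial>(\<rho> \<Otimes>\<^sub>M \<rho>))"
      using close int_f int_g sp by (intro integral_mono integrable_abs) auto
    also have "\<dots> = e" by (simp add: P.prob_space)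
    finally show ?thesis unfolding g .
  qed
  \<comment> \<open>This majorant contains the bound \<open>B\<close> but not \<open>f\<close>, so
    one threshold for n serves all admissible \<open>f\<close>.\<close>
  have "(\<lambda>n. \<Sum>a\<in>A. \<Sum>b\<in>A. \<bar>B\<bar> * \<bar>m a (\<mu> n) * m b (\<mu> n) - m a \<nu> * m b \<nu>\<bar>) \<longlonglongrightarrow>
    (\<Sum>a\<in>A. \<Sum>b\<in>A. \<bar>B\<bar> * \<bar>m a \<nu> * m b \<nu> - m a \<nu> * m b \<nu>\<bar>)"
    unfolding m_def using conv \<psi>_cont by (intro tendsto_intros) (auto simp: weakly_to_def)
  then have "(\<lambda>n. \<Sum>a\<in>A. \<Sum>b\<in>A. \<bar>B\<bar> * \<bar>m a (\<mu> n) * m b (\<mu> n) - m a \<nu> * m b \<nu>\<bar>) \<longlonglongrightarrow> 0"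
    by simp
  then have "\<forall>\<^sub>F n in sequentially. (\<Sum>a\<in>A. \<Sum>b\<in>A. \<bar>B\<bar> * \<bar>m a (\<mu> n) * m b (\<mu> n) - m a \<nu> * m b \<nu>\<bar>) < e"
    using e by (rule order_tendstoD)
  then show ?thesis
  proof (eventually_elim, intro allI impI)
    fix n and f :: "plane \<times> plane \<Rightarrow> real"
    assume small: "(\<Sum>a\<in>A. \<Sum>b\<in>A. \<bar>B\<bar> * \<bar>m a (\<mu> n) * m b (\<mu> n) - m a \<nu> * m b \<nu>\<bar>) < e"
      and f_bd: "\<forall>x\<in>E. \<forall>y\<in>E. \<bar>f (x, y)\<bar> \<le> B"
      and f: "f \<in> borel_measurable (restrict_space borel E \<Otimes>\<^sub>M restrict_space borel E)"
        "\<forall>x\<in>E. \<forall>y\<in>E. \<forall>x'\<in>E. \<forall>y'\<in>E. dist x x' < d \<longrightarrow> dist y y' < d \<longrightarrow> \<bar>f (x, y) - f (x', y')\<bar> \<le> e"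
    let ?s = "\<lambda>\<rho>. \<Sum>a\<in>A. \<Sum>b\<in>A. f (a, b) * (m a \<rho> * m b \<rho>)"
    have "\<bar>?s (\<mu> n) - ?s \<nu>\<bar> = \<bar>\<Sum>a\<in>A. \<Sum>b\<in>A. f (a, b) * (m a (\<mu> n) * m b (\<mu> n) - m a \<nu> * m b \<nu>)\<bar>"
      by (simp add: right_diff_distrib sum_subtractf)
    also have "\<dots> \<le> (\<Sum>a\<in>A. \<Sum>b\<in>A. \<bar>f (a, b) * (m a (\<mu> n) * m b (\<mu> n) - m a \<nu> * m b \<nu>)\<bar>)"
      by (intro order.trans[OF sum_abs] sum_mono sum_abs)
    also have "\<dots> \<le> (\<Sum>a\<in>A. \<Sum>b\<in>A. \<bar>B\<bar> * \<bar>m a (\<mu> n) * m b (\<mu> n) - m a \<nu> * m b \<nu>\<bar>)"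
    proof (intro sum_mono)
      fix a b assume "a \<in> A" "b \<in> A"
      then have "\<bar>f (a, b)\<bar> \<le> \<bar>B\<bar>" using f_bd A(2) by (meson abs_ge_self order_trans subsetD)
      then show "\<bar>f (a, b) * (m a (\<mu> n) * m b (\<mu> n) - m a \<nu> * m b \<nu>)\<bar> \<le> \<bar>B\<bar> * \<bar>m a (\<mu> n) * m b (\<mu> n) - m a \<nu> * m b \<nu>\<bar>"
        by (simp add: abs_mult mult_right_mono)
    qed
    also have "\<dots> \<le> e" using small by simp
    finally have "\<bar>?s (\<mu> n) - ?s \<nu>\<bar> \<le> e" .
    \<comment> \<open>Three errors of size \<open>e\<close>: the discretizations for
      \<open>\<mu> n\<close> and for \<open>\<nu>\<close>, and the difference of the finite
      sums.\<close>
    moreover note approx[OF \<mu>[of n] f(1) f_bd f(2)] approx[OF \<nu> f(1) f_bd f(2)]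
    ultimately show "\<bar>(\<integral>z. f z \<partial>(\<mu> n \<Otimes>\<^sub>M \<mu> n)) - (\<integral>z. f z \<partial>(\<nu> \<Otimes>\<^sub>M \<nu>))\<bar> \<le> 3 * e"
      by (simp add: abs_le_iff)
  qed
qed

section \<open>The logarithmic kernel\<close>

text \<open>Tonelli for \<open>exp (- s * u)\<close> over s > 0 and a \<le> u \<le> b: integrating u
  first gives the left side, integrating s first leaves the integral of
  \<open>1 / u\<close>.\<close>

lemma frullani_exp:
  fixes a b :: real
  assumes a: "0 < a" "a \<le> b"
  shows "(\<integral>\<^sup>+s. ennreal ((exp (- s * a) - exp (- s * b)) / s) * indicator {0<..} s \<partial>lborel) = ennreal (ln (b / a))"
proof -
  define f where "f s u = ennreal (exp (- s * u)) * indicator {0<..} s * indicator {a..b} u" for s u :: real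
  have f_meas: "(\<lambda>(s, u). f s u) \<in> borel_measurable (lborel \<Otimes>\<^sub>M lborel)"
    unfolding f_def by measurable
  have "(\<integral>\<^sup>+u. f s u \<partial>lborel) = ennreal ((exp (- s * a) - exp (- s * b)) / s) * indicator {0<..} s" for s
  proof (cases "s > 0")
    case True
    have "(\<integral>\<^sup>+u. ennreal (exp (- s * u)) * indicator {a..b} u \<partial>lborel)
      = ennreal (- exp (- s * b) / s - (- exp (- s * a) / s))"
      using True a by (intro nn_integral_FTC_Icc) (auto intro!: derivative_eq_intros)
    then show ?thesis using True by (simp add: f_def diff_divide_distrib)
  qed (simp add: f_def)
  moreover have "(\<integral>\<^sup>+s. f s u \<partial>lborel) = ennreal (1 / u) * indicator {a..b} u" for u
  proof (cases "u \<in> {a..b}")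
    case True
    then have u: "u > 0" using a by auto
    have "(\<integral>\<^sup>+s. f s u \<partial>lborel) = (\<integral>\<^sup>+s. ennreal (exp (- s * u)) * indicator {0..} s \<partial>lborel)"
      using True AE_lborel_singleton[of "0::real"]
      by (intro nn_integral_cong_AE) (auto simp: f_def split: split_indicator elim!: eventually_mono)
    also have "\<dots> = ennreal (0 - (- exp (- 0 * u) / u))"
    proof (rule nn_integral_FTC_atLeast)
      show "((\<lambda>s. - exp (- s * u) / u) \<longlongrightarrow> 0) at_top"
        using tendsto_divide[OF tendsto_minus[OF filterlim_compose[OF exp_at_bot
            filterlim_uminus_at_bot_at_top[THEN filterlim_compose, OF filterlim_at_top_mult_tendsto_pos[OF tendsto_const u filterlim_ident]]]] tendsto_const, of u] u by simp
    qed (use u in \<open>auto intro!: derivative_eq_intros\<close>)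
    finally show ?thesis using True by simp
  qed (simp add: f_def)
  ultimately have "(\<integral>\<^sup>+s. ennreal ((exp (- s * a) - exp (- s * b)) / s) * indicator {0<..} s \<partial>lborel)
    = (\<integral>\<^sup>+u. ennreal (1 / u) * indicator {a..b} u \<partial>lborel)"
    using lborel_pair.Fubini'[OF f_meas] by simp
  also have "\<dots> = ennreal (ln b - ln a)"
    using a by (intro nn_integral_FTC_Icc) (auto intro!: derivative_eq_intros)
  also have "\<dots> = ennreal (ln (b / a))"
    using a by (simp add: ln_div)
  finally show ?thesis .
qed

text \<open>Replacing 1 by the smaller \<open>exp (- s * a)\<close> with
  \<open>a = b * exp (- n)\<close> gives the lower bound \<open>ln (b / a) = n\<close>, for every
  n.\<close>

lemma frullani_exp_0:
  fixes b :: real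
  assumes b: "0 < b"
  shows "(\<integral>\<^sup>+s. ennreal ((1 - exp (- s * b)) / s) * indicator {0<..} s \<partial>lborel) = \<infinity>"
proof -
  have "of_nat n \<le> (\<integral>\<^sup>+s. ennreal ((1 - exp (- s * b)) / s) * indicator {0<..} s \<partial>lborel)" for n
  proof -
    have "b / (b * exp (- real n)) = exp (real n)"
      using b by (simp add: exp_minus field_simps)
    then have "of_nat n = ennreal (ln (b / (b * exp (- real n))))"
      by (simp only: ln_exp ennreal_of_nat_eq_real_of_nat)
    also have "\<dots> = (\<integral>\<^sup>+s. ennreal ((exp (- s * (b * exp (- real n))) - exp (- s * b)) / s) * indicator {0<..} s \<partial>lborel)"
      using b by (intro frullani_exp[symmetric]) (auto simp: mult_le_cancel_left1)
    also have "\<dots> \<le> (\<integral>\<^sup>+s. ennreal ((1 - exp (- s * b)) / s) * indicator {0<..} s \<partial>lborel)"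
      using b by (intro nn_integral_mono) (auto split: split_indicator intro!: ennreal_leI divide_right_mono)
    finally show ?thesis .
  qed
  then have "(SUP n. of_nat n) \<le> (\<integral>\<^sup>+s. ennreal ((1 - exp (- s * b)) / s) * indicator {0<..} s \<partial>lborel)"
    by (rule SUP_least)
  then show ?thesis
    unfolding ennreal_SUP_of_nat_eq_top infinity_ennreal_def top_unique .
qed

text \<open>The logarithmic kernel, shifted by \<open>ln D\<close> so as to be nonnegative on distances up to \<open>D\<close>.\<close>

definition ell :: "real \<Rightarrow> real \<Rightarrow> ennreal" where
  "ell D r = (if r \<le> 0 then \<infinity> else ennreal (ln (D / r)))"

text \<open>Unlike \<open>ell\<close>, bounded and continuous in \<open>r\<close>, hence accessible
  to weak convergence; it increases to \<open>ell\<close> as \<open>\<epsilon>\<close> decreases to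
  0.\<close>

definition cut_ell :: "real \<Rightarrow> real \<Rightarrow> real \<Rightarrow> real" where
  "cut_ell D \<epsilon> r = ln (D / max r \<epsilon>)"

lemma ell_measurable [measurable]: "ell D \<in> borel_measurable borel"
  unfolding ell_def[abs_def] by measurable

text \<open>Frullani at the squares of \<open>r\<close> and \<open>D\<close>, which produces
  Gaussians in the distance and the factor 2. Subtracting the Gaussian at \<open>D\<close> removes
  the divergence at s = 0 and keeps the integrand nonnegative for r \<le> D.\<close>

lemma frullani_ell:
  assumes "0 \<le> r" "r \<le> D" "0 < D"
  shows "2 * ell D r = (\<integral>\<^sup>+s. ennreal ((exp (- s * r\<^sup>2) - exp (- s * D\<^sup>2)) / s) * indicator {0<..} s \<partial>lborel)"
proof (cases "r = 0")
  case True
  then show ?thesis using frullani_exp_0[of "D\<^sup>2"] assms by (simp add: ell_def ennreal_mult_top)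
next
  case False
  then have "(\<integral>\<^sup>+s. ennreal ((exp (- s * r\<^sup>2) - exp (- s * D\<^sup>2)) / s) * indicator {0<..} s \<partial>lborel)
    = ennreal (ln (D\<^sup>2 / r\<^sup>2))"
    using assms by (intro frullani_exp) auto
  also have "ln (D\<^sup>2 / r\<^sup>2) = 2 * ln (D / r)"
    using ln_realpow[of "D / r" 2] False assms by (simp add: power_divide)
  also have "ennreal \<dots> = 2 * ell D r"
    using False assms by (simp add: ell_def ennreal_mult)
  finally show ?thesis by simp
qed

lemma cut_ell_nonneg: "0 < \<epsilon> \<Longrightarrow> \<epsilon> \<le> D \<Longrightarrow> r \<le> D \<Longrightarrow> 0 \<le> cut_ell D \<epsilon> r"
  by (auto simp: cut_ell_def)

lemma cut_ell_le: "0 < \<epsilon> \<Longrightarrow> 0 < D \<Longrightarrow> cut_ell D \<epsilon> r \<le> ln (D / \<epsilon>)"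
  by (auto simp: cut_ell_def frac_le)

lemma cut_ell_le_ell: "0 < \<epsilon> \<Longrightarrow> 0 < D \<Longrightarrow> ennreal (cut_ell D \<epsilon> r) \<le> ell D r"
  by (auto simp: cut_ell_def ell_def frac_le intro!: ennreal_leI)

lemma cut_ell_antimono: "0 < \<epsilon> \<Longrightarrow> \<epsilon> \<le> \<epsilon>' \<Longrightarrow> 0 < D \<Longrightarrow> cut_ell D \<epsilon>' r \<le> cut_ell D \<epsilon> r"
  by (auto simp: cut_ell_def frac_le)

lemma SUP_cut_ell:
  assumes "0 \<le> r" "1 \<le> D"
  shows "(SUP n. ennreal (cut_ell D (1 / Suc n) r)) = ell D r"
proof (rule antisym)
  show "(SUP n. ennreal (cut_ell D (1 / Suc n) r)) \<le> ell D r"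
    using assms by (intro SUP_least cut_ell_le_ell) auto
  show "ell D r \<le> (SUP n. ennreal (cut_ell D (1 / Suc n) r))"
  proof (cases "r = 0")
    case False
    then obtain n where "1 / real (Suc n) < r"
      using assms reals_Archimedean[of r] by (auto simp: inverse_eq_divide)
    then have "ell D r = ennreal (cut_ell D (1 / Suc n) r)"
      using assms False by (simp add: ell_def cut_ell_def max_def)
    also have "\<dots> \<le> (SUP n. ennreal (cut_ell D (1 / Suc n) r))"
      by (rule SUP_upper) simp
    finally show ?thesis .
  next
    case True
    have "of_nat m \<le> (SUP n. ennreal (cut_ell D (1 / Suc n) r))" for m
    proof -
      obtain n where "exp (real m) \<le> real n"
        using real_arch_simple by blast
      then have n: "exp (real m) \<le> real (Suc n)" by simp
      have "real m \<le> ln (real (Suc n))"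
        using n by (simp add: ln_ge_iff)
      also have "\<dots> \<le> cut_ell D (1 / Suc n) r"
        using True assms by (simp add: cut_ell_def max_def)
      finally have "of_nat m \<le> ennreal (cut_ell D (1 / Suc n) r)"
        by (simp add: ennreal_of_nat_eq_real_of_nat ennreal_leI)
      also have "\<dots> \<le> (SUP n. ennreal (cut_ell D (1 / Suc n) r))"
        by (rule SUP_upper) simp
      finally show ?thesis .
    qed
    then have "(SUP m. of_nat m) \<le> (SUP n. ennreal (cut_ell D (1 / Suc n) r))"
      by (rule SUP_least)
    then have "(SUP n. ennreal (cut_ell D (1 / Suc n) r)) = top"
      unfolding ennreal_SUP_of_nat_eq_top top_unique .
    then show ?thesis by (simp only: top_greatest)
  qed
qed

text \<open>This is \<open>log_kernel = ell D - ln D\<close>, split into positive and negative parts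
  and rearranged because subtraction in \<open>ennreal\<close> truncates. The second fact bounds the
  negative part, so that its integral can be cancelled.\<close>

lemma ereal_log_kernel_decomp:
  assumes "dist x y \<le> D" "1 \<le> D"
  shows "e2ennreal (log_kernel x y) + ennreal (ln D) = ell D (dist x y) + e2ennreal (- log_kernel x y)"
    and "e2ennreal (- log_kernel x y) \<le> ennreal (ln D)"
proof -
  show "e2ennreal (log_kernel x y) + ennreal (ln D) = ell D (dist x y) + e2ennreal (- log_kernel x y)"
  proof (cases "x = y")
    case False
    then have d: "dist x y > 0" by simp
    show ?thesis
    proof (cases "dist x y \<le> 1")
      case True
      then show ?thesis
        using d assms False
        by (simp add: log_kernel_def ell_def ln_inverse ln_div ennreal_neg flip: ennreal.rep_eq ennreal_plus)
    next
      case gt: False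
      then have "ln (dist x y) > 0" "ln (dist x y) \<le> ln D" using d assms by auto
      then show ?thesis
        using d assms False
        by (simp add: log_kernel_def ell_def ln_inverse ln_div ennreal_neg flip: ennreal_plus)
    qed
  qed (simp add: log_kernel_def ell_def)
  show "e2ennreal (- log_kernel x y) \<le> ennreal (ln D)"
    using assms by (auto simp: log_kernel_def ln_inverse e2ennreal_neg intro!: ennreal_leI ln_mono)
qed

section \<open>Energies of measures under a continuous map\<close>

locale plane_embedding =
  fixes K :: "plane set" and \<Phi> :: "plane \<Rightarrow> plane" and D :: real
  assumes compact_K: "compact K" and cont: "continuous_on K \<Phi>"
    and dist_le: "\<And>x y. x \<in> K \<Longrightarrow> y \<in> K \<Longrightarrow> dist (\<Phi> x) (\<Phi> y) \<le> D" and D_ge_1: "1 \<le> D"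
begin

abbreviation R :: "plane measure" where "R \<equiv> restrict_space borel K"

definition sep :: "plane \<times> plane \<Rightarrow> real" where
  "sep z = dist (\<Phi> (fst z)) (\<Phi> (snd z))"

text \<open>The measures stay on \<open>K\<close> and the map enters only through distances of image
  points, so different maps can be compared on the same measure. Values in \<open>ennreal\<close>
  make infinite energies harmless.\<close>

definition mutual :: "plane measure \<Rightarrow> plane measure \<Rightarrow> ennreal" where
  "mutual \<mu> \<nu> = (\<integral>\<^sup>+z. ell D (sep z) \<partial>(\<mu> \<Otimes>\<^sub>M \<nu>))"

definition cut_energy :: "real \<Rightarrow> plane measure \<Rightarrow> real" where
  "cut_energy \<epsilon> \<mu> = (\<integral>z. cut_ell D \<epsilon> (sep z) \<partial>(\<mu> \<Otimes>\<^sub>M \<mu>))"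

lemma D_pos: "0 < D" using D_ge_1 by simp

lemma inverse_Suc_le_D: "1 / real (Suc n) \<le> D"
  using D_ge_1 by (rule order_trans[rotated]) simp

lemma \<Phi>_measurable [measurable]: "\<Phi> \<in> borel_measurable R"
  using cont by (rule borel_measurable_continuous_on_restrict)

lemma sep_measurable [measurable]: "sep \<in> borel_measurable (R \<Otimes>\<^sub>M R)"
  unfolding sep_def[abs_def] by measurable

lemma pair_measurable:
  assumes "\<mu> \<in> borel_probs K" "\<nu> \<in> borel_probs K" "f \<in> measurable (R \<Otimes>\<^sub>M R) N"
  shows "f \<in> measurable (\<mu> \<Otimes>\<^sub>M \<nu>) N"
  using assms(3) measurable_cong_sets[OF sets_pair_borel_probs[OF assms(1,2)] refl] by blast

lemma space_pair: "\<mu> \<in> borel_probs K \<Longrightarrow> \<nu> \<in> borel_probs K \<Longrightarrow> space (\<mu> \<Otimes>\<^sub>M \<nu>) = K \<times> K"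
  by (simp add: space_pair_measure borel_probsD)

lemma prob_space_pair: "\<mu> \<in> borel_probs K \<Longrightarrow> \<nu> \<in> borel_probs K \<Longrightarrow> prob_space (\<mu> \<Otimes>\<^sub>M \<nu>)"
  by (intro prob_space_pair borel_probsD)

lemma sep_bounds: "z \<in> K \<times> K \<Longrightarrow> 0 \<le> sep z" "z \<in> K \<times> K \<Longrightarrow> sep z \<le> D"
  by (auto simp: sep_def dist_le)

lemma sep_continuous: "continuous_on (K \<times> K) sep"
  unfolding sep_def[abs_def]
  by (intro continuous_on_dist continuous_on_compose2[OF cont] continuous_on_fst continuous_on_snd continuous_on_id) auto

text \<open>\<open>ereal_log_kernel_decomp\<close> integrated against a probability measure; the
  integral \<open>q\<close> of the negative part is at most \<open>ln D\<close>, so it may be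
  subtracted even when the energy is infinite.\<close>

lemma log_energy_eq:
  assumes \<mu>: "\<mu> \<in> borel_probs K"
  shows "log_energy \<Phi> \<mu> = enn2ereal (mutual \<mu> \<mu>) - ereal (ln D)"
proof -
  let ?P = "\<mu> \<Otimes>\<^sub>M \<mu>" and ?f = "\<lambda>z. log_kernel (\<Phi> (fst z)) (\<Phi> (snd z))"
  interpret P: prob_space ?P by (rule prob_space_pair[OF \<mu> \<mu>])
  have "?f = (\<lambda>z. if sep z = 0 then \<infinity> else ereal (ln (inverse (sep z))))"
    by (auto simp: log_kernel_def sep_def)
  moreover have "(\<lambda>z. if sep z = 0 then \<infinity> else ereal (ln (inverse (sep z)))) \<in> borel_measurable (R \<Otimes>\<^sub>M R)"
    by measurable
  ultimately have f: "?f \<in> borel_measurable (R \<Otimes>\<^sub>M R)" by simp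
  have [measurable]: "(\<lambda>z. e2ennreal (?f z)) \<in> borel_measurable ?P" "(\<lambda>z. e2ennreal (- ?f z)) \<in> borel_measurable ?P"
    "(\<lambda>z. ell D (sep z)) \<in> borel_measurable ?P"
    using f by (intro pair_measurable[OF \<mu> \<mu>]; measurable)+
  define p where "p = (\<integral>\<^sup>+z. e2ennreal (?f z) \<partial>?P)"
  define q where "q = (\<integral>\<^sup>+z. e2ennreal (- ?f z) \<partial>?P)"
  have "p + ennreal (ln D) = (\<integral>\<^sup>+z. e2ennreal (?f z) + ennreal (ln D) \<partial>?P)"
    by (simp add: p_def nn_integral_add P.emeasure_space_1)
  also have "\<dots> = (\<integral>\<^sup>+z. ell D (sep z) + e2ennreal (- ?f z) \<partial>?P)"
    using dist_le D_ge_1 space_pair[OF \<mu> \<mu>]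
    by (intro nn_integral_cong) (auto simp: sep_def ereal_log_kernel_decomp)
  also have "\<dots> = mutual \<mu> \<mu> + q"
    by (simp add: nn_integral_add q_def mutual_def)
  finally have eq: "p + ennreal (ln D) = mutual \<mu> \<mu> + q" .
  have "q \<le> (\<integral>\<^sup>+z. ennreal (ln D) \<partial>?P)"
    unfolding q_def using dist_le D_ge_1 space_pair[OF \<mu> \<mu>]
    by (intro nn_integral_mono) (auto intro!: ereal_log_kernel_decomp)
  then have "q \<le> ennreal (ln D)" by (simp add: P.emeasure_space_1)
  then obtain q' where q': "q = ennreal q'" "q' \<ge> 0"
    by (cases q) (auto simp: top_unique)
  have "log_energy \<Phi> \<mu> = enn2ereal p - enn2ereal q"
    by (simp add: log_energy_def ereal_integral_def p_def q_def split_beta')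
  also have "\<dots> = enn2ereal (mutual \<mu> \<mu>) - ereal (ln D)"
  proof (cases p)
    case (real p')
    then have "mutual \<mu> \<mu> \<noteq> top" using eq q' by (auto simp flip: ennreal_plus)
    then obtain m where m: "mutual \<mu> \<mu> = ennreal m" "m \<ge> 0" by (cases "mutual \<mu> \<mu>") auto
    have "p' + ln D = m + q'"
      using eq q' m real D_ge_1 by (simp flip: ennreal_plus)
    then show ?thesis using q' m real by (simp add: enn2ereal_ennreal)
  next
    case top
    then have "mutual \<mu> \<mu> + ennreal q' = top" using eq q' by simp
    then have "mutual \<mu> \<mu> = top" by (simp add: ennreal_add_eq_top)
    then show ?thesis using top q' by (simp add: enn2ereal_ennreal)
  qed
  finally show ?thesis .
qed

lemma ereal_minus_le_iff_le: "a - ereal c \<le> b - ereal c \<longleftrightarrow> a \<le> b" for a b :: ereal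
  by (cases a; cases b) auto

lemma log_energy_le_iff:
  assumes "\<mu> \<in> borel_probs K" "\<nu> \<in> borel_probs K"
  shows "log_energy \<Phi> \<mu> \<le> log_energy \<Phi> \<nu> \<longleftrightarrow> mutual \<mu> \<mu> \<le> mutual \<nu> \<nu>"
  unfolding log_energy_eq[OF assms(1)] log_energy_eq[OF assms(2)] less_eq_ennreal.rep_eq
  by (rule ereal_minus_le_iff_le)

lemma cut_integrable:
  assumes \<mu>: "\<mu> \<in> borel_probs K" and "0 < \<epsilon>" "\<epsilon> \<le> D"
  shows "integrable (\<mu> \<Otimes>\<^sub>M \<mu>) (\<lambda>z. cut_ell D \<epsilon> (sep z))"
proof -
  interpret P: prob_space "\<mu> \<Otimes>\<^sub>M \<mu>" by (rule prob_space_pair[OF \<mu> \<mu>])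
  have "(\<lambda>z. cut_ell D \<epsilon> (sep z)) \<in> borel_measurable (\<mu> \<Otimes>\<^sub>M \<mu>)"
    unfolding cut_ell_def by (rule pair_measurable[OF \<mu> \<mu>]) measurable
  moreover have "\<bar>cut_ell D \<epsilon> (sep z)\<bar> \<le> ln (D / \<epsilon>)" if "z \<in> K \<times> K" for z
    using cut_ell_nonneg[of \<epsilon> D "sep z"] cut_ell_le[of \<epsilon> D "sep z"] sep_bounds[OF that] assms D_pos by simp
  ultimately show ?thesis
    using space_pair[OF \<mu> \<mu>] by (intro P.integrable_const_bound[of _ "ln (D / \<epsilon>)"]) auto
qed

lemma ennreal_cut_energy:
  assumes \<mu>: "\<mu> \<in> borel_probs K" and "0 < \<epsilon>" "\<epsilon> \<le> D"
  shows "ennreal (cut_energy \<epsilon> \<mu>) = (\<integral>\<^sup>+z. ennreal (cut_ell D \<epsilon> (sep z)) \<partial>(\<mu> \<Otimes>\<^sub>M \<mu>))"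
  unfolding cut_energy_def using assms sep_bounds space_pair[OF \<mu> \<mu>]
  by (intro nn_integral_eq_integral[symmetric] cut_integrable AE_I2) (auto intro!: cut_ell_nonneg)

lemma cut_energy_le:
  assumes \<mu>: "\<mu> \<in> borel_probs K" and "0 < \<epsilon>" "\<epsilon> \<le> D"
  shows "ennreal (cut_energy \<epsilon> \<mu>) \<le> mutual \<mu> \<mu>"
  unfolding ennreal_cut_energy[OF assms] mutual_def
  using assms D_pos by (intro nn_integral_mono cut_ell_le_ell)

lemma SUP_cut_energy:
  assumes \<mu>: "\<mu> \<in> borel_probs K"
  shows "(SUP n. ennreal (cut_energy (1 / Suc n) \<mu>)) = mutual \<mu> \<mu>"
proof -
  have "(SUP n. ennreal (cut_energy (1 / Suc n) \<mu>))
    = (SUP n. \<integral>\<^sup>+z. ennreal (cut_ell D (1 / Suc n) (sep z)) \<partial>(\<mu> \<Otimes>\<^sub>M \<mu>))"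
    using inverse_Suc_le_D by (intro SUP_cong refl ennreal_cut_energy[OF \<mu>]) auto
  also have "\<dots> = (\<integral>\<^sup>+z. (SUP n. ennreal (cut_ell D (1 / Suc n) (sep z))) \<partial>(\<mu> \<Otimes>\<^sub>M \<mu>))"
  proof (rule nn_integral_monotone_convergence_SUP[symmetric])
    show "incseq (\<lambda>n z. ennreal (cut_ell D (1 / Suc n) (sep z)))"
      using D_pos by (intro incseq_SucI le_funI ennreal_leI cut_ell_antimono) (auto simp: frac_le)
    show "(\<lambda>z. ennreal (cut_ell D (1 / Suc n) (sep z))) \<in> borel_measurable (\<mu> \<Otimes>\<^sub>M \<mu>)" for n
      unfolding cut_ell_def by (rule pair_measurable[OF \<mu> \<mu>]) measurable
  qed
  also have "\<dots> = mutual \<mu> \<mu>"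
    unfolding mutual_def using sep_bounds space_pair[OF \<mu> \<mu>] D_ge_1
    by (intro nn_integral_cong SUP_cut_ell) auto
  finally show ?thesis .
qed

lemma cut_energy_tendsto:
  assumes \<mu>: "\<And>n. \<mu> n \<in> borel_probs K" and \<nu>: "\<nu> \<in> borel_probs K" and conv: "weakly_to K \<mu> \<nu>"
    and \<epsilon>: "0 < \<epsilon>" "\<epsilon> \<le> D"
  shows "(\<lambda>n. cut_energy \<epsilon> (\<mu> n)) \<longlonglongrightarrow> cut_energy \<epsilon> \<nu>"
proof (rule tendstoI)
  fix e :: real assume e: "e > 0"
  define f where "f z = cut_ell D \<epsilon> (sep z)" for z
  have "continuous_on (K \<times> K) f"
    unfolding f_def cut_ell_def using \<epsilon> D_pos
    by (intro continuous_intros sep_continuous) (auto simp: max_def)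
  then have "uniformly_continuous_on (K \<times> K) f"
    by (rule compact_uniformly_continuous) (intro compact_Times compact_K)
  then obtain d where d: "d > 0" "\<And>z z'. z \<in> K \<times> K \<Longrightarrow> z' \<in> K \<times> K \<Longrightarrow> dist z' z < d \<Longrightarrow> dist (f z') (f z) < e / 4"
    using e unfolding uniformly_continuous_on_def by (elim allE[of _ "e / 4"]) auto
  \<comment> \<open>The uniform convergence theorem returns three times the modulus, and 3 * (e / 4)
    < e.\<close>
  have e4: "e / 4 > 0" using e by simp
  have f: "f \<in> borel_measurable (R \<Otimes>\<^sub>M R)"
    unfolding f_def cut_ell_def by measurable
  have f_bd: "\<forall>x\<in>K. \<forall>y\<in>K. \<bar>f (x, y)\<bar> \<le> ln (D / \<epsilon>)"
    using cut_ell_nonneg[of \<epsilon> D] cut_ell_le[of \<epsilon> D] sep_bounds \<epsilon> D_pos by (auto simp: f_def)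
  have f_mod: "\<forall>x\<in>K. \<forall>y\<in>K. \<forall>x'\<in>K. \<forall>y'\<in>K. dist x x' < d / 2 \<longrightarrow> dist y y' < d / 2 \<longrightarrow> \<bar>f (x, y) - f (x', y')\<bar> \<le> e / 4"
  proof (intro ballI impI)
    fix x y x' y' assume *: "x \<in> K" "y \<in> K" "x' \<in> K" "y' \<in> K" "dist x x' < d / 2" "dist y y' < d / 2"
    have "dist (x, y) (x', y') \<le> dist x x' + dist y y'"
      by (simp add: dist_Pair_Pair sqrt_sum_squares_le_sum)
    then have "dist (x, y) (x', y') < d" using * by simp
    then show "\<bar>f (x, y) - f (x', y')\<bar> \<le> e / 4"
      using d(2)[of "(x', y')" "(x, y)"] * by (simp add: dist_real_def)
  qed
  have "\<forall>\<^sub>F n in sequentially. \<bar>cut_energy \<epsilon> (\<mu> n) - cut_energy \<epsilon> \<nu>\<bar> \<le> 3 * (e / 4)"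
    unfolding cut_energy_def f_def[symmetric]
    using weak_convergence_pair_uniform[OF compact_K \<mu> \<nu> conv
        e4 half_gt_zero[OF d(1)], where B = "ln (D / \<epsilon>)"]
    by eventually_elim (use f f_bd f_mod in blast)
  then show "\<forall>\<^sub>F n in sequentially. dist (cut_energy \<epsilon> (\<mu> n)) (cut_energy \<epsilon> \<nu>) < e"
    by eventually_elim (use e in \<open>auto simp: dist_real_def\<close>)
qed

text \<open>The energy is a supremum of weakly continuous cut-off energies. The form with a
  convergent majorant \<open>c\<close> fits both uses: minimizing sequences, and equilibrium
  measures that are nearly minimal for another map.\<close>

lemma mutual_lower_semicontinuous:
  assumes \<mu>: "\<And>n. \<mu> n \<in> borel_probs K" and \<nu>: "\<nu> \<in> borel_probs K" and conv: "weakly_to K \<mu> \<nu>"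
    and le: "\<And>n. mutual (\<mu> n) (\<mu> n) \<le> c n" and c: "c \<longlonglongrightarrow> C"
  shows "mutual \<nu> \<nu> \<le> C"
proof -
  have "ennreal (cut_energy (1 / Suc m) \<nu>) \<le> C" for m
  proof -
    have \<epsilon>: "0 < 1 / real (Suc m)" "1 / real (Suc m) \<le> D"
      using inverse_Suc_le_D by auto
    have "(\<lambda>n. ennreal (cut_energy (1 / Suc m) (\<mu> n))) \<longlonglongrightarrow> ennreal (cut_energy (1 / Suc m) \<nu>)"
      by (intro tendsto_ennrealI cut_energy_tendsto[OF \<mu> \<nu> conv \<epsilon>])
    then show ?thesis
      by (rule LIMSEQ_le[OF _ c]) (use order_trans[OF cut_energy_le[OF \<mu> \<epsilon>] le] in auto)
  qed
  then show ?thesis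
    unfolding SUP_cut_energy[OF \<nu>, symmetric] by (rule SUP_least)
qed

lemma minimizer_exists:
  assumes "borel_probs K \<noteq> {}"
  obtains \<mu> where "\<mu> \<in> borel_probs K" "\<And>\<nu>. \<nu> \<in> borel_probs K \<Longrightarrow> mutual \<mu> \<mu> \<le> mutual \<nu> \<nu>"
proof -
  let ?A = "(\<lambda>\<mu>. mutual \<mu> \<mu>) ` borel_probs K"
  obtain u where u: "range u \<subseteq> ?A" "u \<longlonglongrightarrow> Inf ?A"
    using Inf_as_limit[of ?A] assms by blast
  then have "\<exists>\<mu>. \<mu> \<in> borel_probs K \<and> u n = mutual \<mu> \<mu>" for n by blast
  then obtain \<mu> where \<mu>: "\<And>n. \<mu> n \<in> borel_probs K" "\<And>n. u n = mutual (\<mu> n) (\<mu> n)" by metis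
  obtain r \<nu> where r: "strict_mono r" and \<nu>: "\<nu> \<in> borel_probs K" "weakly_to K (\<mu> \<circ> r) \<nu>"
    by (rule borel_probs_weakly_compact[OF compact_K \<mu>(1)])
  have "mutual \<nu> \<nu> \<le> Inf ?A"
    using LIMSEQ_subseq_LIMSEQ[OF u(2) r] \<mu>
    by (intro mutual_lower_semicontinuous[OF _ \<nu>, of "u \<circ> r"]) auto
  then show ?thesis
    using \<nu>(1) by (intro that) (auto dest: INF_lower[of _ _ "\<lambda>\<mu>. mutual \<mu> \<mu>"] elim: order_trans)
qed

end

section \<open>Positive definiteness and uniqueness of the minimizer\<close>

text \<open>The polynomials in two coordinates, generated additively from monomials, so that
  equality of integrals passes from moments to polynomials by induction.\<close>

inductive_set poly2 :: "(plane \<Rightarrow> real) set" where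
  monomial: "(\<lambda>x. c * ((x $ 1) ^ i * (x $ 2) ^ j)) \<in> poly2"
| add: "f \<in> poly2 \<Longrightarrow> g \<in> poly2 \<Longrightarrow> (\<lambda>x. f x + g x) \<in> poly2"

lemma poly2_mult:
  assumes "f \<in> poly2" "g \<in> poly2"
  shows "(\<lambda>x. f x * g x) \<in> poly2"
proof -
  have *: "(\<lambda>x. c * ((x $ 1) ^ i * (x $ 2) ^ j) * h x) \<in> poly2" if "h \<in> poly2" for c i j h
    using that
  proof induction
    case (monomial c' i' j')
    have eq: "(\<lambda>x :: plane. c * ((x $ 1) ^ i * (x $ 2) ^ j) * (c' * ((x $ 1) ^ i' * (x $ 2) ^ j')))
      = (\<lambda>x. (c * c') * ((x $ 1) ^ (i + i') * (x $ 2) ^ (j + j')))"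
      by (simp add: power_add algebra_simps)
    show ?case unfolding eq by (rule poly2.monomial)
  next
    case (add f g)
    then show ?case by (simp add: distrib_left poly2.add)
  qed
  show ?thesis
    using assms(1)
    by induction (use assms(2) * in \<open>auto simp: distrib_right intro: poly2.add\<close>)
qed

lemma real_polynomial_function_poly2:
  fixes p :: "plane \<Rightarrow> real"
  assumes "real_polynomial_function p"
  shows "p \<in> poly2"
  using assms
proof induction
  case (linear p)
  then interpret bounded_linear p .
  have eq: "p x = p (axis 1 1) * x $ 1 + p (axis 2 1) * x $ 2" for x
  proof -
    have "x = (x $ 1) *\<^sub>R axis 1 1 + (x $ 2) *\<^sub>R axis 2 1"
      by (simp add: vec_eq_iff forall_2 axis_def)
    then have "p x = p ((x $ 1) *\<^sub>R axis 1 1 + (x $ 2) *\<^sub>R axis 2 1)"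
      by (rule arg_cong)
    also have "\<dots> = p (axis 1 1) * x $ 1 + p (axis 2 1) * x $ 2"
      by (simp add: add scaleR mult.commute)
    finally show ?thesis .
  qed
  have "p = (\<lambda>x. p (axis 1 1) * ((x $ 1) ^ 1 * (x $ 2) ^ 0) + p (axis 2 1) * ((x $ 1) ^ 0 * (x $ 2) ^ 1))"
  proof
    fix x
    show "p x = p (axis 1 1) * ((x $ 1) ^ 1 * (x $ 2) ^ 0) + p (axis 2 1) * ((x $ 1) ^ 0 * (x $ 2) ^ 1)"
      using eq[of x] by simp
  qed
  also have "\<dots> \<in> poly2" by (intro poly2.intros)
  finally show ?case .
next
  case (const c)
  show ?case using poly2.monomial[of c 0 0] by simp
qed (auto intro: poly2.add poly2_mult)

section \<open>Gaussian energies and weighted moments\<close>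

context plane_embedding begin

definition gauss :: "real \<Rightarrow> plane measure \<Rightarrow> plane measure \<Rightarrow> real" where
  "gauss s \<mu> \<nu> = (\<integral>z. exp (- s * (sep z)\<^sup>2) \<partial>(\<mu> \<Otimes>\<^sub>M \<nu>))"

text \<open>The one-variable factor in the product expansion of the Gaussian kernel: a Gaussian
  weight times a monomial, both in the image point.\<close>

definition mono_fun :: "real \<Rightarrow> nat \<Rightarrow> nat \<Rightarrow> plane \<Rightarrow> real" where
  "mono_fun s i j x = exp (- s * (norm (\<Phi> x))\<^sup>2) * ((\<Phi> x $ 1) ^ i * (\<Phi> x $ 2) ^ j)"

definition moment :: "real \<Rightarrow> nat \<Rightarrow> nat \<Rightarrow> plane measure \<Rightarrow> real" where
  "moment s i j \<mu> = (\<integral>x. mono_fun s i j x \<partial>\<mu>)"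

lemma mono_fun_continuous: "continuous_on K (mono_fun s i j)"
  unfolding mono_fun_def by (intro continuous_intros cont)

text \<open>\<open>frullani_ell\<close> integrated over pairs, with the order exchanged by Tonelli.
  The term with \<open>D\<close> passes through unchanged because the total mass is 1.\<close>

lemma two_mutual_eq:
  assumes \<mu>: "\<mu> \<in> borel_probs K" and \<nu>: "\<nu> \<in> borel_probs K"
  shows "2 * mutual \<mu> \<nu>
    = (\<integral>\<^sup>+s. ennreal ((gauss s \<mu> \<nu> - exp (- s * D\<^sup>2)) / s) * indicator {0<..} s \<partial>lborel)"
proof -
  let ?P = "\<mu> \<Otimes>\<^sub>M \<nu>"
  interpret P: prob_space ?P by (rule prob_space_pair[OF \<mu> \<nu>])
  interpret Q: pair_sigma_finite ?P "lborel :: real measure" ..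
  have [measurable]: "sep \<in> borel_measurable ?P"
    by (rule pair_measurable[OF \<mu> \<nu> sep_measurable])
  let ?F = "\<lambda>z s. ennreal ((exp (- s * (sep z)\<^sup>2) - exp (- s * D\<^sup>2)) / s) * indicator {0<..} s"
  have "2 * mutual \<mu> \<nu> = (\<integral>\<^sup>+z. 2 * ell D (sep z) \<partial>?P)"
    unfolding mutual_def by (rule nn_integral_cmult[symmetric]) measurable
  also have "\<dots> = (\<integral>\<^sup>+z. \<integral>\<^sup>+s. ?F z s \<partial>lborel \<partial>?P)"
    using sep_bounds D_pos space_pair[OF \<mu> \<nu>] by (intro nn_integral_cong frullani_ell) auto
  also have "\<dots> = (\<integral>\<^sup>+s. \<integral>\<^sup>+z. ?F z s \<partial>?P \<partial>lborel)"
    by (rule Q.Fubini'[symmetric]) measurable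
  also have "\<dots> = (\<integral>\<^sup>+s. ennreal ((gauss s \<mu> \<nu> - exp (- s * D\<^sup>2)) / s) * indicator {0<..} s \<partial>lborel)"
  proof (rule nn_integral_cong)
    fix s :: real
    show "(\<integral>\<^sup>+z. ?F z s \<partial>?P) = ennreal ((gauss s \<mu> \<nu> - exp (- s * D\<^sup>2)) / s) * indicator {0<..} s"
    proof (cases "s > 0")
      case s: True
      have int: "integrable ?P (\<lambda>z. exp (- s * (sep z)\<^sup>2))"
        using s by (intro P.integrable_const_bound[of _ 1]) auto
      have "exp (- s * D\<^sup>2) \<le> exp (- s * (sep z)\<^sup>2)" if "z \<in> K \<times> K" for z
        using sep_bounds[OF that] s by (auto intro!: power_mono)
      then have "(\<integral>\<^sup>+z. ennreal ((exp (- s * (sep z)\<^sup>2) - exp (- s * D\<^sup>2)) / s) \<partial>?P)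
        = ennreal (\<integral>z. (exp (- s * (sep z)\<^sup>2) - exp (- s * D\<^sup>2)) / s \<partial>?P)"
        using int s space_pair[OF \<mu> \<nu>] by (intro nn_integral_eq_integral AE_I2) (auto intro!: divide_nonneg_pos)
      also have "(\<integral>z. (exp (- s * (sep z)\<^sup>2) - exp (- s * D\<^sup>2)) / s \<partial>?P) = (gauss s \<mu> \<nu> - exp (- s * D\<^sup>2)) / s"
        using int by (simp add: gauss_def P.prob_space)
      finally show ?thesis using s by simp
    qed simp
  qed
  finally show ?thesis .
qed

text \<open>Expanding the square of the distance splits off one weight per point and leaves the
  exponential of a multiple of the inner product. Its power series, with the powers of the two-term
  inner product expanded binomially, consists of products of one-variable functions. A bound
  \<open>B\<close> for the image points gives the summable majorant for termwise
  integration.\<close>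

lemma gauss_sums:
  assumes \<mu>: "\<mu> \<in> borel_probs K" and \<nu>: "\<nu> \<in> borel_probs K" and s: "s > 0"
  shows "(\<lambda>n. (2 * s) ^ n / fact n * (\<Sum>k\<le>n. real (n choose k) * (moment s k (n - k) \<mu> * moment s k (n - k) \<nu>)))
    sums gauss s \<mu> \<nu>"
proof -
  let ?P = "\<mu> \<Otimes>\<^sub>M \<nu>"
  interpret P: prob_space ?P by (rule prob_space_pair[OF \<mu> \<nu>])
  define T where "T n z = (2 * s) ^ n / fact n *
    (\<Sum>k\<le>n. real (n choose k) * (mono_fun s k (n - k) (fst z) * mono_fun s k (n - k) (snd z)))" for n z
  define w where "w z = exp (- s * (norm (\<Phi> (fst z)))\<^sup>2) * exp (- s * (norm (\<Phi> (snd z)))\<^sup>2)" for z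
  have T_eq: "T n z = w z * ((2 * s * (\<Phi> (fst z) \<bullet> \<Phi> (snd z))) ^ n / fact n)" for n z
  proof -
    let ?a = "\<Phi> (fst z)" and ?b = "\<Phi> (snd z)"
    have "(?a \<bullet> ?b) ^ n = (\<Sum>k\<le>n. real (n choose k) * ((?a $ 1) ^ k * (?a $ 2) ^ (n - k) * ((?b $ 1) ^ k * (?b $ 2) ^ (n - k))))"
      by (simp add: inner_vec_def sum_2 binomial_ring power_mult_distrib ac_simps)
    then have eq: "w z * (?a \<bullet> ?b) ^ n
      = (\<Sum>k\<le>n. real (n choose k) * (mono_fun s k (n - k) (fst z) * mono_fun s k (n - k) (snd z)))"
      by (simp add: w_def mono_fun_def sum_distrib_left ac_simps)
    have "T n z = (2 * s) ^ n / fact n * (w z * (?a \<bullet> ?b) ^ n)"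
      by (simp only: T_def eq)
    then show ?thesis
      by (simp add: power_mult_distrib)
  qed
  have T_int: "integrable ?P (T n)" for n
    unfolding T_def
    by (intro integrable_mult_right Bochner_Integration.integrable_sum
        borel_probs_product(1)[OF compact_K \<mu> \<nu>] mono_fun_continuous)
  have T_integral: "(\<integral>z. T n z \<partial>?P) = (2 * s) ^ n / fact n *
      (\<Sum>k\<le>n. real (n choose k) * (moment s k (n - k) \<mu> * moment s k (n - k) \<nu>))" for n
    unfolding T_def
    by (subst integral_mult_right_zero, subst Bochner_Integration.integral_sum)
       (auto simp: borel_probs_product[OF compact_K \<mu> \<nu> mono_fun_continuous mono_fun_continuous] moment_def)
  have sums: "(\<lambda>n. T n z) sums exp (- s * (sep z)\<^sup>2)" for z
  proof -
    have "- s * (sep z)\<^sup>2 = - s * (norm (\<Phi> (fst z)))\<^sup>2 + - s * (norm (\<Phi> (snd z)))\<^sup>2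
      + 2 * s * (\<Phi> (fst z) \<bullet> \<Phi> (snd z))"
      by (simp add: sep_def dist_norm power2_norm_eq_inner inner_diff algebra_simps inner_commute)
    then have "exp (- s * (sep z)\<^sup>2) = w z * exp (2 * s * (\<Phi> (fst z) \<bullet> \<Phi> (snd z)))"
      by (simp add: w_def flip: exp_add)
    then show ?thesis
      unfolding T_eq using sums_mult[OF exp_converges[of "2 * s * (\<Phi> (fst z) \<bullet> \<Phi> (snd z))"], of "w z"]
      by (simp add: divide_inverse mult.commute)
  qed
  obtain B where B: "B > 0" "\<And>x. x \<in> K \<Longrightarrow> norm (\<Phi> x) \<le> B"
    using compact_imp_bounded[OF compact_continuous_image[OF cont compact_K]] by (auto simp: bounded_pos)
  have bound: "\<bar>T n z\<bar> \<le> (2 * s * B\<^sup>2) ^ n / fact n" if z: "z \<in> K \<times> K" for n z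
  proof -
    have "\<bar>\<Phi> (fst z) \<bullet> \<Phi> (snd z)\<bar> \<le> norm (\<Phi> (fst z)) * norm (\<Phi> (snd z))"
      by (rule Cauchy_Schwarz_ineq2)
    also have "\<dots> \<le> B\<^sup>2"
      unfolding power2_eq_square using B z by (intro mult_mono) auto
    finally have "\<bar>(2 * s * (\<Phi> (fst z) \<bullet> \<Phi> (snd z))) ^ n / fact n\<bar> \<le> (2 * s * B\<^sup>2) ^ n / fact n"
      using s by (auto simp: abs_mult power_abs intro!: divide_right_mono power_mono)
    moreover have "0 \<le> w z" "w z \<le> 1"
      using s by (auto simp: w_def mult_le_one)
    ultimately have "\<bar>w z\<bar> * \<bar>(2 * s * (\<Phi> (fst z) \<bullet> \<Phi> (snd z))) ^ n / fact n\<bar> \<le> 1 * ((2 * s * B\<^sup>2) ^ n / fact n)"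
      by (intro mult_mono) auto
    then show ?thesis
      unfolding T_eq abs_mult by simp
  qed
  have sumB: "summable (\<lambda>n. (2 * s * B\<^sup>2) ^ n / fact n)"
    using exp_converges[of "2 * s * B\<^sup>2"] by (simp add: sums_iff divide_inverse mult.commute)
  have "(\<lambda>n. \<integral>z. T n z \<partial>?P) sums (\<integral>z. (\<Sum>n. T n z) \<partial>?P)"
  proof (rule sums_integral[OF T_int])
    show "AE z in ?P. summable (\<lambda>n. norm (T n z))"
      using bound space_pair[OF \<mu> \<nu>]
      by (intro AE_I2 summable_comparison_test'[OF sumB, of 0]) auto
    have "(\<integral>z. norm (T n z) \<partial>?P) \<le> (2 * s * B\<^sup>2) ^ n / fact n" for n
    proof -
      have "(\<integral>z. norm (T n z) \<partial>?P) \<le> (\<integral>z. (2 * s * B\<^sup>2) ^ n / fact n \<partial>?P)"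
        using bound space_pair[OF \<mu> \<nu>] T_int by (intro integral_mono integrable_norm) auto
      then show ?thesis by (simp add: P.prob_space)
    qed
    then show "summable (\<lambda>n. \<integral>z. norm (T n z) \<partial>?P)"
      by (intro summable_comparison_test'[OF sumB, of 0]) auto
  qed
  then show ?thesis
    unfolding T_integral gauss_def using sums by (simp add: sums_iff)
qed

text \<open>The Gaussian energy of the signed measure \<open>\<mu> - \<nu>\<close>, multiplied
  out.\<close>

definition gauss_gap :: "real \<Rightarrow> plane measure \<Rightarrow> plane measure \<Rightarrow> real" where
  "gauss_gap s \<mu> \<nu> = gauss s \<mu> \<mu> + gauss s \<nu> \<nu> - 2 * gauss s \<mu> \<nu>"

text \<open>Positive definiteness made explicit: each product of moments becomes the square of a
  difference of moments, so the gap is nonnegative and vanishes only if all moments agree.\<close>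

lemma gauss_gap_sums:
  assumes \<mu>: "\<mu> \<in> borel_probs K" and \<nu>: "\<nu> \<in> borel_probs K" and s: "s > 0"
  shows "(\<lambda>n. (2 * s) ^ n / fact n * (\<Sum>k\<le>n. real (n choose k) * (moment s k (n - k) \<mu> - moment s k (n - k) \<nu>)\<^sup>2))
    sums gauss_gap s \<mu> \<nu>"
proof -
  have "(\<Sum>k\<le>n. real (n choose k) * (a k - b k)\<^sup>2) = (\<Sum>k\<le>n. real (n choose k) * (a k * a k))
     + (\<Sum>k\<le>n. real (n choose k) * (b k * b k)) - 2 * (\<Sum>k\<le>n. real (n choose k) * (a k * b k))"
    for n and a b :: "nat \<Rightarrow> real"
    by (simp add: power2_eq_square algebra_simps sum.distrib sum_subtractf sum_distrib_left)
  then show ?thesis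
    unfolding gauss_gap_def
    using sums_diff[OF sums_add[OF gauss_sums[OF \<mu> \<mu> s] gauss_sums[OF \<nu> \<nu> s]] sums_mult[OF gauss_sums[OF \<mu> \<nu> s], of 2]]
    by (simp only: distrib_left right_diff_distrib mult.left_commute[of _ "2::real"])
qed

lemma gauss_gap_nonneg:
  assumes \<mu>: "\<mu> \<in> borel_probs K" and \<nu>: "\<nu> \<in> borel_probs K" and s: "s > 0"
  shows "0 \<le> gauss_gap s \<mu> \<nu>"
  by (rule sums_le[OF _ sums_zero gauss_gap_sums[OF assms]])
     (use s in \<open>auto intro!: mult_nonneg_nonneg divide_nonneg_pos sum_nonneg\<close>)

lemma gauss_gap_eq_0_moments:
  assumes \<mu>: "\<mu> \<in> borel_probs K" and \<nu>: "\<nu> \<in> borel_probs K" and s: "s > 0"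
    and gap: "gauss_gap s \<mu> \<nu> = 0"
  shows "moment s i j \<mu> = moment s i j \<nu>"
proof -
  define c where "c n = (2 * s) ^ n / fact n *
    (\<Sum>k\<le>n. real (n choose k) * (moment s k (n - k) \<mu> - moment s k (n - k) \<nu>)\<^sup>2)" for n
  have "c n \<ge> 0" for n
    unfolding c_def using s by (auto intro!: mult_nonneg_nonneg divide_nonneg_pos sum_nonneg)
  moreover have "c sums 0"
    using gauss_gap_sums[OF \<mu> \<nu> s] gap by (simp add: c_def[abs_def])
  \<comment> \<open>The moment with indices \<open>i\<close> and \<open>j\<close> occurs in the term
    of degree \<open>i + j\<close>, at \<open>k = i\<close>.\<close>
  ultimately have "c (i + j) = 0"
    using suminf_eq_zero_iff[of c] by (simp add: sums_iff)
  then have "(\<Sum>k\<le>i + j. real (i + j choose k) * (moment s k (i + j - k) \<mu> - moment s k (i + j - k) \<nu>)\<^sup>2) = 0"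
    using s by (simp add: c_def)
  then have "real (i + j choose i) * (moment s i (i + j - i) \<mu> - moment s i (i + j - i) \<nu>)\<^sup>2 = 0"
    by (subst (asm) sum_nonneg_eq_0_iff) (auto dest!: bspec[of _ _ i])
  then show ?thesis by simp
qed

text \<open>Equal weighted moments give equal integrals of weight times polynomial. By injectivity
  \<open>f\<close> is a continuous function of the image point, and Stone-Weierstrass on the compact
  image does the rest.\<close>

lemma gauss_gap_eq_0_imp_eq:
  assumes \<mu>: "\<mu> \<in> borel_probs K" and \<nu>: "\<nu> \<in> borel_probs K" and s: "s > 0" and inj: "inj_on \<Phi> K"
    and gap: "gauss_gap s \<mu> \<nu> = 0"
  shows "\<mu> = \<nu>"
proof (rule borel_probs_eqI[OF compact_K \<mu> \<nu>])
  fix f :: "plane \<Rightarrow> real" assume f: "continuous_on K f"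
  define w where "w x = exp (- s * (norm (\<Phi> x))\<^sup>2)" for x
  have w_cont: "continuous_on K w"
    unfolding w_def by (intro continuous_intros cont)
  have w: "0 < w x" "w x \<le> 1" for x
    using s by (auto simp: w_def)
  have poly_cont: "continuous_on S p" if "p \<in> poly2" for p S
    using that by induction (intro continuous_intros)+
  have wp_cont: "continuous_on K (\<lambda>x. w x * p (\<Phi> x))" if "p \<in> poly2" for p
    by (intro continuous_intros w_cont continuous_on_compose2[OF poly_cont[OF that, of UNIV] cont]) auto
  have poly_eq: "(\<integral>x. w x * p (\<Phi> x) \<partial>\<mu>) = (\<integral>x. w x * p (\<Phi> x) \<partial>\<nu>)" if "p \<in> poly2" for p
    using that
  proof induction
    case (monomial c i j)
    then show ?case
      using gauss_gap_eq_0_moments[OF \<mu> \<nu> s gap, of i j]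
      by (simp add: moment_def mono_fun_def w_def mult.left_commute[of _ c])
  next
    case (add f g)
    then show ?case
      using borel_probs_integrable[OF compact_K \<mu> wp_cont] borel_probs_integrable[OF compact_K \<nu> wp_cont]
      by (simp add: distrib_left)
  qed
  have small: "\<bar>(\<integral>x. f x \<partial>\<mu>) - (\<integral>x. f x \<partial>\<nu>)\<bar> \<le> 2 * e" if e: "e > 0" for e
  proof -
    define \<Psi> where "\<Psi> = inv_into K \<Phi>"
    have \<Psi>: "\<Psi> (\<Phi> x) = x" if "x \<in> K" for x
      unfolding \<Psi>_def using inj that by simp
    then have "continuous_on (\<Phi> ` K) \<Psi>"
      by (intro continuous_on_inv[OF cont compact_K]) auto
    \<comment> \<open>The quotient by the weight is approximated, since the moments carry the
      weight; \<open>w \<le> 1\<close> keeps the error below \<open>e\<close> after multiplying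
      back.\<close>
    then have "continuous_on (\<Phi> ` K) (\<lambda>y. f (\<Psi> y) / w (\<Psi> y))"
      using \<Psi> w(1)
      by (intro continuous_on_divide continuous_on_compose2[OF f] continuous_on_compose2[OF w_cont])
         (auto simp: less_imp_neq[symmetric])
    then obtain p where p: "real_polynomial_function p" "\<And>y. y \<in> \<Phi> ` K \<Longrightarrow> \<bar>f (\<Psi> y) / w (\<Psi> y) - p y\<bar> < e"
      by - (rule Stone_Weierstrass_real_polynomial_function[OF compact_continuous_image[OF cont compact_K] _ e],
          assumption, blast)
    note pp = real_polynomial_function_poly2[OF p(1)]
    have close: "\<bar>f x - w x * p (\<Phi> x)\<bar> \<le> e" if x: "x \<in> K" for x
    proof -
      have "f x - w x * p (\<Phi> x) = w x * (f x / w x - p (\<Phi> x))"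
        using w(1)[of x] by (simp add: right_diff_distrib)
      also have "\<bar>\<dots>\<bar> \<le> 1 * e"
        unfolding abs_mult using w[of x] p(2)[of "\<Phi> x"] \<Psi>[OF x] x by (intro mult_mono) auto
      finally show ?thesis by simp
    qed
    have "\<bar>(\<integral>x. f x \<partial>\<rho>) - (\<integral>x. w x * p (\<Phi> x) \<partial>\<rho>)\<bar> \<le> e" if \<rho>: "\<rho> \<in> borel_probs K" for \<rho>
    proof -
      interpret prob_space \<rho> using borel_probsD(1)[OF \<rho>] .
      note int = borel_probs_integrable[OF compact_K \<rho> f] borel_probs_integrable[OF compact_K \<rho> wp_cont[OF pp]]
      have "\<bar>(\<integral>x. f x \<partial>\<rho>) - (\<integral>x. w x * p (\<Phi> x) \<partial>\<rho>)\<bar> = \<bar>\<integral>x. f x - w x * p (\<Phi> x) \<partial>\<rho>\<bar>"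
        using int by simp
      also have "\<dots> \<le> (\<integral>x. \<bar>f x - w x * p (\<Phi> x)\<bar> \<partial>\<rho>)"
        by (rule integral_abs_bound)
      also have "\<dots> \<le> (\<integral>x. e \<partial>\<rho>)"
        using int close borel_probsD(3)[OF \<rho>] by (intro integral_mono integrable_abs) auto
      finally show ?thesis by (simp add: prob_space)
    qed
    from this[OF \<mu>] this[OF \<nu>] poly_eq[OF pp] show ?thesis by (simp add: abs_le_iff)
  qed
  have "\<bar>(\<integral>x. f x \<partial>\<mu>) - (\<integral>x. f x \<partial>\<nu>)\<bar> \<le> 0"
  proof (rule field_le_epsilon)
    fix e :: real assume "e > 0"
    then show "\<bar>(\<integral>x. f x \<partial>\<mu>) - (\<integral>x. f x \<partial>\<nu>)\<bar> \<le> 0 + e"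
      using small[of "e / 2"] by simp
  qed
  then show "(\<integral>x. f x \<partial>\<mu>) = (\<integral>x. f x \<partial>\<nu>)" by simp
qed

end

text \<open>Toss a fair coin and draw from \<open>\<mu>\<close> or from \<open>\<nu>\<close>: as a
  monadic bind, the half-sum is a probability measure with the right sigma-algebra at once.\<close>

lemma borel_probs_midpoint:
  assumes \<mu>: "\<mu> \<in> borel_probs K" and \<nu>: "\<nu> \<in> borel_probs K"
  obtains m where "m \<in> borel_probs K"
    "\<And>f. f \<in> borel_measurable (restrict_space borel K) \<Longrightarrow> 2 * (\<integral>\<^sup>+x. f x \<partial>m) = (\<integral>\<^sup>+x. f x \<partial>\<mu>) + (\<integral>\<^sup>+x. f x \<partial>\<nu>)"
proof -
  let ?R = "restrict_space borel K"
  define B where "B = measure_pmf (bernoulli_pmf (1/2))"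
  define F where "F b = (if b then \<mu> else \<nu>)" for b
  have F: "F \<in> B \<rightarrow>\<^sub>M prob_algebra ?R"
    unfolding B_def F_def using borel_probsD[OF \<mu>] borel_probsD[OF \<nu>]
    by (auto simp: space_prob_algebra)
  have B: "B \<in> space (prob_algebra B)"
    by (simp add: space_prob_algebra B_def measure_pmf.prob_space_axioms)
  define m where "m = B \<bind> F"
  have "m \<in> borel_probs K"
    using prob_space_bind'[OF B F] sets_bind'[OF B F] by (simp add: borel_probs_def m_def)
  moreover have "2 * (\<integral>\<^sup>+x. f x \<partial>m) = (\<integral>\<^sup>+x. f x \<partial>\<mu>) + (\<integral>\<^sup>+x. f x \<partial>\<nu>)"
    if f: "f \<in> borel_measurable ?R" for f
  proof -
    have "(\<integral>\<^sup>+x. f x \<partial>m) = (\<integral>\<^sup>+b. \<integral>\<^sup>+x. f x \<partial>F b \<partial>B)"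
      unfolding m_def by (rule nn_integral_bind[OF f measurable_prob_algebraD[OF F]])
    also have "\<dots> = (\<integral>\<^sup>+x. f x \<partial>\<mu>) * ennreal (1/2) + (\<integral>\<^sup>+x. f x \<partial>\<nu>) * ennreal (1/2)"
      unfolding B_def by (subst nn_integral_bernoulli_pmf) (simp_all add: F_def)
    finally have "2 * (\<integral>\<^sup>+x. f x \<partial>m) = (2 * ennreal (1/2)) * ((\<integral>\<^sup>+x. f x \<partial>\<mu>) + (\<integral>\<^sup>+x. f x \<partial>\<nu>))"
      by (simp add: algebra_simps)
    also have "2 * ennreal (1/2) = 1"
      using ennreal_mult[of 2 "1/2"] by simp
    finally show ?thesis by simp
  qed
  ultimately show ?thesis by (rule that)
qed

section \<open>Bilinearity and strict convexity of the energy\<close>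

context plane_embedding begin

lemma mutual_iterated:
  assumes \<mu>: "\<mu> \<in> borel_probs K" and \<nu>: "\<nu> \<in> borel_probs K"
  shows "mutual \<mu> \<nu> = (\<integral>\<^sup>+x. \<integral>\<^sup>+y. ell D (sep (x, y)) \<partial>\<nu> \<partial>\<mu>)"
proof -
  interpret \<nu>: prob_space \<nu> using borel_probsD(1)[OF \<nu>] .
  show ?thesis
    unfolding mutual_def by (rule \<nu>.nn_integral_fst[symmetric]) (rule pair_measurable[OF \<mu> \<nu>], measurable)
qed

lemma inner_measurable:
  assumes \<nu>: "\<nu> \<in> borel_probs K"
  shows "(\<lambda>x. \<integral>\<^sup>+y. ell D (sep (x, y)) \<partial>\<nu>) \<in> borel_measurable R"
proof -
  interpret \<nu>: prob_space \<nu> using borel_probsD(1)[OF \<nu>] .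
  have "sets (R \<Otimes>\<^sub>M \<nu>) = sets (R \<Otimes>\<^sub>M R)"
    by (intro sets_pair_measure_cong refl borel_probsD(2)[OF \<nu>])
  then have "(\<lambda>(x, y). ell D (sep (x, y))) \<in> borel_measurable (R \<Otimes>\<^sub>M \<nu>)"
    by (subst measurable_cong_sets[OF _ refl]) (assumption, measurable)
  then show ?thesis
    by (rule \<nu>.borel_measurable_nn_integral)
qed

text \<open>Linearity in one variable at a time, through the iterated integral. Both mixed terms are
  kept, so no symmetry of \<open>mutual\<close> is invoked.\<close>

lemma mutual_midpoint:
  assumes \<mu>: "\<mu> \<in> borel_probs K" and \<nu>: "\<nu> \<in> borel_probs K"
  obtains m where "m \<in> borel_probs K"
    "4 * mutual m m = mutual \<mu> \<mu> + mutual \<mu> \<nu> + mutual \<nu> \<mu> + mutual \<nu> \<nu>"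
proof -
  obtain m where m: "m \<in> borel_probs K"
    and half: "\<And>f. f \<in> borel_measurable R \<Longrightarrow> 2 * (\<integral>\<^sup>+x. f x \<partial>m) = (\<integral>\<^sup>+x. f x \<partial>\<mu>) + (\<integral>\<^sup>+x. f x \<partial>\<nu>)"
    using borel_probs_midpoint[OF \<mu> \<nu>] by blast
  have left: "2 * mutual m \<rho> = mutual \<mu> \<rho> + mutual \<nu> \<rho>" if \<rho>: "\<rho> \<in> borel_probs K" for \<rho>
    unfolding mutual_iterated[OF m \<rho>] mutual_iterated[OF \<mu> \<rho>] mutual_iterated[OF \<nu> \<rho>]
    by (rule half[OF inner_measurable[OF \<rho>]])
  have right: "2 * mutual \<rho> m = mutual \<rho> \<mu> + mutual \<rho> \<nu>" if \<rho>: "\<rho> \<in> borel_probs K" for \<rho>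
  proof -
    have in_\<rho>: "(\<lambda>x. \<integral>\<^sup>+y. ell D (sep (x, y)) \<partial>\<sigma>) \<in> borel_measurable \<rho>" if "\<sigma> \<in> borel_probs K" for \<sigma>
      using inner_measurable[OF that] measurable_cong_sets[OF borel_probsD(2)[OF \<rho>] refl] by blast
    have sec: "(\<lambda>y. ell D (sep (x, y))) \<in> borel_measurable R" if "x \<in> K" for x
      by (rule measurable_compose_Pair1[of x R "\<lambda>z. ell D (sep z)"])
         (use that in \<open>auto simp: space_restrict_space\<close>)
    have "2 * mutual \<rho> m = (\<integral>\<^sup>+x. 2 * \<integral>\<^sup>+y. ell D (sep (x, y)) \<partial>m \<partial>\<rho>)"
      unfolding mutual_iterated[OF \<rho> m] by (rule nn_integral_cmult[OF in_\<rho>[OF m], symmetric])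
    also have "\<dots> = (\<integral>\<^sup>+x. (\<integral>\<^sup>+y. ell D (sep (x, y)) \<partial>\<mu>) + (\<integral>\<^sup>+y. ell D (sep (x, y)) \<partial>\<nu>) \<partial>\<rho>)"
      using half[OF sec] borel_probsD(3)[OF \<rho>] by (intro nn_integral_cong) auto
    also have "\<dots> = mutual \<rho> \<mu> + mutual \<rho> \<nu>"
      unfolding mutual_iterated[OF \<rho> \<mu>] mutual_iterated[OF \<rho> \<nu>]
      by (rule nn_integral_add[OF in_\<rho>[OF \<mu>] in_\<rho>[OF \<nu>]])
    finally show ?thesis .
  qed
  have "4 * mutual m m = 2 * (2 * mutual m m)"
    by (simp add: mult.assoc[symmetric])
  also have "\<dots> = mutual \<mu> \<mu> + mutual \<mu> \<nu> + mutual \<nu> \<mu> + mutual \<nu> \<nu>"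
    unfolding left[OF m] distrib_left right[OF \<mu>] right[OF \<nu>] by (simp add: add.assoc)
  finally show ?thesis using m that by blast
qed

lemma gauss_lower:
  assumes \<mu>: "\<mu> \<in> borel_probs K" and \<nu>: "\<nu> \<in> borel_probs K" and s: "s > 0"
  shows "exp (- s * D\<^sup>2) \<le> gauss s \<mu> \<nu>"
proof -
  interpret P: prob_space "\<mu> \<Otimes>\<^sub>M \<nu>" by (rule prob_space_pair[OF \<mu> \<nu>])
  have [measurable]: "sep \<in> borel_measurable (\<mu> \<Otimes>\<^sub>M \<nu>)"
    by (rule pair_measurable[OF \<mu> \<nu> sep_measurable])
  have "(\<integral>z. exp (- s * D\<^sup>2) \<partial>(\<mu> \<Otimes>\<^sub>M \<nu>)) \<le> gauss s \<mu> \<nu>"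
    unfolding gauss_def
  proof (rule integral_mono)
    show "integrable (\<mu> \<Otimes>\<^sub>M \<nu>) (\<lambda>z. exp (- s * (sep z)\<^sup>2))"
      using s by (intro P.integrable_const_bound[of _ 1]) auto
    show "exp (- s * D\<^sup>2) \<le> exp (- s * (sep z)\<^sup>2)" if "z \<in> space (\<mu> \<Otimes>\<^sub>M \<nu>)" for z
      using sep_bounds[of z] that s space_pair[OF \<mu> \<nu>] by (auto intro!: power_mono)
  qed simp
  then show ?thesis by (simp add: P.prob_space)
qed

lemma gauss_measurable:
  assumes \<mu>: "\<mu> \<in> borel_probs K" and \<nu>: "\<nu> \<in> borel_probs K"
  shows "(\<lambda>s. gauss s \<mu> \<nu>) \<in> borel_measurable lborel"
proof -
  interpret P: prob_space "\<mu> \<Otimes>\<^sub>M \<nu>" by (rule prob_space_pair[OF \<mu> \<nu>])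
  have [measurable]: "sep \<in> borel_measurable (\<mu> \<Otimes>\<^sub>M \<nu>)"
    by (rule pair_measurable[OF \<mu> \<nu> sep_measurable])
  show ?thesis
    unfolding gauss_def by (rule P.borel_measurable_lebesgue_integral) measurable
qed

text \<open>In the Frullani representations the terms with \<open>D\<close> cancel, as 1 + 1 - 2 =
  0, and what remains is the Gaussian gap. The mixed energy stands on the left because it might be
  infinite.\<close>

lemma mutual_gap:
  assumes \<mu>: "\<mu> \<in> borel_probs K" and \<nu>: "\<nu> \<in> borel_probs K"
  shows "4 * mutual \<mu> \<nu> + (\<integral>\<^sup>+s. ennreal (gauss_gap s \<mu> \<nu> / s) * indicator {0<..} s \<partial>lborel)
    = 2 * mutual \<mu> \<mu> + 2 * mutual \<nu> \<nu>"
proof -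
  let ?g = "\<lambda>\<alpha> \<beta> s. (gauss s \<alpha> \<beta> - exp (- s * D\<^sup>2)) / s"
  let ?G = "\<lambda>\<alpha> \<beta> s. ennreal (?g \<alpha> \<beta> s) * indicator {0<..} s"
  let ?H = "\<lambda>s. ennreal (gauss_gap s \<mu> \<nu> / s) * indicator {0<..} s"
  note [measurable] = gauss_measurable[OF \<mu> \<mu>] gauss_measurable[OF \<mu> \<nu>] gauss_measurable[OF \<nu> \<nu>]
  have [measurable]: "?H \<in> borel_measurable lborel"
    unfolding gauss_gap_def by measurable
  have pt: "2 * ?G \<mu> \<nu> s + ?H s = ?G \<mu> \<mu> s + ?G \<nu> \<nu> s" for s
  proof (cases "s > 0")
    case s: True
    have nn: "0 \<le> ?g \<mu> \<mu> s" "0 \<le> ?g \<mu> \<nu> s" "0 \<le> ?g \<nu> \<nu> s" "0 \<le> gauss_gap s \<mu> \<nu> / s"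
      using s gauss_lower[OF \<mu> \<mu> s] gauss_lower[OF \<mu> \<nu> s] gauss_lower[OF \<nu> \<nu> s] gauss_gap_nonneg[OF \<mu> \<nu> s]
      by simp_all
    have "2 * ?g \<mu> \<nu> s + gauss_gap s \<mu> \<nu> / s = ?g \<mu> \<mu> s + ?g \<nu> \<nu> s"
      by (simp add: gauss_gap_def add_divide_distrib diff_divide_distrib)
    then have "2 * ennreal (?g \<mu> \<nu> s) + ennreal (gauss_gap s \<mu> \<nu> / s) = ennreal (?g \<mu> \<mu> s) + ennreal (?g \<nu> \<nu> s)"
      using nn by (simp only: ennreal_numeral[symmetric] ennreal_mult[symmetric] ennreal_plus[symmetric] zero_le_numeral mult_nonneg_nonneg)
    then show ?thesis using s by simp
  qed simp
  have "4 * mutual \<mu> \<nu> + (\<integral>\<^sup>+s. ?H s \<partial>lborel) = 2 * (2 * mutual \<mu> \<nu>) + (\<integral>\<^sup>+s. ?H s \<partial>lborel)"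
    by (simp add: mult.assoc[symmetric])
  also have "\<dots> = (\<integral>\<^sup>+s. 2 * ?G \<mu> \<nu> s + ?H s \<partial>lborel)"
    unfolding two_mutual_eq[OF \<mu> \<nu>] by (subst nn_integral_add) (simp_all add: nn_integral_cmult)
  also have "\<dots> = 2 * mutual \<mu> \<mu> + 2 * mutual \<nu> \<nu>"
    unfolding pt two_mutual_eq[OF \<mu> \<mu>] two_mutual_eq[OF \<nu> \<nu>] by (subst nn_integral_add) simp_all
  finally show ?thesis .
qed

text \<open>Minimality against the midpoint \<open>(\<mu> + \<nu>) / 2\<close> forces \<open>mutual \<mu> \<nu> = mutual \<mu> \<mu>\<close>, hence the Gaussian gap
  vanishes for almost every \<open>s\<close>.\<close>

theorem minimizer_unique:
  assumes inj: "inj_on \<Phi> K" and \<mu>: "\<mu> \<in> borel_probs K" and \<nu>: "\<nu> \<in> borel_probs K"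
    and min: "\<And>\<rho>. \<rho> \<in> borel_probs K \<Longrightarrow> mutual \<mu> \<mu> \<le> mutual \<rho> \<rho>"
    and same: "mutual \<nu> \<nu> = mutual \<mu> \<mu>" and fin: "mutual \<mu> \<mu> < \<infinity>"
  shows "\<mu> = \<nu>"
proof -
  let ?h = "\<lambda>\<alpha> \<beta>. \<integral>\<^sup>+s. ennreal (gauss_gap s \<alpha> \<beta> / s) * indicator {0<..} s \<partial>lborel"
  obtain V where V: "mutual \<mu> \<mu> = ennreal V" "V \<ge> 0"
    using fin by (cases "mutual \<mu> \<mu>") auto
  have gap: "4 * mutual \<mu> \<nu> + ?h \<mu> \<nu> = ennreal (4 * V)" "4 * mutual \<nu> \<mu> + ?h \<nu> \<mu> = ennreal (4 * V)"
    using mutual_gap[OF \<mu> \<nu>] mutual_gap[OF \<nu> \<mu>] V same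
    by (simp_all add: ennreal_mult flip: distrib_right)
  obtain a where a: "mutual \<mu> \<nu> = ennreal a" "a \<ge> 0"
    using gap(1) by (cases "mutual \<mu> \<nu>") (auto simp: ennreal_mult_top)
  obtain b where b: "mutual \<nu> \<mu> = ennreal b" "b \<ge> 0"
    using gap(2) by (cases "mutual \<nu> \<mu>") (auto simp: ennreal_mult_top)
  obtain h where h: "?h \<mu> \<nu> = ennreal h" "h \<ge> 0"
    using gap(1) by (cases "?h \<mu> \<nu>") auto
  obtain k where k: "?h \<nu> \<mu> = ennreal k" "k \<ge> 0"
    using gap(2) by (cases "?h \<nu> \<mu>") auto
  \<comment> \<open>Nonnegative gaps give a \<le> V and b \<le> V, while the midpoint gives 4 V
    \<le> 2 V + a + b. Hence a = b = V and the gap integral \<open>h\<close> is 0.\<close>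
  have "4 * a + h = 4 * V" "4 * b + k = 4 * V"
    using gap a b h k V by (simp_all flip: ennreal_numeral ennreal_mult ennreal_plus)
  moreover obtain m where m: "m \<in> borel_probs K"
    and "4 * mutual m m = mutual \<mu> \<mu> + mutual \<mu> \<nu> + mutual \<nu> \<mu> + mutual \<nu> \<nu>"
    using mutual_midpoint[OF \<mu> \<nu>] by blast
  then have "4 * mutual m m = ennreal (2 * V + a + b)"
    using V a b same by (simp flip: ennreal_plus)
  moreover have "4 * ennreal V \<le> 4 * mutual m m"
    using min[OF m] V by (intro mult_left_mono) auto
  ultimately have "ennreal (4 * V) \<le> ennreal (2 * V + a + b)"
    using ennreal_mult[of 4 V] V by simp
  then have "4 * V \<le> 2 * V + a + b"
    using V a b by (subst (asm) ennreal_le_iff) auto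
  with \<open>4 * a + h = 4 * V\<close> \<open>4 * b + k = 4 * V\<close> h(2) k(2) have "h = 0" by linarith
  note [measurable] = gauss_measurable[OF \<mu> \<mu>] gauss_measurable[OF \<mu> \<nu>] gauss_measurable[OF \<nu> \<nu>]
  have meas: "(\<lambda>s. ennreal (gauss_gap s \<mu> \<nu> / s) * indicator {0<..} s) \<in> borel_measurable lborel"
    unfolding gauss_gap_def by measurable
  have ae: "AE s in lborel. ennreal (gauss_gap s \<mu> \<nu> / s) * indicator {0<..} s = 0"
    using nn_integral_0_iff_AE[OF meas] h(1) \<open>h = 0\<close> by simp
  \<comment> \<open>Vanishing almost everywhere yields an actual s, because the interval (0, 1) is
    not a null set; a single s suffices for uniqueness.\<close>
  have "\<exists>s>0. gauss_gap s \<mu> \<nu> = 0"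
  proof (rule ccontr)
    assume "\<not> (\<exists>s>0. gauss_gap s \<mu> \<nu> = 0)"
    then have "ennreal (gauss_gap s \<mu> \<nu> / s) * indicator {0<..} s \<noteq> 0" if "s > 0" for s
      using that gauss_gap_nonneg[OF \<mu> \<nu> that] by (auto simp: ennreal_eq_0_iff divide_le_0_iff)
    then have "AE s in lborel. s \<notin> {0<..<1::real}"
      using ae by (auto elim!: eventually_mono)
    then have "emeasure lborel {0<..<1::real} = 0"
      by (subst (asm) AE_iff_null_sets[symmetric]) (auto simp: null_sets_def)
    then show False by simp
  qed
  then show ?thesis
    using gauss_gap_eq_0_imp_eq[OF \<mu> \<nu> _ inj] by blast
qed

end

section \<open>Lipschitz perturbations\<close>

text \<open>Each difference quotient is a lower bound of the admissible constants, so their infimum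
  is itself admissible.\<close>

lemma Lip_lipschitz:
  assumes "L-lipschitz_on E h"
  shows "(Lip E h)-lipschitz_on E h"
proof (rule lipschitz_onI)
  have ne: "{L. L-lipschitz_on E h} \<noteq> {}" using assms by auto
  show "0 \<le> Lip E h"
    unfolding Lip_def by (rule cInf_greatest[OF ne]) (auto dest: lipschitz_on_nonneg)
  fix x y assume xy: "x \<in> E" "y \<in> E"
  show "dist (h x) (h y) \<le> Lip E h * dist x y"
  proof (cases "x = y")
    case False
    have "dist (h x) (h y) / dist x y \<le> Lip E h"
      unfolding Lip_def using xy False
      by (intro cInf_greatest[OF ne]) (auto simp: divide_le_eq dest: lipschitz_onD)
    then show ?thesis using False by (simp add: divide_le_eq)
  qed simp
qed

lemma Lip_le: "L-lipschitz_on E h \<Longrightarrow> Lip E h \<le> L"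
  unfolding Lip_def by (rule cInf_lower) (auto simp: bdd_below_def dest: lipschitz_on_nonneg)

lemma W1infD:
  assumes "h \<in> W1inf E"
  shows "(Lip E h)-lipschitz_on E h" "0 \<le> Lip E h" "x \<notin> E \<Longrightarrow> h x = 0"
    "x \<in> E \<Longrightarrow> y \<in> E \<Longrightarrow> norm (h x - h y) \<le> Lip E h * norm (x - y)"
proof -
  obtain L where "L-lipschitz_on E h" using assms by (auto simp: W1inf_def)
  then show L: "(Lip E h)-lipschitz_on E h" by (rule Lip_lipschitz)
  show "0 \<le> Lip E h" using L by (rule lipschitz_on_nonneg)
  show "x \<in> E \<Longrightarrow> y \<in> E \<Longrightarrow> norm (h x - h y) \<le> Lip E h * norm (x - y)"
    using lipschitz_onD[OF L] by (simp add: dist_norm)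
qed (use assms in \<open>auto simp: W1inf_def\<close>)

lemma W1inf_add:
  assumes "h \<in> W1inf E" "q \<in> W1inf E"
  shows "(\<lambda>x. h x + q x) \<in> W1inf E" "Lip E (\<lambda>x. h x + q x) \<le> Lip E h + Lip E q"
proof -
  have "(Lip E h + Lip E q)-lipschitz_on E (\<lambda>x. h x + q x)"
    by (intro lipschitz_on_add W1infD(1) assms)
  then show "(\<lambda>x. h x + q x) \<in> W1inf E" "Lip E (\<lambda>x. h x + q x) \<le> Lip E h + Lip E q"
    using W1infD(3)[OF assms(1)] W1infD(3)[OF assms(2)] by (auto simp: W1inf_def intro: Lip_le)
qed

lemma W1inf_diff:
  assumes "h \<in> W1inf E" "q \<in> W1inf E"
  shows "(\<lambda>x. h x - q x) \<in> W1inf E"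
proof -
  have "(Lip E h + Lip E q)-lipschitz_on E (\<lambda>x. h x - q x)"
    by (intro lipschitz_on_diff W1infD(1) assms)
  then show ?thesis
    using W1infD(3)[OF assms(1)] W1infD(3)[OF assms(2)] by (auto simp: W1inf_def)
qed

lemma W1inf_scaleR:
  assumes "q \<in> W1inf E"
  shows "(\<lambda>x. c *\<^sub>R q x) \<in> W1inf E" "Lip E (\<lambda>x. c *\<^sub>R q x) \<le> \<bar>c\<bar> * Lip E q"
proof -
  have "(\<bar>c\<bar> * Lip E q)-lipschitz_on E (\<lambda>x. c *\<^sub>R q x)"
    using lipschitz_on_cmult[OF W1infD(1)[OF assms], of c] by simp
  then show "(\<lambda>x. c *\<^sub>R q x) \<in> W1inf E" "Lip E (\<lambda>x. c *\<^sub>R q x) \<le> \<bar>c\<bar> * Lip E q"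
    using W1infD(3)[OF assms] by (auto simp: W1inf_def intro: Lip_le)
qed

lemma zero_W1inf: "(\<lambda>x. 0) \<in> W1inf E" and Lip_zero: "Lip E (\<lambda>x. 0) = 0"
proof -
  have z: "0-lipschitz_on E (\<lambda>x. 0)" by (rule lipschitz_on_constant)
  then show w: "(\<lambda>x. 0) \<in> W1inf E" by (auto simp: W1inf_def)
  show "Lip E (\<lambda>x. 0) = 0" using Lip_le[OF z] W1infD(2)[OF w] by simp
qed

text \<open>On a nonempty compact set the \<open>SUP\<close> in the norm is a genuine, hence
  nonnegative, supremum. This converts estimates in \<open>Lip\<close> into estimates in the
  norm.\<close>

lemma Lip_le_W1inf_norm:
  assumes E: "compact E" "E \<noteq> {}" and q: "q \<in> W1inf E"
  shows "Lip E q \<le> W1inf_norm E q"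
proof -
  have "continuous_on E q"
    using W1infD(1)[OF q] by (rule lipschitz_on_continuous_on)
  then have "compact ((\<lambda>x. norm (q x)) ` E)"
    by (intro compact_continuous_image continuous_on_norm E)
  then have "bdd_above ((\<lambda>x. norm (q x)) ` E)"
    by (intro bounded_imp_bdd_above compact_imp_bounded)
  moreover obtain x where "x \<in> E" using E by blast
  ultimately have "norm (q x) \<le> (SUP x\<in>E. norm (q x))"
    by (intro cSUP_upper)
  then show ?thesis
    unfolding W1inf_norm_def using norm_ge_zero[of "q x"] by linarith
qed

section \<open>Transport of measures and energies\<close>

lemma log_energy_cong:
  assumes "\<mu> \<in> borel_probs K" "\<And>x. x \<in> K \<Longrightarrow> \<Phi> x = \<Psi> x"
  shows "log_energy \<Phi> \<mu> = log_energy \<Psi> \<mu>"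
proof -
  have "(\<integral>\<^sup>+z. e2ennreal (case z of (x, y) \<Rightarrow> log_kernel (\<Phi> x) (\<Phi> y)) \<partial>(\<mu> \<Otimes>\<^sub>M \<mu>))
      = (\<integral>\<^sup>+z. e2ennreal (case z of (x, y) \<Rightarrow> log_kernel (\<Psi> x) (\<Psi> y)) \<partial>(\<mu> \<Otimes>\<^sub>M \<mu>))"
    "(\<integral>\<^sup>+z. e2ennreal (- (case z of (x, y) \<Rightarrow> log_kernel (\<Phi> x) (\<Phi> y))) \<partial>(\<mu> \<Otimes>\<^sub>M \<mu>))
      = (\<integral>\<^sup>+z. e2ennreal (- (case z of (x, y) \<Rightarrow> log_kernel (\<Psi> x) (\<Psi> y))) \<partial>(\<mu> \<Otimes>\<^sub>M \<mu>))"
    using assms(2) borel_probsD(3)[OF assms(1)]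
    by (auto intro!: nn_integral_cong simp: space_pair_measure)
  then show ?thesis
    by (simp add: log_energy_def ereal_integral_def)
qed

lemma log_kernel_measurable:
  assumes [measurable]: "\<Phi> \<in> borel_measurable M"
  shows "(\<lambda>(x, y). log_kernel (\<Phi> x) (\<Phi> y)) \<in> borel_measurable (M \<Otimes>\<^sub>M M)"
proof -
  have "(\<lambda>(x, y). log_kernel (\<Phi> x) (\<Phi> y)) = (\<lambda>z. if dist (\<Phi> (fst z)) (\<Phi> (snd z)) = 0 then \<infinity>
      else ereal (ln (inverse (dist (\<Phi> (fst z)) (\<Phi> (snd z))))))"
    by (auto simp: log_kernel_def)
  also have "\<dots> \<in> borel_measurable (M \<Otimes>\<^sub>M M)" by measurable
  finally show ?thesis .
qed

lemma borel_probs_distr: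
  assumes \<mu>: "\<mu> \<in> borel_probs K"
    and T: "T \<in> restrict_space borel K \<rightarrow>\<^sub>M restrict_space borel K'"
    and \<Psi>: "\<Psi> \<in> borel_measurable (restrict_space borel K')"
  shows "distr \<mu> (restrict_space borel K') T \<in> borel_probs K'"
    and "log_energy \<Psi> (distr \<mu> (restrict_space borel K') T) = log_energy (\<lambda>x. \<Psi> (T x)) \<mu>"
proof -
  interpret prob_space \<mu> using borel_probsD(1)[OF \<mu>] .
  let ?R = "restrict_space borel K'" and ?f = "\<lambda>(x, y). log_kernel (\<Psi> x) (\<Psi> y)"
  have T' [measurable]: "T \<in> \<mu> \<rightarrow>\<^sub>M ?R"
    using T measurable_cong_sets[OF borel_probsD(2)[OF \<mu>] refl] by blast
  show "distr \<mu> ?R T \<in> borel_probs K'"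
    using T' by (auto simp: borel_probs_def intro: prob_space_distr)
  interpret D: prob_space "distr \<mu> ?R T" using T' by (rule prob_space_distr)
  have f [measurable]: "?f \<in> borel_measurable (?R \<Otimes>\<^sub>M ?R)"
    using \<Psi> by (rule log_kernel_measurable)
  have "distr \<mu> ?R T \<Otimes>\<^sub>M distr \<mu> ?R T = distr (\<mu> \<Otimes>\<^sub>M \<mu>) (?R \<Otimes>\<^sub>M ?R) (\<lambda>(x, y). (T x, T y))"
    by (rule pair_measure_distr[OF T' T']) unfold_locales
  then show "log_energy \<Psi> (distr \<mu> ?R T) = log_energy (\<lambda>x. \<Psi> (T x)) \<mu>"
    by (simp add: log_energy_def ereal_integral_def nn_integral_distr split_beta')
qed

text \<open>Push-forward by \<open>\<Phi>\<close> and by its inverse, which is continuous on the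
  compact image, matches the measures on \<open>K\<close> and on the image with equal
  energies.\<close>

lemma (in plane_embedding) min_energy_image:
  assumes inj: "inj_on \<Phi> K"
  shows "min_energy (\<Phi> ` K) = (INF \<mu>\<in>borel_probs K. log_energy \<Phi> \<mu>)"
proof (rule antisym)
  have T: "\<Phi> \<in> restrict_space borel K \<rightarrow>\<^sub>M restrict_space borel (\<Phi> ` K)"
    by (rule measurable_restrict_space2) (auto simp: space_restrict_space)
  have id: "(\<lambda>x. x) \<in> borel_measurable (restrict_space borel (\<Phi> ` K))"
    by (rule measurable_restrict_space1) simp
  show "min_energy (\<Phi> ` K) \<le> (INF \<mu>\<in>borel_probs K. log_energy \<Phi> \<mu>)"
    unfolding min_energy_def using borel_probs_distr[OF _ T id]
    by (intro INF_greatest) (metis INF_lower)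
  define \<Psi> where "\<Psi> = inv_into K \<Phi>"
  have \<Psi>: "\<Psi> (\<Phi> x) = x" if "x \<in> K" for x
    unfolding \<Psi>_def using inj that by simp
  then have "continuous_on (\<Phi> ` K) \<Psi>"
    by (intro continuous_on_inv[OF cont compact_K]) auto
  then have S: "\<Psi> \<in> restrict_space borel (\<Phi> ` K) \<rightarrow>\<^sub>M restrict_space borel K"
    using \<Psi> by (intro measurable_restrict_space2 borel_measurable_continuous_on_restrict)
      (auto simp: space_restrict_space)
  show "(INF \<mu>\<in>borel_probs K. log_energy \<Phi> \<mu>) \<le> min_energy (\<Phi> ` K)"
    unfolding min_energy_def
  proof (rule INF_greatest)
    fix \<nu> assume \<nu>: "\<nu> \<in> borel_probs (\<Phi> ` K)"
    have "log_energy (\<lambda>x. x) \<nu> = log_energy (\<lambda>x. \<Phi> (\<Psi> x)) \<nu>"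
      using \<Psi> by (intro log_energy_cong[OF \<nu>]) auto
    also have "\<dots> = log_energy \<Phi> (distr \<nu> R \<Psi>)"
      by (rule borel_probs_distr(2)[OF \<nu> S \<Phi>_measurable, symmetric])
    finally show "(INF \<mu>\<in>borel_probs K. log_energy \<Phi> \<mu>) \<le> log_energy (\<lambda>x. x) \<nu>"
      using INF_lower[OF borel_probs_distr(1)[OF \<nu> S \<Phi>_measurable], of "log_energy \<Phi>"] by simp
  qed
qed

text \<open>The squared ratio of norms is \<open>1 + u\<close> with \<open>u = 2 * p + r\<close>,
  where \<open>r\<close> is of second order, and the quadratic bound for \<open>ln (1 + u)\<close>
  is halved. For t \<le> 1/5 one has |u| \<le> 11/5 t < 1/2, so the error is at most half of 10 t^2
  + t^2, which is below 6 t^2.\<close>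

lemma ln_norm_expansion:
  fixes a b :: "'a::real_inner"
  assumes a: "a \<noteq> 0" and t: "norm b \<le> t * norm a" "t \<le> 1/5"
  shows "\<bar>ln (norm (a + b) / norm a) - (a \<bullet> b) / (norm a)\<^sup>2\<bar> \<le> 6 * t\<^sup>2"
proof -
  have na: "norm a > 0" using a by simp
  have t0: "t \<ge> 0" using t(1) na by (meson norm_ge_zero order_trans zero_le_mult_iff not_le)
  define p where "p = (a \<bullet> b) / (norm a)\<^sup>2"
  define r where "r = (norm b)\<^sup>2 / (norm a)\<^sup>2"
  have "\<bar>a \<bullet> b\<bar> \<le> norm a * norm b" by (rule Cauchy_Schwarz_ineq2)
  also have "\<dots> \<le> norm a * (t * norm a)" using t(1) by (intro mult_left_mono) auto
  finally have p: "\<bar>p\<bar> \<le> t" using na by (simp add: p_def divide_le_eq power2_eq_square mult_ac)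
  have "(norm b)\<^sup>2 \<le> (t * norm a)\<^sup>2" using t(1) by (intro power_mono) auto
  then have r: "0 \<le> r" "r \<le> t\<^sup>2" using na by (auto simp: r_def divide_le_eq power_mult_distrib)
  define u where "u = 2 * p + r"
  have "t\<^sup>2 \<le> 1/5 * t" unfolding power2_eq_square using t(2) t0 by (intro mult_right_mono) auto
  then have u: "\<bar>u\<bar> \<le> 11/5 * t" using p r unfolding u_def by linarith
  then have u_half: "\<bar>u\<bar> \<le> 1/2" using t(2) by simp
  have sq: "(norm (a + b) / norm a)\<^sup>2 = 1 + u"
    using na by (simp add: u_def p_def r_def power_divide power2_norm_eq_inner inner_add add_divide_distrib inner_commute)
  moreover have "norm (a + b) / norm a > 0"
  proof (rule divide_pos_pos[OF _ na])
    have "t * norm a \<le> 1/5 * norm a" using t(2) na by (intro mult_right_mono) auto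
    then show "norm (a + b) > 0"
      using norm_diff_ineq[of a b] t(1) na by linarith
  qed
  ultimately have ln_eq: "2 * ln (norm (a + b) / norm a) = ln (1 + u)"
    using ln_realpow[of "norm (a + b) / norm a" 2] by simp
  have "\<bar>ln (1 + u) - u\<bar> \<le> 2 * u\<^sup>2"
    using u_half by (rule abs_ln_one_plus_x_minus_x_bound)
  also have "u\<^sup>2 \<le> (11/5 * t)\<^sup>2"
    using power_mono[OF u, of 2] by simp
  also have "2 * (11/5 * t)\<^sup>2 \<le> 10 * t\<^sup>2"
    using zero_le_square[of t] by (simp add: power2_eq_square)
  finally have "\<bar>ln (1 + u) - u\<bar> \<le> 10 * t\<^sup>2" by simp
  then show ?thesis
    using ln_eq r unfolding u_def p_def[symmetric] by (auto simp: abs_le_iff)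
qed

section \<open>Consequences of finite energy\<close>

context plane_embedding begin

text \<open>A finite integral forces the kernel to be finite almost everywhere, so coinciding image
  points form a null set. This is the passage from \<open>ennreal\<close> to real integrals, where
  the value of \<open>ln (D / 0)\<close> does not matter.\<close>

lemma finite_mutual:
  assumes \<mu>: "\<mu> \<in> borel_probs K" and fin: "mutual \<mu> \<mu> < \<infinity>"
  shows "AE z in \<mu> \<Otimes>\<^sub>M \<mu>. sep z > 0"
    and "integrable (\<mu> \<Otimes>\<^sub>M \<mu>) (\<lambda>z. ln (D / sep z))"
    and "enn2real (mutual \<mu> \<mu>) = (\<integral>z. ln (D / sep z) \<partial>(\<mu> \<Otimes>\<^sub>M \<mu>))"
proof -
  have [measurable]: "sep \<in> borel_measurable (\<mu> \<Otimes>\<^sub>M \<mu>)"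
    by (rule pair_measurable[OF \<mu> \<mu> sep_measurable])
  have "AE z in \<mu> \<Otimes>\<^sub>M \<mu>. ell D (sep z) \<noteq> \<infinity>"
    using fin unfolding mutual_def by (intro nn_integral_PInf_AE) auto
  then show pos: "AE z in \<mu> \<Otimes>\<^sub>M \<mu>. sep z > 0"
    by eventually_elim (auto simp: ell_def split: if_splits)
  have eq: "mutual \<mu> \<mu> = (\<integral>\<^sup>+z. ennreal (ln (D / sep z)) \<partial>(\<mu> \<Otimes>\<^sub>M \<mu>))"
    unfolding mutual_def using pos by (intro nn_integral_cong_AE) (auto simp: ell_def elim!: eventually_mono)
  have "AE z in \<mu> \<Otimes>\<^sub>M \<mu>. z \<in> K \<times> K"
    using space_pair[OF \<mu> \<mu>] by (intro AE_I2) auto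
  with pos have nn: "AE z in \<mu> \<Otimes>\<^sub>M \<mu>. 0 \<le> ln (D / sep z)"
    by eventually_elim (auto simp: sep_bounds)
  then show "integrable (\<mu> \<Otimes>\<^sub>M \<mu>) (\<lambda>z. ln (D / sep z))"
    using fin eq by (intro integrableI_nonneg) auto
  show "enn2real (mutual \<mu> \<mu>) = (\<integral>z. ln (D / sep z) \<partial>(\<mu> \<Otimes>\<^sub>M \<mu>))"
    unfolding eq using nn by (intro integral_eq_nn_integral[symmetric]) auto
qed

text \<open>Markov's inequality: the shifted kernel is at least \<open>T\<close> where the distance
  is below \<open>D * exp (- T)\<close>.\<close>

lemma measure_sep_small:
  assumes \<mu>: "\<mu> \<in> borel_probs K" and M: "mutual \<mu> \<mu> \<le> ennreal M" "0 \<le> M" and T: "T > 0"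
  shows "measure (\<mu> \<Otimes>\<^sub>M \<mu>) {z \<in> space (\<mu> \<Otimes>\<^sub>M \<mu>). sep z < D * exp (- T)} \<le> M / T"
proof -
  interpret P: prob_space "\<mu> \<Otimes>\<^sub>M \<mu>" by (rule prob_space_pair[OF \<mu> \<mu>])
  have [measurable]: "sep \<in> borel_measurable (\<mu> \<Otimes>\<^sub>M \<mu>)"
    by (rule pair_measurable[OF \<mu> \<mu> sep_measurable])
  let ?A = "{z \<in> space (\<mu> \<Otimes>\<^sub>M \<mu>). sep z < D * exp (- T)}"
  have "ennreal T * emeasure (\<mu> \<Otimes>\<^sub>M \<mu>) ?A = (\<integral>\<^sup>+z. ennreal T * indicator ?A z \<partial>(\<mu> \<Otimes>\<^sub>M \<mu>))"
    by (rule nn_integral_cmult_indicator[symmetric]) measurable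
  also have "\<dots> \<le> mutual \<mu> \<mu>"
    unfolding mutual_def
  proof (rule nn_integral_mono)
    fix z assume z: "z \<in> space (\<mu> \<Otimes>\<^sub>M \<mu>)"
    show "ennreal T * indicator ?A z \<le> ell D (sep z)"
    proof (cases "z \<in> ?A \<and> sep z > 0")
      case True
      then have "exp T \<le> D / sep z"
        by (auto simp: exp_minus field_simps)
      then have "T \<le> ln (D / sep z)"
        using True D_pos by (simp add: ln_ge_iff)
      then show ?thesis using True by (simp add: ell_def ennreal_leI)
    qed (use z in \<open>auto simp: ell_def\<close>)
  qed
  also note M(1)
  finally have "ennreal (T * measure (\<mu> \<Otimes>\<^sub>M \<mu>) ?A) \<le> ennreal M"
    using T by (simp add: P.emeasure_eq_measure ennreal_mult)
  then show ?thesis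
    using T M(2) by (simp add: ennreal_le_iff field_simps)
qed

end

section \<open>The perturbed sets and their equilibrium measures\<close>

locale nonpolar_compact =
  fixes E :: "plane set"
  assumes compact_E: "compact E" and nonpolar_E: "nonpolar E"
begin

text \<open>A contraction changes distances by a factor of at most \<open>2\<close>, so one \<open>D\<close> serves all of them.\<close>

definition D :: real where "D = 2 * diameter E + 1"

abbreviation mut :: "(plane \<Rightarrow> plane) \<Rightarrow> plane measure \<Rightarrow> plane measure \<Rightarrow> ennreal" where
  "mut h \<equiv> plane_embedding.mutual (perturb h) D"

abbreviation psep :: "(plane \<Rightarrow> plane) \<Rightarrow> plane \<times> plane \<Rightarrow> real" where
  "psep h \<equiv> plane_embedding.sep (perturb h)"

lemma contractionsD:
  assumes "h \<in> contractions E" shows "h \<in> W1inf E" "0 \<le> Lip E h" "Lip E h < 1"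
  using assms W1infD(2) by (auto simp: contractions_def)

lemma perturb_diff: "perturb h x - perturb h y = (x - y) + (h x - h y)"
  by (simp add: perturb_def)

lemma perturb_bounds:
  assumes h: "h \<in> contractions E" and x: "x \<in> E" and y: "y \<in> E"
  shows "(1 - Lip E h) * norm (x - y) \<le> norm (perturb h x - perturb h y)"
    and "norm (perturb h x - perturb h y) \<le> 2 * norm (x - y)"
proof -
  have *: "norm (h x - h y) \<le> Lip E h * norm (x - y)"
    using W1infD(4)[OF contractionsD(1)[OF h] x y] .
  show "(1 - Lip E h) * norm (x - y) \<le> norm (perturb h x - perturb h y)"
    using * norm_diff_ineq[of "x - y" "h x - h y"] by (simp add: perturb_diff left_diff_distrib)
  have "Lip E h * norm (x - y) \<le> 1 * norm (x - y)"
    using contractionsD[OF h] by (intro mult_right_mono) auto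
  then show "norm (perturb h x - perturb h y) \<le> 2 * norm (x - y)"
    using * norm_triangle_ineq[of "x - y" "h x - h y"] by (simp add: perturb_diff)
qed

lemma D_ge_1: "1 \<le> D"
  using diameter_ge_0[OF compact_imp_bounded[OF compact_E]] by (simp add: D_def)

lemma perturb_embedding:
  assumes h: "h \<in> contractions E"
  shows "plane_embedding E (perturb h) D"
proof
  show "compact E" by (rule compact_E)
  show "continuous_on E (perturb h)"
    unfolding perturb_def
    using lipschitz_on_continuous_on[OF W1infD(1)[OF contractionsD(1)[OF h]]] by (intro continuous_intros)
  show "1 \<le> D" by (rule D_ge_1)
  fix x y assume xy: "x \<in> E" "y \<in> E"
  have "norm (x - y) \<le> diameter E"
    using diameter_bounded_bound[OF compact_imp_bounded[OF compact_E] xy] by (simp add: dist_norm)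
  then show "dist (perturb h x) (perturb h y) \<le> D"
    using perturb_bounds(2)[OF h xy] by (simp add: dist_norm D_def)
qed

lemma perturb_inj:
  assumes h: "h \<in> contractions E" shows "inj_on (perturb h) E"
proof (rule inj_onI)
  fix x y assume "x \<in> E" "y \<in> E" "perturb h x = perturb h y"
  then have "(1 - Lip E h) * norm (x - y) \<le> 0"
    using perturb_bounds(1)[OF h, of x y] by simp
  then show "x = y"
    using contractionsD[OF h] by (simp add: mult_le_0_iff)
qed

lemma psep_eq: "psep h z = norm (perturb h (fst z) - perturb h (snd z))"
proof -
  \<comment> \<open>\<open>sep\<close> depends on the map only, so the trivial instance with empty
    set makes the equation available for every \<open>h\<close>.\<close>
  interpret plane_embedding "{}" "perturb h" 1 by standard auto
  show ?thesis by (simp add: sep_def dist_norm)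
qed

lemma zero_contraction: "(\<lambda>x. 0) \<in> contractions E"
  by (simp add: contractions_def zero_W1inf Lip_zero)

text \<open>Passing from \<open>h\<close> to \<open>g\<close> stretches distances by at most the
  factor 1 + k, with k the Lipschitz constant of the difference over \<open>1 - Lip E h\<close>, and
  ln (1 + k) \<le> k. On the diagonal both kernels are infinite.\<close>

lemma mut_le:
  assumes g: "g \<in> contractions E" and h: "h \<in> contractions E"
    and \<mu>: "\<mu> \<in> borel_probs E" and \<nu>: "\<nu> \<in> borel_probs E"
  shows "mut h \<mu> \<nu> \<le> mut g \<mu> \<nu> + ennreal (Lip E (\<lambda>x. g x - h x) / (1 - Lip E h))"
proof -
  interpret H: plane_embedding E "perturb h" D by (rule perturb_embedding[OF h])
  interpret G: plane_embedding E "perturb g" D by (rule perturb_embedding[OF g])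
  interpret P: prob_space "\<mu> \<Otimes>\<^sub>M \<nu>" by (rule H.prob_space_pair[OF \<mu> \<nu>])
  let ?l = "Lip E (\<lambda>x. g x - h x)" and ?k = "Lip E (\<lambda>x. g x - h x) / (1 - Lip E h)"
  have gh: "(\<lambda>x. g x - h x) \<in> W1inf E"
    by (intro W1inf_diff contractionsD(1) g h)
  have pt: "ell D (psep h z) \<le> ell D (psep g z) + ennreal ?k" if z: "z \<in> E \<times> E" for z
  proof (cases "fst z = snd z")
    case True
    then show ?thesis by (simp add: psep_eq ell_def)
  next
    case False
    let ?d = "norm (fst z - snd z)" and ?a = "psep h z" and ?b = "psep g z"
    have d: "?d > 0" using False by simp
    have z': "fst z \<in> E" "snd z \<in> E" using z by auto
    have a: "(1 - Lip E h) * ?d \<le> ?a" and b: "(1 - Lip E g) * ?d \<le> ?b"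
      unfolding psep_eq by (intro perturb_bounds z' g h)+
    have pos: "?a > 0" "?b > 0"
      using less_le_trans[OF mult_pos_pos[OF _ d] a] less_le_trans[OF mult_pos_pos[OF _ d] b]
        contractionsD(3)[OF h] contractionsD(3)[OF g] by simp_all
    have k: "?k \<ge> 0" using W1infD(2)[OF gh] contractionsD[OF h] by simp
    have "?b \<le> ?a + norm ((g (fst z) - h (fst z)) - (g (snd z) - h (snd z)))"
      unfolding psep_eq perturb_diff
      using norm_triangle_ineq[of "fst z - snd z + (h (fst z) - h (snd z))" "(g (fst z) - h (fst z)) - (g (snd z) - h (snd z))"]
      by (simp add: algebra_simps)
    also have "\<dots> \<le> ?a + ?l * ?d"
      using W1infD(4)[OF gh z'] by simp
    also have "?l * ?d = ?k * ((1 - Lip E h) * ?d)"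
      using contractionsD[OF h] by simp
    also have "?a + \<dots> \<le> ?a + ?k * ?a"
      using a k by (intro add_left_mono mult_left_mono)
    finally have "?b / ?a \<le> 1 + ?k"
      using pos by (simp add: field_simps)
    then have "ln (?b / ?a) \<le> ?k"
      using pos ln_add_one_self_le_self[OF k] by (meson divide_pos_pos ln_mono order_trans)
    then have "ln (D / ?a) \<le> ln (D / ?b) + ?k"
      using pos H.D_pos by (simp add: ln_div)
    moreover have "0 \<le> ln (D / ?b)"
      using pos G.sep_bounds[OF z] by simp
    ultimately show ?thesis
      using pos k by (simp add: ell_def ennreal_leI flip: ennreal_plus)
  qed
  have [measurable]: "psep g \<in> borel_measurable (\<mu> \<Otimes>\<^sub>M \<nu>)"
    by (rule G.pair_measurable[OF \<mu> \<nu> G.sep_measurable])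
  have "mut h \<mu> \<nu> \<le> (\<integral>\<^sup>+z. ell D (psep g z) + ennreal ?k \<partial>(\<mu> \<Otimes>\<^sub>M \<nu>))"
    unfolding H.mutual_def using pt H.space_pair[OF \<mu> \<nu>] by (intro nn_integral_mono) auto
  also have "\<dots> = mut g \<mu> \<nu> + ennreal ?k"
    unfolding G.mutual_def by (subst nn_integral_add) (simp_all add: P.emeasure_space_1)
  finally show ?thesis .
qed

text \<open>Nonpolarity is the case \<open>h = 0\<close>, and \<open>mut_le\<close> transfers
  finiteness. It also provides a measure at all, since an infimum over no measures would be
  infinite.\<close>

lemma finite_energy_exists:
  assumes h: "h \<in> contractions E"
  obtains \<mu> where "\<mu> \<in> borel_probs E" "mut h \<mu> \<mu> < \<infinity>"
proof -
  interpret Z: plane_embedding E "perturb (\<lambda>x. 0)" D by (rule perturb_embedding[OF zero_contraction])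
  have "perturb (\<lambda>x. 0) = (\<lambda>x. x)" by (auto simp: perturb_def)
  moreover obtain \<mu> where \<mu>: "\<mu> \<in> borel_probs E" "log_energy (\<lambda>x. x) \<mu> < \<infinity>"
    using nonpolar_E unfolding nonpolar_def min_energy_def INF_less_iff by blast
  ultimately have "mut (\<lambda>x. 0) \<mu> \<mu> < \<infinity>"
    using Z.log_energy_eq[OF \<mu>(1)] by (cases "mut (\<lambda>x. 0) \<mu> \<mu>") auto
  then have "mut h \<mu> \<mu> < \<infinity>"
    using mut_le[OF zero_contraction h \<mu>(1) \<mu>(1)] by (auto simp: less_top[symmetric] top_unique)
  then show ?thesis using \<mu>(1) that by blast
qed

text \<open>The last fact asks only for an energy not above the minimum; in this form it identifies
  weak limits.\<close>

lemma equilibrium: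
  assumes h: "h \<in> contractions E"
  shows "equilibrium E h \<in> borel_probs E"
    and "\<And>\<nu>. \<nu> \<in> borel_probs E \<Longrightarrow> mut h (equilibrium E h) (equilibrium E h) \<le> mut h \<nu> \<nu>"
    and "mut h (equilibrium E h) (equilibrium E h) < \<infinity>"
    and "\<And>\<nu>. \<nu> \<in> borel_probs E \<Longrightarrow> mut h \<nu> \<nu> \<le> mut h (equilibrium E h) (equilibrium E h) \<Longrightarrow> \<nu> = equilibrium E h"
proof -
  interpret H: plane_embedding E "perturb h" D by (rule perturb_embedding[OF h])
  let ?P = "\<lambda>\<mu>. \<mu> \<in> borel_probs E \<and> (\<forall>\<nu>\<in>borel_probs E. mut h \<mu> \<mu> \<le> mut h \<nu> \<nu>)"
  obtain \<mu>0 where \<mu>0: "\<mu>0 \<in> borel_probs E" "mut h \<mu>0 \<mu>0 < \<infinity>"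
    using finite_energy_exists[OF h] by blast
  obtain \<mu> where \<mu>: "?P \<mu>"
    using H.minimizer_exists \<mu>0(1) by (metis empty_iff)
  have fin: "mut h \<mu> \<mu> < \<infinity>"
    using \<mu> \<mu>0 by (meson le_less_trans)
  have uniq: "\<nu> = \<mu>" if "\<nu> \<in> borel_probs E" "mut h \<nu> \<nu> \<le> mut h \<mu> \<mu>" for \<nu>
  proof -
    have "mut h \<nu> \<nu> = mut h \<mu> \<mu>" using that \<mu> by (auto intro: antisym)
    then show ?thesis
      using H.minimizer_unique[OF perturb_inj[OF h], of \<mu> \<nu>] \<mu> that(1) fin by auto
  qed
  have "equilibrium E h = (THE \<mu>. ?P \<mu>)"
    unfolding equilibrium_def using H.log_energy_le_iff by (intro arg_cong[where f = The] ext) auto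
  also have "\<dots> = \<mu>"
    using \<mu> uniq by (intro the_equality) auto
  finally have eq: "equilibrium E h = \<mu>" .
  show "equilibrium E h \<in> borel_probs E"
    "\<And>\<nu>. \<nu> \<in> borel_probs E \<Longrightarrow> mut h (equilibrium E h) (equilibrium E h) \<le> mut h \<nu> \<nu>"
    "mut h (equilibrium E h) (equilibrium E h) < \<infinity>"
    "\<And>\<nu>. \<nu> \<in> borel_probs E \<Longrightarrow> mut h \<nu> \<nu> \<le> mut h (equilibrium E h) (equilibrium E h) \<Longrightarrow> \<nu> = equilibrium E h"
    unfolding eq using \<mu> fin uniq by auto
qed

lemma min_energy_perturb:
  assumes h: "h \<in> contractions E"
  shows "min_energy (perturb h ` E) = ereal (enn2real (mut h (equilibrium E h) (equilibrium E h)) - ln D)"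
proof -
  interpret H: plane_embedding E "perturb h" D by (rule perturb_embedding[OF h])
  have "min_energy (perturb h ` E) = log_energy (perturb h) (equilibrium E h)"
    unfolding H.min_energy_image[OF perturb_inj[OF h]]
    using equilibrium(1,2)[OF h] H.log_energy_le_iff
    by (intro antisym INF_lower INF_greatest) auto
  then show ?thesis
    using equilibrium(3)[OF h] unfolding H.log_energy_eq[OF equilibrium(1)[OF h]]
    by (cases "mut h (equilibrium E h) (equilibrium E h)") (auto simp: enn2ereal_ennreal)
qed

end

section \<open>The derivative of the energy\<close>

text \<open>The distance formula for inversion in the unit sphere; it controls how
  \<open>strain\<close> depends on \<open>h\<close>.\<close>

lemma norm_inversion_diff:
  fixes a b :: "'a::real_inner"
  assumes "a \<noteq> 0" "b \<noteq> 0"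
  shows "norm (a /\<^sub>R (norm a)\<^sup>2 - b /\<^sub>R (norm b)\<^sup>2) = norm (a - b) / (norm a * norm b)"
proof -
  have a: "a \<bullet> a \<noteq> 0" and b: "b \<bullet> b \<noteq> 0" using assms by auto
  have "(norm (a /\<^sub>R (norm a)\<^sup>2 - b /\<^sub>R (norm b)\<^sup>2))\<^sup>2 = (norm (a - b) / (norm a * norm b))\<^sup>2"
    unfolding power_divide power_mult_distrib power2_norm_eq_inner
    using a b by (simp add: inner_diff inner_commute divide_simps algebra_simps)
  then show ?thesis
    by (rule power2_eq_imp_eq) auto
qed

lemma Lip_diff_commute:
  assumes "h \<in> W1inf E" "g \<in> W1inf E"
  shows "Lip E (\<lambda>x. h x - g x) = Lip E (\<lambda>x. g x - h x)"
proof -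
  have "Lip E (\<lambda>x. h x - g x) \<le> Lip E (\<lambda>x. g x - h x)" if "h \<in> W1inf E" "g \<in> W1inf E" for h g
    using W1inf_scaleR(2)[OF W1inf_diff[OF that(2,1)], of "-1"] by simp
  then show ?thesis using assms by (intro antisym) auto
qed

lemma Lip_le_add_diff:
  assumes "h \<in> W1inf E" "g \<in> W1inf E"
  shows "Lip E g \<le> Lip E h + Lip E (\<lambda>x. g x - h x)"
  using W1inf_add(2)[OF assms(1) W1inf_diff[OF assms(2,1)]] by simp

context nonpolar_compact begin

text \<open>The rate of change of the logarithm of the distance between image points when
  \<open>h\<close> moves in direction \<open>q\<close>. On the diagonal it is 0 / 0 = 0.\<close>

definition strain :: "(plane \<Rightarrow> plane) \<Rightarrow> (plane \<Rightarrow> plane) \<Rightarrow> plane \<times> plane \<Rightarrow> real" where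
  "strain h q z = ((perturb h (fst z) - perturb h (snd z)) \<bullet> (q (fst z) - q (snd z))) /
     (norm (perturb h (fst z) - perturb h (snd z)))\<^sup>2"

definition mean_strain :: "plane measure \<Rightarrow> (plane \<Rightarrow> plane) \<Rightarrow> (plane \<Rightarrow> plane) \<Rightarrow> real" where
  "mean_strain \<mu> h q = (\<integral>z. strain h q z \<partial>(\<mu> \<Otimes>\<^sub>M \<mu>))"

text \<open>Provides the ratio \<open>t\<close> for \<open>ln_norm_expansion\<close>, uniformly over
  all pairs of points.\<close>

lemma increment_le:
  assumes h: "h \<in> contractions E" and q: "q \<in> W1inf E" and z: "z \<in> E \<times> E"
  shows "norm (q (fst z) - q (snd z)) \<le> Lip E q / (1 - Lip E h) * psep h z"
proof -
  have z': "fst z \<in> E" "snd z \<in> E" using z by auto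
  have "norm (q (fst z) - q (snd z)) \<le> Lip E q * norm (fst z - snd z)"
    by (rule W1infD(4)[OF q z'])
  also have "\<dots> = Lip E q / (1 - Lip E h) * ((1 - Lip E h) * norm (fst z - snd z))"
    using contractionsD[OF h] by simp
  also have "\<dots> \<le> Lip E q / (1 - Lip E h) * psep h z"
    unfolding psep_eq
    using perturb_bounds(1)[OF h z'] W1infD(2)[OF q] contractionsD[OF h] by (intro mult_left_mono) auto
  finally show ?thesis .
qed

lemma strain_bound:
  assumes h: "h \<in> contractions E" and q: "q \<in> W1inf E" and z: "z \<in> E \<times> E"
  shows "\<bar>strain h q z\<bar> \<le> Lip E q / (1 - Lip E h)"
proof (cases "psep h z = 0")
  case True
  then show ?thesis
    using W1infD(2)[OF q] contractionsD[OF h] by (simp add: strain_def psep_eq)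
next
  case False
  then have a: "psep h z > 0" by (simp add: psep_eq)
  have "\<bar>(perturb h (fst z) - perturb h (snd z)) \<bullet> (q (fst z) - q (snd z))\<bar>
      \<le> psep h z * norm (q (fst z) - q (snd z))"
    unfolding psep_eq by (rule Cauchy_Schwarz_ineq2)
  also have "\<dots> \<le> psep h z * (Lip E q / (1 - Lip E h) * psep h z)"
    using increment_le[OF assms] a by (intro mult_left_mono) auto
  also have "\<dots> = Lip E q / (1 - Lip E h) * (psep h z)\<^sup>2"
    by (simp add: power2_eq_square)
  finally show ?thesis
    unfolding strain_def abs_divide psep_eq[symmetric] using a by (subst pos_divide_le_eq) auto
qed

text \<open>\<open>strain\<close> is the inner product of the inverted image difference with the
  increment of \<open>q\<close>. By \<open>norm_inversion_diff\<close> numerator and denominator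
  each carry two factors |x - y|, which cancel.\<close>

lemma strain_diff:
  assumes g: "g \<in> contractions E" and h: "h \<in> contractions E" and q: "q \<in> W1inf E" and z: "z \<in> E \<times> E"
  shows "\<bar>strain g q z - strain h q z\<bar> \<le> Lip E (\<lambda>x. g x - h x) * Lip E q / ((1 - Lip E g) * (1 - Lip E h))"
proof (cases "fst z = snd z")
  case True
  have "(\<lambda>x. g x - h x) \<in> W1inf E"
    by (intro W1inf_diff contractionsD(1) g h)
  then show ?thesis
    using True W1infD(2)[OF q] contractionsD[OF h] contractionsD[OF g] W1infD(2) by (simp add: strain_def)
next
  case False
  let ?a = "perturb g (fst z) - perturb g (snd z)" and ?b = "perturb h (fst z) - perturb h (snd z)"
  let ?d = "norm (fst z - snd z)" and ?q = "q (fst z) - q (snd z)"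
  let ?G = "1 - Lip E g" and ?H = "1 - Lip E h" and ?L = "Lip E (\<lambda>x. g x - h x)"
  have gh: "(\<lambda>x. g x - h x) \<in> W1inf E"
    by (intro W1inf_diff contractionsD(1) g h)
  have z': "fst z \<in> E" "snd z \<in> E" using z by auto
  have d: "?d > 0" using False by simp
  have GH: "?G > 0" "?H > 0" using contractionsD[OF h] contractionsD[OF g] by auto
  have a: "?G * ?d \<le> norm ?a" and b: "?H * ?d \<le> norm ?b"
    by (intro perturb_bounds z' g h)+
  have pos: "?G * ?d > 0" "?H * ?d > 0" using GH d by auto
  then have ne: "?a \<noteq> 0" "?b \<noteq> 0" using a b by auto
  have eq: "strain g q z - strain h q z = (?a /\<^sub>R (norm ?a)\<^sup>2 - ?b /\<^sub>R (norm ?b)\<^sup>2) \<bullet> ?q"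
    by (simp add: strain_def inner_diff_left divide_inverse mult.commute)
  have "\<bar>strain g q z - strain h q z\<bar> \<le> norm (?a /\<^sub>R (norm ?a)\<^sup>2 - ?b /\<^sub>R (norm ?b)\<^sup>2) * norm ?q"
    unfolding eq by (rule Cauchy_Schwarz_ineq2)
  also have "\<dots> = norm (?a - ?b) * norm ?q / (norm ?a * norm ?b)"
    unfolding norm_inversion_diff[OF ne] by simp
  also have "\<dots> \<le> (?L * ?d) * (Lip E q * ?d) / ((?G * ?d) * (?H * ?d))"
  proof (rule frac_le)
    show "norm (?a - ?b) * norm ?q \<le> (?L * ?d) * (Lip E q * ?d)"
      using W1infD(4)[OF gh z'] W1infD(4)[OF q z'] W1infD(2)[OF gh] d
      by (intro mult_mono) (auto simp: perturb_def algebra_simps)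
    show "(?G * ?d) * (?H * ?d) \<le> norm ?a * norm ?b"
      using a b pos by (intro mult_mono) auto
    show "0 \<le> (?L * ?d) * (Lip E q * ?d)"
      using W1infD(2)[OF gh] W1infD(2)[OF q] d by simp
    show "0 < (?G * ?d) * (?H * ?d)"
      using pos by (rule mult_pos_pos)
  qed
  also have "\<dots> = ?L * Lip E q / (?G * ?H)"
  proof -
    have "(l * d) * (k * d) / ((G * d) * (H * d)) = l * k / (G * H)" if "d \<noteq> 0" for l k d G H :: real
      using that by (cases "G = 0"; cases "H = 0") (auto simp: field_simps)
    from this[OF less_imp_neq[OF d, symmetric]] show ?thesis .
  qed
  finally show ?thesis .
qed

lemma W1inf_continuous: "q \<in> W1inf E \<Longrightarrow> continuous_on E q"
  using W1infD(1) by (rule lipschitz_on_continuous_on)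

lemma strain_measurable:
  assumes h: "h \<in> contractions E" and q: "q \<in> W1inf E"
  shows "strain h q \<in> borel_measurable (restrict_space borel E \<Otimes>\<^sub>M restrict_space borel E)"
proof -
  interpret H: plane_embedding E "perturb h" D by (rule perturb_embedding[OF h])
  have [measurable]: "q \<in> borel_measurable (restrict_space borel E)"
    using W1inf_continuous[OF q] by (rule borel_measurable_continuous_on_restrict)
  show ?thesis unfolding strain_def[abs_def] by measurable
qed

lemma strain_integrable:
  assumes h: "h \<in> contractions E" and q: "q \<in> W1inf E" and \<mu>: "\<mu> \<in> borel_probs E"
  shows "integrable (\<mu> \<Otimes>\<^sub>M \<mu>) (strain h q)"
proof -
  interpret H: plane_embedding E "perturb h" D by (rule perturb_embedding[OF h])
  interpret P: prob_space "\<mu> \<Otimes>\<^sub>M \<mu>" by (rule H.prob_space_pair[OF \<mu> \<mu>])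
  show ?thesis
    using strain_bound[OF h q] H.space_pair[OF \<mu> \<mu>] H.pair_measurable[OF \<mu> \<mu> strain_measurable[OF h q]]
    by (intro P.integrable_const_bound[of _ "Lip E q / (1 - Lip E h)"] AE_I2) auto
qed

lemma pair_integral_bound:
  assumes \<mu>: "\<mu> \<in> borel_probs E" and f: "integrable (\<mu> \<Otimes>\<^sub>M \<mu>) f"
    and bound: "AE z in \<mu> \<Otimes>\<^sub>M \<mu>. \<bar>f z\<bar> \<le> C"
  shows "\<bar>\<integral>z. f z \<partial>(\<mu> \<Otimes>\<^sub>M \<mu>)\<bar> \<le> (C::real)"
proof -
  \<comment> \<open>Any contraction would do; the instance only supplies that the product measure is
    a probability measure.\<close>
  interpret H: plane_embedding E "perturb (\<lambda>x. 0)" D by (rule perturb_embedding[OF zero_contraction])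
  interpret P: prob_space "\<mu> \<Otimes>\<^sub>M \<mu>" by (rule H.prob_space_pair[OF \<mu> \<mu>])
  have "\<bar>\<integral>z. f z \<partial>(\<mu> \<Otimes>\<^sub>M \<mu>)\<bar> \<le> (\<integral>z. \<bar>f z\<bar> \<partial>(\<mu> \<Otimes>\<^sub>M \<mu>))"
    by (rule integral_abs_bound)
  also have "\<dots> \<le> (\<integral>z. C \<partial>(\<mu> \<Otimes>\<^sub>M \<mu>))"
    using f bound by (intro integral_mono_AE) auto
  finally show ?thesis by (simp add: P.prob_space)
qed

lemma AE_pair: "\<mu> \<in> borel_probs E \<Longrightarrow> AE z in \<mu> \<Otimes>\<^sub>M \<mu>. z \<in> E \<times> E"
  by (intro AE_I2) (simp add: space_pair_measure borel_probsD)

lemma mean_strain_bound: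
  assumes h: "h \<in> contractions E" and q: "q \<in> W1inf E" and \<mu>: "\<mu> \<in> borel_probs E"
  shows "\<bar>mean_strain \<mu> h q\<bar> \<le> Lip E q / (1 - Lip E h)"
  unfolding mean_strain_def
  by (rule pair_integral_bound[OF \<mu> strain_integrable[OF assms]])
     (use AE_pair[OF \<mu>] strain_bound[OF h q] in \<open>auto elim: eventually_mono\<close>)

lemma mean_strain_diff:
  assumes g: "g \<in> contractions E" and h: "h \<in> contractions E" and q: "q \<in> W1inf E" and \<mu>: "\<mu> \<in> borel_probs E"
  shows "\<bar>mean_strain \<mu> g q - mean_strain \<mu> h q\<bar>
    \<le> Lip E (\<lambda>x. g x - h x) * Lip E q / ((1 - Lip E g) * (1 - Lip E h))"
proof -
  note int = strain_integrable[OF g q \<mu>] strain_integrable[OF h q \<mu>]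
  have "\<bar>\<integral>z. strain g q z - strain h q z \<partial>(\<mu> \<Otimes>\<^sub>M \<mu>)\<bar>
    \<le> Lip E (\<lambda>x. g x - h x) * Lip E q / ((1 - Lip E g) * (1 - Lip E h))"
    by (rule pair_integral_bound[OF \<mu> Bochner_Integration.integrable_diff[OF int]])
       (use AE_pair[OF \<mu>] strain_diff[OF g h q] in \<open>auto elim: eventually_mono\<close>)
  then show ?thesis
    using int by (simp add: mean_strain_def)
qed

lemma mean_strain_add:
  assumes h: "h \<in> contractions E" and "q \<in> W1inf E" "r \<in> W1inf E" and \<mu>: "\<mu> \<in> borel_probs E"
  shows "mean_strain \<mu> h (\<lambda>x. q x + r x) = mean_strain \<mu> h q + mean_strain \<mu> h r"
proof -
  have "strain h (\<lambda>x. q x + r x) z = strain h q z + strain h r z" for z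
    by (simp add: strain_def inner_diff_right inner_add_right add_divide_distrib diff_divide_distrib)
  then show ?thesis
    using strain_integrable[OF h assms(2) \<mu>] strain_integrable[OF h assms(3) \<mu>] by (simp add: mean_strain_def)
qed

lemma mean_strain_scaleR: "mean_strain \<mu> h (\<lambda>x. c *\<^sub>R q x) = c * mean_strain \<mu> h q"
proof -
  have "strain h (\<lambda>x. c *\<^sub>R q x) z = c * strain h q z" for z
    by (simp add: strain_def flip: scaleR_diff_right)
  then show ?thesis by (simp add: mean_strain_def)
qed

text \<open>\<open>ln_norm_expansion\<close> integrated; the plus sign before
  \<open>mean_strain\<close> reflects that the kernel is minus the logarithm. \<open>small\<close>
  is the condition t \<le> 1/5, and the error does not depend on \<open>\<mu>\<close>.\<close>

lemma mut_expansion: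
  assumes h: "h \<in> contractions E" and q: "q \<in> W1inf E" and g: "(\<lambda>x. h x + q x) \<in> contractions E"
    and small: "Lip E q \<le> (1 - Lip E h) / 5"
    and \<mu>: "\<mu> \<in> borel_probs E" and fin: "mut h \<mu> \<mu> < \<infinity>"
  shows "\<bar>enn2real (mut (\<lambda>x. h x + q x) \<mu> \<mu>) - enn2real (mut h \<mu> \<mu>) + mean_strain \<mu> h q\<bar>
    \<le> 6 * (Lip E q / (1 - Lip E h))\<^sup>2"
proof -
  let ?g = "\<lambda>x. h x + q x"
  interpret H: plane_embedding E "perturb h" D by (rule perturb_embedding[OF h])
  interpret G: plane_embedding E "perturb ?g" D by (rule perturb_embedding[OF g])
  have fin': "mut ?g \<mu> \<mu> < \<infinity>"
    using mut_le[OF h g \<mu> \<mu>] fin by (auto simp: less_top[symmetric] top_unique)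
  note Hf = H.finite_mutual[OF \<mu> fin] and Gf = G.finite_mutual[OF \<mu> fin']
  let ?f = "\<lambda>z. ln (D / psep ?g z) - ln (D / psep h z) + strain h q z"
  have "\<bar>\<integral>z. ?f z \<partial>(\<mu> \<Otimes>\<^sub>M \<mu>)\<bar> \<le> 6 * (Lip E q / (1 - Lip E h))\<^sup>2"
  proof (rule pair_integral_bound[OF \<mu>])
    show "integrable (\<mu> \<Otimes>\<^sub>M \<mu>) ?f"
      by (intro Bochner_Integration.integrable_add Bochner_Integration.integrable_diff Hf Gf strain_integrable h q \<mu>)
    show "AE z in \<mu> \<Otimes>\<^sub>M \<mu>. \<bar>?f z\<bar> \<le> 6 * (Lip E q / (1 - Lip E h))\<^sup>2"
      using Hf(1) Gf(1) AE_pair[OF \<mu>]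
    proof eventually_elim
      case (elim z)
      let ?a = "perturb h (fst z) - perturb h (snd z)" and ?b = "q (fst z) - q (snd z)"
      have a: "?a \<noteq> 0" using elim(1) by (auto simp: psep_eq)
      have ab: "perturb ?g (fst z) - perturb ?g (snd z) = ?a + ?b"
        by (simp add: perturb_def)
      have "\<bar>ln (norm (?a + ?b) / norm ?a) - (?a \<bullet> ?b) / (norm ?a)\<^sup>2\<bar> \<le> 6 * (Lip E q / (1 - Lip E h))\<^sup>2"
        using increment_le[OF h q elim(3)] small contractionsD[OF h]
        by (intro ln_norm_expansion[OF a]) (auto simp: psep_eq divide_le_eq)
      moreover have "?f z = - (ln (norm (?a + ?b) / norm ?a) - (?a \<bullet> ?b) / (norm ?a)\<^sup>2)"
        using elim H.D_pos by (simp add: psep_eq ab ln_div strain_def)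
      ultimately show ?case by simp
    qed
  qed
  then show ?thesis
    using Hf(2) Gf(2) strain_integrable[OF h q \<mu>] by (simp add: Hf(3) Gf(3) mean_strain_def)
qed

text \<open>Unlike \<open>strain h q\<close>, its cut-off is continuous across the diagonal.\<close>

definition cut_strain :: "real \<Rightarrow> (plane \<Rightarrow> plane) \<Rightarrow> (plane \<Rightarrow> plane) \<Rightarrow> plane \<times> plane \<Rightarrow> real" where
  "cut_strain \<epsilon> h q z = ((perturb h (fst z) - perturb h (snd z)) \<bullet> (q (fst z) - q (snd z))) / (max (psep h z) \<epsilon>)\<^sup>2"

lemma cut_strain_diff:
  assumes "\<epsilon> > 0"
  shows "\<bar>strain h q z - cut_strain \<epsilon> h q z\<bar> \<le> (if psep h z < \<epsilon> then \<bar>strain h q z\<bar> else 0)"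
    and "\<bar>cut_strain \<epsilon> h q z\<bar> \<le> \<bar>strain h q z\<bar>"
proof -
  \<comment> \<open>The cut-off multiplies \<open>strain\<close> by a factor in [0, 1] that equals 1
    as soon as \<open>psep h z \<ge> \<epsilon>\<close>.\<close>
  define k where "k = (psep h z / max (psep h z) \<epsilon>)\<^sup>2"
  have nn: "psep h z \<ge> 0" by (simp add: psep_eq)
  have k: "cut_strain \<epsilon> h q z = k * strain h q z"
  proof (cases "psep h z = 0")
    case True
    then show ?thesis by (simp add: cut_strain_def strain_def psep_eq)
  next
    case False
    then show ?thesis by (simp add: cut_strain_def strain_def k_def psep_eq power_divide)
  qed
  have k01: "0 \<le> k" "k \<le> 1"
    using assms nn by (auto simp: k_def intro!: power_le_one divide_le_eq_1_pos[THEN iffD2])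
  show "\<bar>cut_strain \<epsilon> h q z\<bar> \<le> \<bar>strain h q z\<bar>"
    using k01 by (simp add: k abs_mult mult_left_le_one_le)
  show "\<bar>strain h q z - cut_strain \<epsilon> h q z\<bar> \<le> (if psep h z < \<epsilon> then \<bar>strain h q z\<bar> else 0)"
  proof (cases "psep h z < \<epsilon>")
    case True
    have "strain h q z - cut_strain \<epsilon> h q z = (1 - k) * strain h q z"
      by (simp add: k left_diff_distrib)
    then show ?thesis
      using True k01 by (simp add: abs_mult mult_left_le_one_le)
  next
    case False
    then have "k = 1" using assms by (simp add: k_def max_def)
    then show ?thesis using False by (simp add: k)
  qed
qed

lemma cut_strain_measurable:
  assumes h: "h \<in> contractions E" and q: "q \<in> W1inf E"
  shows "cut_strain \<epsilon> h q \<in> borel_measurable (restrict_space borel E \<Otimes>\<^sub>M restrict_space borel E)"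
proof -
  interpret H: plane_embedding E "perturb h" D by (rule perturb_embedding[OF h])
  have [measurable]: "q \<in> borel_measurable (restrict_space borel E)"
    using W1inf_continuous[OF q] by (rule borel_measurable_continuous_on_restrict)
  show ?thesis unfolding cut_strain_def[abs_def] by measurable
qed

text \<open>The cut-off changes the integrand only where image points are closer than
  \<open>D * exp (- T)\<close>. There it is bounded by \<open>1 / (1 - Lip E h)\<close>, and
  \<open>measure_sep_small\<close> bounds the mass of the region.\<close>

lemma mean_cut_strain_diff:
  assumes h: "h \<in> contractions E" and q: "q \<in> W1inf E" "Lip E q \<le> 1"
    and \<mu>: "\<mu> \<in> borel_probs E" and M: "mut h \<mu> \<mu> \<le> ennreal M" "0 \<le> M" and T: "T > 0"
  shows "\<bar>mean_strain \<mu> h q - (\<integral>z. cut_strain (D * exp (- T)) h q z \<partial>(\<mu> \<Otimes>\<^sub>M \<mu>))\<bar> \<le> 1 / (1 - Lip E h) * (M / T)"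
proof -
  interpret H: plane_embedding E "perturb h" D by (rule perturb_embedding[OF h])
  interpret P: prob_space "\<mu> \<Otimes>\<^sub>M \<mu>" by (rule H.prob_space_pair[OF \<mu> \<mu>])
  let ?\<epsilon> = "D * exp (- T)" and ?C = "1 / (1 - Lip E h)"
  let ?A = "{z \<in> space (\<mu> \<Otimes>\<^sub>M \<mu>). psep h z < ?\<epsilon>}"
  have \<epsilon>: "?\<epsilon> > 0" using H.D_pos by simp
  have [measurable]: "psep h \<in> borel_measurable (\<mu> \<Otimes>\<^sub>M \<mu>)"
    by (rule H.pair_measurable[OF \<mu> \<mu> H.sep_measurable])
  have bound: "\<bar>strain h q z\<bar> \<le> ?C" if "z \<in> E \<times> E" for z
    using strain_bound[OF h q(1) that] q(2) contractionsD[OF h]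
    by (elim order_trans) (simp add: divide_right_mono)
  have int: "integrable (\<mu> \<Otimes>\<^sub>M \<mu>) (strain h q)"
    by (rule strain_integrable[OF h q(1) \<mu>])
  have int': "integrable (\<mu> \<Otimes>\<^sub>M \<mu>) (cut_strain ?\<epsilon> h q)"
    using bound order_trans[OF cut_strain_diff(2)[OF \<epsilon>]] H.space_pair[OF \<mu> \<mu>]
      H.pair_measurable[OF \<mu> \<mu> cut_strain_measurable[OF h q(1)]]
    by (intro P.integrable_const_bound[of _ ?C] AE_I2) auto
  have "\<bar>\<integral>z. strain h q z - cut_strain ?\<epsilon> h q z \<partial>(\<mu> \<Otimes>\<^sub>M \<mu>)\<bar>
    \<le> (\<integral>z. \<bar>strain h q z - cut_strain ?\<epsilon> h q z\<bar> \<partial>(\<mu> \<Otimes>\<^sub>M \<mu>))"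
    by (rule integral_abs_bound)
  also have "\<dots> \<le> (\<integral>z. ?C * indicator ?A z \<partial>(\<mu> \<Otimes>\<^sub>M \<mu>))"
  proof (rule integral_mono)
    show "integrable (\<mu> \<Otimes>\<^sub>M \<mu>) (\<lambda>z. \<bar>strain h q z - cut_strain ?\<epsilon> h q z\<bar>)"
      using int int' by auto
    show "integrable (\<mu> \<Otimes>\<^sub>M \<mu>) (\<lambda>z. ?C * indicator ?A z)"
      by (intro integrable_mult_right integrable_real_indicator) (auto simp: P.emeasure_eq_measure)
    show "\<bar>strain h q z - cut_strain ?\<epsilon> h q z\<bar> \<le> ?C * indicator ?A z" if "z \<in> space (\<mu> \<Otimes>\<^sub>M \<mu>)" for z
      using cut_strain_diff(1)[OF \<epsilon>, of h q z] bound[of z] that H.space_pair[OF \<mu> \<mu>]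
      by (auto split: if_splits)
  qed
  also have "\<dots> = ?C * measure (\<mu> \<Otimes>\<^sub>M \<mu>) ?A"
    by simp
  also have "\<dots> \<le> ?C * (M / T)"
    using H.measure_sep_small[OF \<mu> M T] contractionsD[OF h] by (intro mult_left_mono) auto
  finally show ?thesis
    using int int' by (simp add: mean_strain_def)
qed

end

section \<open>Stability of equilibrium measures and continuity of the derivative\<close>

context nonpolar_compact begin

text \<open>One modulus for all \<open>q\<close>: the integrand pairs the increment of
  \<open>q\<close>, which is 1-Lipschitz in each point, with a vector field \<open>c\<close> that
  depends on \<open>h\<close> and \<open>\<epsilon>\<close> only and is uniformly
  continuous.\<close>

lemma cut_strain_modulus:
  assumes h: "h \<in> contractions E" and \<epsilon>: "\<epsilon> > 0" and e: "e > 0"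
  obtains d where "d > 0"
    "\<And>q x y x' y'. q \<in> W1inf E \<Longrightarrow> Lip E q \<le> 1 \<Longrightarrow> x \<in> E \<Longrightarrow> y \<in> E \<Longrightarrow> x' \<in> E \<Longrightarrow> y' \<in> E
      \<Longrightarrow> dist x x' < d \<Longrightarrow> dist y y' < d \<Longrightarrow> \<bar>cut_strain \<epsilon> h q (x, y) - cut_strain \<epsilon> h q (x', y')\<bar> \<le> e"
proof -
  interpret H: plane_embedding E "perturb h" D by (rule perturb_embedding[OF h])
  define c where "c z = (perturb h (fst z) - perturb h (snd z)) /\<^sub>R (max (psep h z) \<epsilon>)\<^sup>2" for z
  define \<delta> where "\<delta> = diameter E + 1"
  have \<delta>: "\<delta> > 0" using diameter_ge_0[OF compact_imp_bounded[OF compact_E]] by (simp add: \<delta>_def)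
  have c_norm: "norm (c z) \<le> 1 / \<epsilon>" for z
  proof -
    have "norm (c z) = psep h z / (max (psep h z) \<epsilon>)\<^sup>2"
      by (simp add: c_def psep_eq divide_inverse mult.commute)
    also have "\<dots> \<le> max (psep h z) \<epsilon> / (max (psep h z) \<epsilon>)\<^sup>2"
      by (intro divide_right_mono) auto
    also have "\<dots> = 1 / max (psep h z) \<epsilon>"
      using \<epsilon> by (simp add: power2_eq_square)
    also have "\<dots> \<le> 1 / \<epsilon>"
      using \<epsilon> by (intro divide_left_mono) auto
    finally show ?thesis .
  qed
  have cut: "cut_strain \<epsilon> h q z = c z \<bullet> (q (fst z) - q (snd z))" for q z
    by (simp add: cut_strain_def c_def divide_inverse mult.commute)
  have "continuous_on (E \<times> E) c"
    unfolding c_def using \<epsilon>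
    by (intro continuous_intros H.sep_continuous continuous_on_compose2[OF H.cont])
       (auto simp: max_def)
  then have "uniformly_continuous_on (E \<times> E) c"
    by (rule compact_uniformly_continuous) (intro compact_Times compact_E)
  moreover have "e / (2 * \<delta>) > 0" using e \<delta> by simp
  ultimately obtain d1 where d1: "d1 > 0"
    "\<And>z z'. z \<in> E \<times> E \<Longrightarrow> z' \<in> E \<times> E \<Longrightarrow> dist z' z < d1 \<Longrightarrow> dist (c z') (c z) < e / (2 * \<delta>)"
    unfolding uniformly_continuous_on_def by (elim allE[of _ "e / (2 * \<delta>)"]) auto
  \<comment> \<open>Half of \<open>e\<close> goes to each factor: \<open>d1 / 2\<close> keeps pairs
    within \<open>d1\<close>, and \<open>e * \<epsilon> / 4\<close> makes the increments of
    \<open>q\<close> differ by at most \<open>e * \<epsilon> / 2\<close>, to be multiplied by |c|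
    \<le> 1 / \<epsilon>.\<close>
  define d where "d = min (d1 / 2) (e * \<epsilon> / 4)"
  have d: "d > 0" using d1(1) e \<epsilon> by (simp add: d_def)
  show ?thesis
  proof (rule that[OF d])
    fix q x y x' y'
    assume q: "q \<in> W1inf E" "Lip E q \<le> 1" and E: "x \<in> E" "y \<in> E" "x' \<in> E" "y' \<in> E"
      and close: "dist x x' < d" "dist y y' < d"
    have q_le: "norm (q u - q v) \<le> norm (u - v)" if "u \<in> E" "v \<in> E" for u v
      using W1infD(4)[OF q(1) that] q(2) mult_right_mono[OF q(2), of "norm (u - v)"] by simp
    have "dist (x, y) (x', y') \<le> dist x x' + dist y y'"
      by (simp add: dist_Pair_Pair sqrt_sum_squares_le_sum)
    also have "\<dots> < d1" using close by (simp add: d_def)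
    finally have c_close: "norm (c (x, y) - c (x', y')) \<le> e / (2 * \<delta>)"
      using d1(2)[of "(x', y')" "(x, y)"] E by (simp add: dist_norm)
    let ?b = "q x - q y" and ?b' = "q x' - q y'"
    have "norm (?b - ?b') \<le> norm (q x - q x') + norm (q y - q y')"
      using norm_triangle_ineq4[of "q x - q x'" "q y - q y'"] by (simp add: algebra_simps)
    also have "\<dots> \<le> dist x x' + dist y y'"
      using q_le E by (intro add_mono) (auto simp: dist_norm)
    also have "\<dots> \<le> e * \<epsilon> / 2" using close by (simp add: d_def)
    finally have b_close: "norm (?b - ?b') \<le> e * \<epsilon> / 2" .
    have b': "norm ?b' \<le> \<delta>"
      using q_le[OF E(3,4)] diameter_bounded_bound[OF compact_imp_bounded[OF compact_E] E(3,4)]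
      by (simp add: \<delta>_def dist_norm)
    have "cut_strain \<epsilon> h q (x, y) - cut_strain \<epsilon> h q (x', y')
      = c (x, y) \<bullet> (?b - ?b') + (c (x, y) - c (x', y')) \<bullet> ?b'"
      by (simp add: cut inner_diff)
    moreover have "\<bar>c (x, y) \<bullet> (?b - ?b')\<bar> \<le> 1 / \<epsilon> * (e * \<epsilon> / 2)" (is "_ \<le> ?r")
      using c_norm b_close \<epsilon> by (intro order_trans[OF Cauchy_Schwarz_ineq2] mult_mono) auto
    moreover have "\<bar>(c (x, y) - c (x', y')) \<bullet> ?b'\<bar> \<le> e / (2 * \<delta>) * \<delta>" (is "_ \<le> ?s")
      using c_close b' e \<delta> by (intro order_trans[OF Cauchy_Schwarz_ineq2] mult_mono) auto
    moreover have "?r = e / 2" "?s = e / 2" using \<epsilon> \<delta> by simp_all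
    ultimately show "\<bar>cut_strain \<epsilon> h q (x, y) - cut_strain \<epsilon> h q (x', y')\<bar> \<le> e"
      by linarith
  qed
qed

text \<open>The energy bound \<open>M\<close> makes the cut-off error small for all
  \<open>\<mu> n\<close> and for \<open>\<nu>\<close> at once; the cut-off integrands share a bound
  and a modulus, so uniform weak convergence applies to them.\<close>

lemma mean_strain_uniform:
  assumes h: "h \<in> contractions E"
    and \<mu>: "\<And>n. \<mu> n \<in> borel_probs E" and \<nu>: "\<nu> \<in> borel_probs E" and conv: "weakly_to E \<mu> \<nu>"
    and M: "\<And>n. mut h (\<mu> n) (\<mu> n) \<le> ennreal M" "mut h \<nu> \<nu> \<le> ennreal M" "0 \<le> M" and e: "e > 0"
  shows "\<forall>\<^sub>F n in sequentially. \<forall>q\<in>W1inf E. Lip E q \<le> 1 \<longrightarrow> \<bar>mean_strain (\<mu> n) h q - mean_strain \<nu> h q\<bar> \<le> e"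
proof -
  interpret H: plane_embedding E "perturb h" D by (rule perturb_embedding[OF h])
  define C where "C = 1 / (1 - Lip E h)"
  have C: "C > 0" using contractionsD[OF h] by (simp add: C_def)
  \<comment> \<open>Chosen so that \<open>C * M / T \<le> e / 4\<close>; \<open>M + 1\<close>
    instead of \<open>M\<close> keeps \<open>T\<close> positive when \<open>M = 0\<close>.\<close>
  define T where "T = 4 * C * (M + 1) / e"
  have T: "T > 0" using C M(3) e by (simp add: T_def)
  have "C * (M / T) = e / 4 * (M / (M + 1))"
    using C M(3) e by (simp add: T_def)
  also have "\<dots> \<le> e / 4 * 1"
    using M(3) e by (intro mult_left_mono) auto
  finally have CMT: "1 / (1 - Lip E h) * (M / T) \<le> e / 4" by (simp add: C_def)
  define \<epsilon> where "\<epsilon> = D * exp (- T)"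
  have \<epsilon>: "\<epsilon> > 0" using H.D_pos by (simp add: \<epsilon>_def)
  \<comment> \<open>Weak convergence then contributes 3 * (e / 6) = e / 2, and the two cut-off
    errors e / 4 each.\<close>
  have e6: "e / 6 > 0" using e by simp
  obtain d where d: "d > 0"
    "\<And>q x y x' y'. q \<in> W1inf E \<Longrightarrow> Lip E q \<le> 1 \<Longrightarrow> x \<in> E \<Longrightarrow> y \<in> E \<Longrightarrow> x' \<in> E \<Longrightarrow> y' \<in> E
      \<Longrightarrow> dist x x' < d \<Longrightarrow> dist y y' < d \<Longrightarrow> \<bar>cut_strain \<epsilon> h q (x, y) - cut_strain \<epsilon> h q (x', y')\<bar> \<le> e / 6"
    by (rule cut_strain_modulus[OF h \<epsilon> e6]) (rule that, assumption, blast)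
  show ?thesis
    using weak_convergence_pair_uniform[OF compact_E \<mu> \<nu> conv e6 d(1), where B = C]
  proof (eventually_elim, intro ballI impI)
    fix n q
    assume W: "\<forall>f. f \<in> borel_measurable (restrict_space borel E \<Otimes>\<^sub>M restrict_space borel E) \<longrightarrow>
        (\<forall>x\<in>E. \<forall>y\<in>E. \<bar>f (x, y)\<bar> \<le> C) \<longrightarrow>
        (\<forall>x\<in>E. \<forall>y\<in>E. \<forall>x'\<in>E. \<forall>y'\<in>E. dist x x' < d \<longrightarrow> dist y y' < d \<longrightarrow> \<bar>f (x, y) - f (x', y')\<bar> \<le> e / 6) \<longrightarrow>
        \<bar>(\<integral>z. f z \<partial>(\<mu> n \<Otimes>\<^sub>M \<mu> n)) - (\<integral>z. f z \<partial>(\<nu> \<Otimes>\<^sub>M \<nu>))\<bar> \<le> 3 * (e / 6)"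
      and q: "q \<in> W1inf E" "Lip E q \<le> 1"
    have "\<bar>cut_strain \<epsilon> h q (x, y)\<bar> \<le> C" if "x \<in> E" "y \<in> E" for x y
    proof -
      have "\<bar>strain h q (x, y)\<bar> \<le> Lip E q / (1 - Lip E h)"
        using that by (intro strain_bound h q) auto
      also have "\<dots> \<le> C"
        using q(2) contractionsD[OF h] by (simp add: C_def divide_right_mono)
      finally show ?thesis using cut_strain_diff(2)[OF \<epsilon>, of h q "(x, y)"] by simp
    qed
    then have "\<bar>(\<integral>z. cut_strain \<epsilon> h q z \<partial>(\<mu> n \<Otimes>\<^sub>M \<mu> n)) - (\<integral>z. cut_strain \<epsilon> h q z \<partial>(\<nu> \<Otimes>\<^sub>M \<nu>))\<bar> \<le> 3 * (e / 6)"
      using d(2)[OF q] cut_strain_measurable[OF h q(1)] by (intro W[rule_format]) auto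
    moreover note mean_cut_strain_diff[OF h q \<mu>[of n] M(1)[of n] M(3) T, folded \<epsilon>_def]
      mean_cut_strain_diff[OF h q \<nu> M(2,3) T, folded \<epsilon>_def]
    ultimately show "\<bar>mean_strain (\<mu> n) h q - mean_strain \<nu> h q\<bar> \<le> e"
      using CMT by linarith
  qed
qed

text \<open>Go from \<open>h\<close> to \<open>g\<close>, use minimality at \<open>g\<close>, and
  return to \<open>h\<close>. The way out costs l / H; the way back costs at most 2 l / H, because
  \<open>1 - Lip E g\<close> is at least half of \<open>1 - Lip E h\<close>.\<close>

lemma equilibrium_energy_bound:
  assumes h: "h \<in> contractions E" and g: "g \<in> contractions E"
    and small: "Lip E (\<lambda>x. g x - h x) \<le> (1 - Lip E h) / 2"
  shows "mut h (equilibrium E g) (equilibrium E g)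
    \<le> mut h (equilibrium E h) (equilibrium E h) + ennreal (3 * Lip E (\<lambda>x. g x - h x) / (1 - Lip E h))"
proof -
  let ?l = "Lip E (\<lambda>x. g x - h x)" and ?H = "1 - Lip E h" and ?G = "1 - Lip E g"
  note W = contractionsD(1)[OF h] contractionsD(1)[OF g]
  have l: "?l \<ge> 0" by (intro W1infD(2) W1inf_diff W)
  have H: "?H > 0" using contractionsD[OF h] by simp
  have G: "?H / 2 \<le> ?G" using Lip_le_add_diff[OF W] small by (simp add: field_simps)
  have "mut h (equilibrium E g) (equilibrium E g) \<le> mut g (equilibrium E g) (equilibrium E g) + ennreal (?l / ?H)"
    by (intro mut_le g h equilibrium(1))
  also have "\<dots> \<le> mut g (equilibrium E h) (equilibrium E h) + ennreal (?l / ?H)"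
    by (intro add_right_mono equilibrium(2) g equilibrium(1) h)
  also have "\<dots> \<le> (mut h (equilibrium E h) (equilibrium E h) + ennreal (Lip E (\<lambda>x. h x - g x) / ?G)) + ennreal (?l / ?H)"
    by (intro add_right_mono mut_le g h equilibrium(1))
  also have "Lip E (\<lambda>x. h x - g x) = ?l"
    by (rule Lip_diff_commute[OF W])
  also have "mut h (equilibrium E h) (equilibrium E h) + ennreal (?l / ?G) + ennreal (?l / ?H)
      = mut h (equilibrium E h) (equilibrium E h) + ennreal (?l / ?G + ?l / ?H)"
    using l H G by (simp add: add.assoc ennreal_plus[symmetric] del: ennreal_plus)
  also have "ennreal (?l / ?G + ?l / ?H) \<le> ennreal (3 * ?l / ?H)"
  proof (rule ennreal_leI)
    have "?l / ?G \<le> ?l / (?H / 2)"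
      using l H G by (intro divide_left_mono mult_pos_pos) auto
    then show "?l / ?G + ?l / ?H \<le> 3 * ?l / ?H" by simp
  qed
  finally show ?thesis by (simp add: add_left_mono)
qed

text \<open>A subsequence is enough, because the lemma serves an argument by contradiction.\<close>

lemma equilibrium_weakly_continuous:
  assumes h: "h \<in> contractions E" and g: "\<And>n. g n \<in> contractions E"
    and small: "\<And>n. Lip E (\<lambda>x. g n x - h x) \<le> (1 - Lip E h) / 2"
    and lim: "(\<lambda>n. Lip E (\<lambda>x. g n x - h x)) \<longlonglongrightarrow> 0"
  obtains r where "strict_mono r" "weakly_to E (\<lambda>n. equilibrium E (g (r n))) (equilibrium E h)"
proof -
  interpret H: plane_embedding E "perturb h" D by (rule perturb_embedding[OF h])
  have \<mu>: "equilibrium E (g n) \<in> borel_probs E" for n by (rule equilibrium(1)[OF g])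
  obtain r \<nu> where r: "strict_mono r" and \<nu>: "\<nu> \<in> borel_probs E"
    and conv: "weakly_to E ((\<lambda>n. equilibrium E (g n)) \<circ> r) \<nu>"
    by (rule borel_probs_weakly_compact[OF compact_E \<mu>])
  let ?c = "\<lambda>n. mut h (equilibrium E h) (equilibrium E h) + ennreal (3 * Lip E (\<lambda>x. g (r n) x - h x) / (1 - Lip E h))"
  have "(\<lambda>n. Lip E (\<lambda>x. g (r n) x - h x)) \<longlonglongrightarrow> 0"
    using LIMSEQ_subseq_LIMSEQ[OF lim r] by (simp add: comp_def)
  then have "(\<lambda>n. ennreal (3 * Lip E (\<lambda>x. g (r n) x - h x) / (1 - Lip E h))) \<longlonglongrightarrow> ennreal (3 * 0 / (1 - Lip E h))"
    using contractionsD[OF h] by (intro tendsto_ennrealI tendsto_intros) auto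
  then have "?c \<longlonglongrightarrow> mut h (equilibrium E h) (equilibrium E h) + ennreal (3 * 0 / (1 - Lip E h))"
    by (intro tendsto_add tendsto_const)
  then have "?c \<longlonglongrightarrow> mut h (equilibrium E h) (equilibrium E h)" by simp
  then have "mut h \<nu> \<nu> \<le> mut h (equilibrium E h) (equilibrium E h)"
    using \<mu> equilibrium_energy_bound[OF h g small]
    by (intro H.mutual_lower_semicontinuous[OF _ \<nu> conv, of ?c]) auto
  then have "\<nu> = equilibrium E h"
    by (rule equilibrium(4)[OF h \<nu>])
  then show ?thesis using r conv that by (simp add: comp_def)
qed

definition energy_deriv :: "(plane \<Rightarrow> plane) \<Rightarrow> (plane \<Rightarrow> plane) \<Rightarrow> real" where
  "energy_deriv h q = - mean_strain (equilibrium E h) h q"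

text \<open>The estimate is uniform in \<open>q\<close> and serves twice: as continuity in the dual
  norm, and as the bound for the remainder in the Frechet derivative.\<close>

lemma energy_deriv_continuous:
  assumes h: "h \<in> contractions E" and e: "e > 0"
  obtains \<delta> where "\<delta> > 0"
    "\<And>g q. g \<in> contractions E \<Longrightarrow> Lip E (\<lambda>x. g x - h x) < \<delta> \<Longrightarrow> q \<in> W1inf E
      \<Longrightarrow> \<bar>energy_deriv g q - energy_deriv h q\<bar> \<le> e * Lip E q"
proof (rule ccontr)
  assume neg: "\<not> thesis"
  define H where "H = 1 - Lip E h"
  have H: "H > 0" using contractionsD[OF h] by (simp add: H_def)
  \<comment> \<open>\<open>1 / Suc n\<close> forces convergence to \<open>h\<close>;
    \<open>H / 2\<close> keeps the Lipschitz constants of the \<open>g n\<close> away from 1 and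
    meets the hypothesis of \<open>equilibrium_energy_bound\<close>.\<close>
  define \<delta> where "\<delta> n = min (H / 2) (1 / real (Suc n))" for n
  have \<delta>: "\<delta> n > 0" "\<delta> n \<le> H / 2" for n using H by (auto simp: \<delta>_def)
  define bad where "bad n p \<longleftrightarrow> fst p \<in> contractions E \<and> Lip E (\<lambda>x. fst p x - h x) < \<delta> n \<and> snd p \<in> W1inf E
      \<and> \<bar>energy_deriv (fst p) (snd p) - energy_deriv h (snd p)\<bar> > e * Lip E (snd p)" for n p
  have "\<exists>p. bad n p" for n
  proof (rule ccontr)
    assume *: "\<not> (\<exists>p. bad n p)"
    have thesis
    proof (rule that[OF \<delta>(1)[of n]])
      fix g q assume "g \<in> contractions E" "Lip E (\<lambda>x. g x - h x) < \<delta> n" "q \<in> W1inf E"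
      then show "\<bar>energy_deriv g q - energy_deriv h q\<bar> \<le> e * Lip E q"
        using * by (auto simp: bad_def not_less)
    qed
    then show False using neg by simp
  qed
  then have "bad n (SOME p. bad n p)" for n by (rule someI_ex)
  moreover define g where "g n = fst (SOME p. bad n p)" for n
  moreover define q where "q n = snd (SOME p. bad n p)" for n
  ultimately have g: "g n \<in> contractions E" and gl: "Lip E (\<lambda>x. g n x - h x) < \<delta> n"
    and q: "q n \<in> W1inf E" and big: "\<bar>energy_deriv (g n) (q n) - energy_deriv h (q n)\<bar> > e * Lip E (q n)" for n
    by (simp_all add: bad_def)
  note Wg = contractionsD(1)[OF g] and Wh = contractionsD(1)[OF h]
  have l_nonneg: "0 \<le> Lip E (\<lambda>x. g n x - h x)" for n
    by (intro W1infD(2) W1inf_diff Wg Wh)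
  have small: "Lip E (\<lambda>x. g n x - h x) \<le> (1 - Lip E h) / 2" for n
    using gl[of n] \<delta>(2)[of n] by (simp add: H_def)
  have lim: "(\<lambda>n. Lip E (\<lambda>x. g n x - h x)) \<longlonglongrightarrow> 0"
  proof (rule tendsto_sandwich[of "\<lambda>_. 0" _ _ "\<lambda>n. 1 / real (Suc n)"])
    show "(\<lambda>n. 1 / real (Suc n)) \<longlonglongrightarrow> 0" by (rule LIMSEQ_Suc[OF lim_1_over_n])
    show "\<forall>\<^sub>F n in sequentially. Lip E (\<lambda>x. g n x - h x) \<le> 1 / real (Suc n)"
      using gl by (intro always_eventually allI) (auto simp: \<delta>_def intro: less_imp_le)
  qed (use l_nonneg in auto)
  obtain r where r: "strict_mono r" and conv: "weakly_to E (\<lambda>n. equilibrium E (g (r n))) (equilibrium E h)"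
    by (rule equilibrium_weakly_continuous[OF h g small lim])
  define p where "p n = (\<lambda>x. (1 / Lip E (q n)) *\<^sub>R q n x)" for n
  \<comment> \<open>Needed for normalizing: a direction with \<open>Lip E (q n) = 0\<close> has both
    derivatives 0 and cannot violate the estimate.\<close>
  have Lq: "Lip E (q n) > 0" for n
  proof (rule ccontr)
    assume "\<not> Lip E (q n) > 0"
    then have "Lip E (q n) = 0" using W1infD(2)[OF q[of n]] by simp
    then show False
      using big[of n] mean_strain_bound[OF g q equilibrium(1)[OF g], of n n n] mean_strain_bound[OF h q equilibrium(1)[OF h], of n]
      by (simp add: energy_deriv_def)
  qed
  have p: "p n \<in> W1inf E" "Lip E (p n) \<le> 1" for n
    using W1inf_scaleR[OF q[of n], of "1 / Lip E (q n)"] Lq[of n] by (auto simp: p_def)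
  have p_big: "\<bar>energy_deriv (g n) (p n) - energy_deriv h (p n)\<bar> > e" for n
  proof -
    have "energy_deriv (g n) (p n) - energy_deriv h (p n)
      = (energy_deriv (g n) (q n) - energy_deriv h (q n)) / Lip E (q n)"
      unfolding energy_deriv_def p_def mean_strain_scaleR by (simp add: diff_divide_distrib)
    then show ?thesis
      using big[of n] Lq[of n] by (simp add: abs_divide pos_less_divide_eq)
  qed
  \<comment> \<open>The excess energy is at most 3 l / H, and l \<le> H / 2, so adding 3 is
    ample.\<close>
  define M where "M = enn2real (mut h (equilibrium E h) (equilibrium E h)) + 3"
  have M0: "M \<ge> 0" by (simp add: M_def)
  have M_eq: "mut h (equilibrium E h) (equilibrium E h) + ennreal 3 = ennreal M"
    using equilibrium(3)[OF h] by (cases "mut h (equilibrium E h) (equilibrium E h)") (auto simp: M_def)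
  have M: "mut h (equilibrium E (g n)) (equilibrium E (g n)) \<le> ennreal M" for n
  proof -
    have "3 * Lip E (\<lambda>x. g n x - h x) / (1 - Lip E h) \<le> 3"
      using small[of n] H by (simp add: H_def pos_divide_le_eq)
    then show ?thesis
      unfolding M_eq[symmetric]
      by (intro order_trans[OF equilibrium_energy_bound[OF h g small]] add_left_mono ennreal_leI)
  qed
  have Mh: "mut h (equilibrium E h) (equilibrium E h) \<le> ennreal M"
    unfolding M_eq[symmetric] by simp
  have e2: "e / 2 > 0" using e by simp
  have ev1: "\<forall>\<^sub>F n in sequentially. \<forall>q\<in>W1inf E. Lip E q \<le> 1 \<longrightarrow>
      \<bar>mean_strain (equilibrium E (g (r n))) h q - mean_strain (equilibrium E h) h q\<bar> \<le> e / 2"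
    by (rule mean_strain_uniform[OF h equilibrium(1)[OF g] equilibrium(1)[OF h] conv M Mh M0 e2])
  have "(\<lambda>n. Lip E (\<lambda>x. g (r n) x - h x)) \<longlonglongrightarrow> 0"
    using LIMSEQ_subseq_LIMSEQ[OF lim r] by (simp add: comp_def)
  \<comment> \<open>The threshold turns the bound l / (H / 2 * H) for the change of
    \<open>strain\<close> into less than e / 2.\<close>
  then have ev2: "\<forall>\<^sub>F n in sequentially. Lip E (\<lambda>x. g (r n) x - h x) < e * H\<^sup>2 / 4"
    using e H by (intro order_tendstoD) auto
  have "\<forall>\<^sub>F n in sequentially. False"
    using ev1 ev2
  proof eventually_elim
    case (elim n)
    \<comment> \<open>First the map changes with the measure fixed, then the measure with the map
      \<open>h\<close> fixed; each change costs at most e / 2.\<close>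
    let ?g = "g (r n)" and ?p = "p (r n)" and ?\<mu> = "equilibrium E (g (r n))"
    let ?l = "Lip E (\<lambda>x. ?g x - h x)"
    have G: "H / 2 \<le> 1 - Lip E ?g"
      using Lip_le_add_diff[OF Wh Wg, of "r n"] small[of "r n"] by (simp add: H_def field_simps)
    have GH: "H / 2 * H \<le> (1 - Lip E ?g) * (1 - Lip E h)"
      unfolding H_def[symmetric] using G H by (intro mult_right_mono) auto
    have "\<bar>mean_strain ?\<mu> ?g ?p - mean_strain ?\<mu> h ?p\<bar> \<le> ?l * Lip E ?p / ((1 - Lip E ?g) * (1 - Lip E h))"
      by (rule mean_strain_diff[OF g h p(1) equilibrium(1)[OF g]])
    also have "\<dots> \<le> ?l * 1 / (H / 2 * H)"
      using GH H p l_nonneg W1infD(2)[OF p(1)] by (intro frac_le mult_left_mono mult_nonneg_nonneg) auto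
    also have "\<dots> < e / 2"
      using elim(2) H by (simp add: field_simps power2_eq_square)
    finally have "\<bar>mean_strain ?\<mu> ?g ?p - mean_strain ?\<mu> h ?p\<bar> < e / 2" .
    moreover have "\<bar>mean_strain ?\<mu> h ?p - mean_strain (equilibrium E h) h ?p\<bar> \<le> e / 2"
      using elim(1) p by blast
    ultimately show False
      using p_big[of "r n"] unfolding energy_deriv_def by linarith
  qed
  then show False by simp
qed

section \<open>Frechet differentiability of the energy\<close>

lemma energy_of_eq:
  assumes "h \<in> contractions E"
  shows "energy_of E h = enn2real (mut h (equilibrium E h) (equilibrium E h)) - ln D"
  unfolding energy_of_def min_energy_perturb[OF assms] by simp

text \<open>Testing the minimality of each of the two equilibrium measures against the other one
  bounds the increment from both sides.\<close>

lemma energy_increment: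
  assumes h: "h \<in> contractions E" and q: "q \<in> W1inf E" and g: "(\<lambda>x. h x + q x) \<in> contractions E"
    and small: "Lip E q \<le> (1 - Lip E h) / 10"
  shows "\<bar>energy_of E (\<lambda>x. h x + q x) - energy_of E h - energy_deriv h q\<bar>
    \<le> \<bar>energy_deriv (\<lambda>x. h x + q x) q - energy_deriv h q\<bar> + 24 * (Lip E q / (1 - Lip E h))\<^sup>2"
proof -
  let ?g = "\<lambda>x. h x + q x" and ?L = "Lip E q" and ?H = "1 - Lip E h"
  let ?\<mu> = "equilibrium E h" and ?\<nu> = "equilibrium E ?g"
  have H: "?H > 0" using contractionsD[OF h] by simp
  have L: "?L \<ge> 0" by (rule W1infD(2)[OF q])
  have G: "?H / 2 \<le> 1 - Lip E ?g"
    using W1inf_add(2)[OF contractionsD(1)[OF h] q] small H by (simp add: field_simps)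
  have mq: "(\<lambda>x. - q x) \<in> W1inf E" "Lip E (\<lambda>x. - q x) \<le> ?L"
    using W1inf_scaleR[OF q, of "-1"] by simp_all
  have neg: "mean_strain ?\<nu> ?g (\<lambda>x. - q x) = - mean_strain ?\<nu> ?g q"
    using mean_strain_scaleR[of ?\<nu> ?g "-1" q] by simp
  have undo: "(\<lambda>x. ?g x + - q x) = h" by simp
  have fin: "mut ?g ?\<nu> ?\<nu> < \<infinity>" "mut h ?\<mu> ?\<mu> < \<infinity>"
    by (intro equilibrium(3) h g)+
  have fin': "mut h ?\<nu> ?\<nu> < \<infinity>" "mut ?g ?\<mu> ?\<mu> < \<infinity>"
    using mut_le[OF g h equilibrium(1)[OF g] equilibrium(1)[OF g]] mut_le[OF h g equilibrium(1)[OF h] equilibrium(1)[OF h]] fin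
    by (auto simp: less_top[symmetric] top_unique)
  have up: "\<bar>enn2real (mut ?g ?\<mu> ?\<mu>) - enn2real (mut h ?\<mu> ?\<mu>) + mean_strain ?\<mu> h q\<bar> \<le> 6 * (?L / ?H)\<^sup>2"
    using small H by (intro mut_expansion h q g equilibrium) auto
  \<comment> \<open>The expansion based at \<open>h + q\<close> in direction \<open>- q\<close>
    leads back to \<open>h\<close>. There only \<open>H / 2\<close> is guaranteed for the
    contraction gap: hence the hypothesis H / 10, which is (H / 2) / 5, and the constant 24 = 6 *
    4.\<close>
  have "\<bar>enn2real (mut (\<lambda>x. ?g x + - q x) ?\<nu> ?\<nu>) - enn2real (mut ?g ?\<nu> ?\<nu>) + mean_strain ?\<nu> ?g (\<lambda>x. - q x)\<bar>
    \<le> 6 * (Lip E (\<lambda>x. - q x) / (1 - Lip E ?g))\<^sup>2"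
  proof (rule mut_expansion[OF g mq(1)])
    show "(\<lambda>x. ?g x + - q x) \<in> contractions E" unfolding undo by (rule h)
    show "Lip E (\<lambda>x. - q x) \<le> (1 - Lip E ?g) / 5" using mq(2) small G by simp
  qed (intro equilibrium g)+
  also have "\<dots> \<le> 6 * (?L / (?H / 2))\<^sup>2"
    using mq(2) G H L W1infD(2)[OF mq(1)] by (intro mult_left_mono power_mono frac_le divide_nonneg_nonneg) auto
  also have "\<dots> = 24 * (?L / ?H)\<^sup>2"
    by (simp add: power2_eq_square)
  finally have down: "\<bar>enn2real (mut h ?\<nu> ?\<nu>) - enn2real (mut ?g ?\<nu> ?\<nu>) - mean_strain ?\<nu> ?g q\<bar> \<le> 24 * (?L / ?H)\<^sup>2"
    unfolding undo neg by simp
  have "enn2real (mut ?g ?\<nu> ?\<nu>) \<le> enn2real (mut ?g ?\<mu> ?\<mu>)"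
    using fin' by (intro enn2real_mono equilibrium(2)[OF g] equilibrium(1)[OF h]) auto
  moreover have "enn2real (mut h ?\<mu> ?\<mu>) \<le> enn2real (mut h ?\<nu> ?\<nu>)"
    using fin' by (intro enn2real_mono equilibrium(2)[OF h] equilibrium(1)[OF g]) auto
  moreover have "6 * (?L / ?H)\<^sup>2 \<le> 24 * (?L / ?H)\<^sup>2" by simp
  ultimately show ?thesis
    unfolding energy_of_eq[OF h] energy_of_eq[OF g] energy_deriv_def using up down by linarith
qed

lemma E_nonempty: "E \<noteq> {}"
proof -
  obtain \<mu> where "\<mu> \<in> borel_probs E" using finite_energy_exists[OF zero_contraction] by blast
  then show ?thesis
    using prob_space.not_empty[OF borel_probsD(1)] borel_probsD(3) by blast
qed

lemmas Lip_le_norm = Lip_le_W1inf_norm[OF compact_E E_nonempty]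

lemma norm_open_contractions: "norm_open (W1inf E) (W1inf_norm E) (contractions E)"
  unfolding norm_open_def
proof (intro conjI ballI)
  show "contractions E \<subseteq> W1inf E" using contractionsD(1) by blast
  fix h assume h: "h \<in> contractions E"
  show "\<exists>\<delta>>0. \<forall>g\<in>W1inf E. W1inf_norm E (\<lambda>x. g x - h x) < \<delta> \<longrightarrow> g \<in> contractions E"
  proof (intro exI[of _ "1 - Lip E h"] conjI ballI impI)
    show "0 < 1 - Lip E h" using contractionsD[OF h] by simp
    fix g assume g: "g \<in> W1inf E" and "W1inf_norm E (\<lambda>x. g x - h x) < 1 - Lip E h"
    then have "Lip E g < 1"
      using Lip_le_add_diff[OF contractionsD(1)[OF h] g] Lip_le_norm[OF W1inf_diff[OF g contractionsD(1)[OF h]]]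
      by simp
    then show "g \<in> contractions E" using g by (simp add: contractions_def)
  qed
qed

lemma frechet_energy_deriv:
  assumes h: "h \<in> contractions E"
  shows "has_frechet_derivative_on (W1inf E) (W1inf_norm E) (contractions E) (energy_of E) (energy_deriv h) h"
  unfolding has_frechet_derivative_on_def
proof (intro conjI allI impI)
  define H where "H = 1 - Lip E h"
  have H: "H > 0" using contractionsD[OF h] by (simp add: H_def)
  show "bounded_functional (W1inf E) (W1inf_norm E) (energy_deriv h)"
    unfolding bounded_functional_def
  proof (intro conjI ballI allI)
    show "energy_deriv h (\<lambda>x. q x + r x) = energy_deriv h q + energy_deriv h r"
      if "q \<in> W1inf E" "r \<in> W1inf E" for q r
      using mean_strain_add[OF h that equilibrium(1)[OF h]] by (simp add: energy_deriv_def)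
    show "energy_deriv h (\<lambda>x. c *\<^sub>R q x) = c * energy_deriv h q" for c q
      by (simp add: energy_deriv_def mean_strain_scaleR)
    show "\<exists>B. \<forall>q\<in>W1inf E. \<bar>energy_deriv h q\<bar> \<le> B * W1inf_norm E q"
    proof (intro exI ballI)
      fix q assume q: "q \<in> W1inf E"
      have "\<bar>energy_deriv h q\<bar> \<le> Lip E q / H"
        using mean_strain_bound[OF h q equilibrium(1)[OF h]] by (simp add: energy_deriv_def H_def)
      also have "\<dots> \<le> 1 / H * W1inf_norm E q"
        using Lip_le_norm[OF q] H by (simp add: divide_right_mono)
      finally show "\<bar>energy_deriv h q\<bar> \<le> 1 / H * W1inf_norm E q" .
    qed
  qed
  fix \<epsilon> :: real assume \<epsilon>: "\<epsilon> > 0"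
  obtain \<delta> where \<delta>: "\<delta> > 0"
    "\<And>g q. g \<in> contractions E \<Longrightarrow> Lip E (\<lambda>x. g x - h x) < \<delta> \<Longrightarrow> q \<in> W1inf E
      \<Longrightarrow> \<bar>energy_deriv g q - energy_deriv h q\<bar> \<le> \<epsilon> / 2 * Lip E q"
    by (rule energy_deriv_continuous[OF h half_gt_zero[OF \<epsilon>]]) (rule that, assumption, blast)
  \<comment> \<open>\<open>H / 10\<close> admits \<open>energy_increment\<close>;
    \<open>\<epsilon> * H\<^sup>2 / 48\<close> makes the quadratic remainder at most half of
    \<open>\<epsilon> * Lip E q\<close>.\<close>
  show "\<exists>\<delta>>0. \<forall>q\<in>W1inf E. (\<lambda>x. h x + q x) \<in> contractions E \<and> W1inf_norm E q < \<delta> \<longrightarrow>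
      \<bar>energy_of E (\<lambda>x. h x + q x) - energy_of E h - energy_deriv h q\<bar> \<le> \<epsilon> * W1inf_norm E q"
  proof (intro exI[of _ "min \<delta> (min (H / 10) (\<epsilon> * H\<^sup>2 / 48))"] conjI ballI impI)
    show "0 < min \<delta> (min (H / 10) (\<epsilon> * H\<^sup>2 / 48))" using \<delta> H \<epsilon> by simp
    fix q assume q: "q \<in> W1inf E"
      and *: "(\<lambda>x. h x + q x) \<in> contractions E \<and> W1inf_norm E q < min \<delta> (min (H / 10) (\<epsilon> * H\<^sup>2 / 48))"
    have L: "0 \<le> Lip E q" "Lip E q \<le> W1inf_norm E q"
      using W1infD(2)[OF q] Lip_le_norm[OF q] by auto
    have "Lip E q < \<delta>" "Lip E q \<le> H / 10" and L48: "Lip E q \<le> \<epsilon> * H\<^sup>2 / 48"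
      using * L by auto
    then have "\<bar>energy_deriv (\<lambda>x. h x + q x) q - energy_deriv h q\<bar> \<le> \<epsilon> / 2 * Lip E q"
      using * q by (intro \<delta>(2)) auto
    then have "\<bar>energy_of E (\<lambda>x. h x + q x) - energy_of E h - energy_deriv h q\<bar>
      \<le> \<epsilon> / 2 * Lip E q + 24 * (Lip E q / H)\<^sup>2"
      using energy_increment[OF h q conjunct1[OF *]] \<open>Lip E q \<le> H / 10\<close> unfolding H_def by simp
    also have "24 * (Lip E q / H)\<^sup>2 = 24 / H\<^sup>2 * (Lip E q * Lip E q)"
      by (simp add: power2_eq_square)
    also have "\<dots> \<le> 24 / H\<^sup>2 * (\<epsilon> * H\<^sup>2 / 48 * Lip E q)"
      using L48 L H by (intro mult_left_mono mult_right_mono) auto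
    also have "\<dots> = \<epsilon> / 2 * Lip E q" using H by simp
    also have "\<epsilon> / 2 * Lip E q + \<epsilon> / 2 * Lip E q = \<epsilon> * Lip E q" by simp
    also have "\<dots> \<le> \<epsilon> * W1inf_norm E q" using L \<epsilon> by simp
    finally show "\<bar>energy_of E (\<lambda>x. h x + q x) - energy_of E h - energy_deriv h q\<bar> \<le> \<epsilon> * W1inf_norm E q"
      by simp
  qed
qed

lemma C1_energy: "C1_on (W1inf E) (W1inf_norm E) (contractions E) (energy_of E) energy_deriv"
  unfolding C1_on_def
proof (intro conjI ballI allI impI norm_open_contractions frechet_energy_deriv)
  fix h and \<epsilon> :: real assume h: "h \<in> contractions E" and \<epsilon>: "\<epsilon> > 0"
  obtain \<delta> where \<delta>: "\<delta> > 0"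
    "\<And>g q. g \<in> contractions E \<Longrightarrow> Lip E (\<lambda>x. g x - h x) < \<delta> \<Longrightarrow> q \<in> W1inf E
      \<Longrightarrow> \<bar>energy_deriv g q - energy_deriv h q\<bar> \<le> \<epsilon> / 2 * Lip E q"
    by (rule energy_deriv_continuous[OF h half_gt_zero[OF \<epsilon>]]) (rule that, assumption, blast)
  show "\<exists>\<delta>>0. \<forall>g\<in>contractions E. W1inf_norm E (\<lambda>x. g x - h x) < \<delta> \<longrightarrow>
      dual_norm (W1inf E) (W1inf_norm E) (\<lambda>q. energy_deriv g q - energy_deriv h q) < \<epsilon>"
  proof (intro exI[of _ \<delta>] conjI ballI impI \<delta>(1))
    fix g assume g: "g \<in> contractions E" and "W1inf_norm E (\<lambda>x. g x - h x) < \<delta>"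
    then have close: "Lip E (\<lambda>x. g x - h x) < \<delta>"
      using Lip_le_norm[OF W1inf_diff[OF contractionsD(1)[OF g] contractionsD(1)[OF h]]] by simp
    \<comment> \<open>A supremum inherits only a weak inequality, so half of
      \<open>\<epsilon>\<close> leaves room for the strict one.\<close>
    have "dual_norm (W1inf E) (W1inf_norm E) (\<lambda>q. energy_deriv g q - energy_deriv h q) \<le> \<epsilon> / 2"
      unfolding dual_norm_def
    proof (rule cSUP_least)
      have "W1inf_norm E (\<lambda>x. 0) = 0"
        using E_nonempty by (simp add: W1inf_norm_def Lip_zero)
      then show "{q \<in> W1inf E. W1inf_norm E q \<le> 1} \<noteq> {}"
        using zero_W1inf by force
      fix q assume "q \<in> {q \<in> W1inf E. W1inf_norm E q \<le> 1}"
      then have q: "q \<in> W1inf E" "Lip E q \<le> 1"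
        using Lip_le_norm order_trans by auto
      have "\<bar>energy_deriv g q - energy_deriv h q\<bar> \<le> \<epsilon> / 2 * Lip E q"
        by (rule \<delta>(2)[OF g close q(1)])
      also have "\<dots> \<le> \<epsilon> / 2 * 1"
        using q(2) \<epsilon> by (intro mult_left_mono) auto
      finally show "\<bar>energy_deriv g q - energy_deriv h q\<bar> \<le> \<epsilon> / 2" by simp
    qed
    then show "dual_norm (W1inf E) (W1inf_norm E) (\<lambda>q. energy_deriv g q - energy_deriv h q) < \<epsilon>"
      using \<epsilon> by simp
  qed
qed

end

text \<open>The first conjunct guards the encoding: \<open>energy_of\<close> goes through
  \<open>real_of_ereal\<close>, which sends infinite values to 0, so finiteness is what makes it the
  actual minimal energy.\<close>

theorem proposition5p2:
  fixes E :: "plane set"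
  assumes "compact E" and "nonpolar E"
  shows "(\<forall>h\<in>contractions E. \<bar>min_energy (perturb h ` E)\<bar> \<noteq> \<infinity>) \<and>
    (\<exists>DI. C1_on (W1inf E) (W1inf_norm E) (contractions E) (energy_of E) DI \<and>
      (\<forall>h\<in>contractions E. \<forall>q\<in>W1inf E.
        DI h q = - (\<integral>(x, y). ((perturb h x - perturb h y) \<bullet> (q x - q y)) /
                       (norm (perturb h x - perturb h y))\<^sup>2
                     \<partial>(equilibrium E h \<Otimes>\<^sub>M equilibrium E h))))"
proof -
  interpret nonpolar_compact E by standard (fact assms)+
  have "\<forall>h\<in>contractions E. \<bar>min_energy (perturb h ` E)\<bar> \<noteq> \<infinity>"
    by (simp add: min_energy_perturb)
  moreover have "energy_deriv h q = - (\<integral>(x, y). ((perturb h x - perturb h y) \<bullet> (q x - q y)) /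
      (norm (perturb h x - perturb h y))\<^sup>2 \<partial>(equilibrium E h \<Otimes>\<^sub>M equilibrium E h))" for h q
    by (simp add: energy_deriv_def mean_strain_def strain_def split_beta')
  ultimately show ?thesis
    using C1_energy by blast
qed

end
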